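(* Let $(A,\mathbb{R},\sigma)$ be a C*-dynamical system with $A$ a unital C*-algebra. Let $\mu$ and $\lambda$ be positive linear functionals (PLFs) on $A$ with $N_\lambda\subseteq N_\mu$, and suppose that $\lambda$ is a KMS-PLF for $(A,\mathbb{R},\sigma)$. Then: (i) $\mu\ll_w\lambda$ if and only if $\mu\ll\lambda$; and (ii) $\mu\perp_w\lambda$ if and only if $\mu\perp\lambda$.
   Context: A PLF on a unital C*-algebra $A$ is a positive linear functional $A\to\mathbb{C}$, and $\nu\le\mu$ means $\mu-\nu$ is positive. For a PLF $\tau$, $N_\tau=\{a\in A:\tau(a^*a)=0\}$. C*-dynamical system $(A,\mathbb{R},\sigma)$: a C*-algebra $A$ and a group homomorphism $\sigma:\mathbb{R}\to\mathrm{Aut}(A)$, $t\mapsto\sigma_t$, into the group of $*$-automorphisms such that $(t,a)\mapsto\sigma_t(a)$ is continuous (norm topology on $A$). KMS-PLF: a PLF $\lambda$ on $A$ is a KMS-PLF for $(A,\mathbb{R},\sigma)$ if (1) for each $a\in A$ the map $\mathbb{R}\to A$, $t\mapsto\sigma_t(a)$, has an analytic extension $f_a$ to the strip $\{z\in\mathbb{C}:0<\mathrm{Im}(z)<1\}$ (with continuous boundary values on the closed strip, agreeing with $\sigma_t(a)$ on $\mathbb{R}$), and one writes $\sigma_z(a):=f_a(z)$; (2) $\lambda(ab)=\lambda(b\,\sigma_i(a))$ for all $a,b\in A$; (3) $\lambda\circ\sigma_t=\lambda$ for all $t\in\mathbb{R}$. Let $(\pi_\lambda,L^2(\lambda),\xi_\lambda)$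 be the GNS representation of $\lambda$, with cyclic vector $\xi_\lambda=1+N_\lambda$. Put $L^\infty(\lambda)=\pi_\lambda(A)''\subseteq\mathscr{B}(L^2(\lambda))$, with the weak* topology coming from its predual. If $N_\lambda\subseteq N_\mu$, then $\pi_\lambda(a)\mapsto\mu(a)$ is a well-defined PLF on $\pi_\lambda(A)$. An extension of $\mu$ to $L^\infty(\lambda)$ means a PLF $\hat\mu$ on $L^\infty(\lambda)$ with $\hat\mu(\pi_\lambda(a))=\mu(a)$ for all $a\in A$. For PLFs $\mu,\lambda$ on $A$ with $N_\lambda\subseteq N_\mu$: - $\mu\ll_w\lambda$ (weak* continuous): $\mu$ has an extension to a weak*-continuous PLF on $L^\infty(\lambda)$. - $\mu\perp_w\lambda$ (weak* singular): no extension of $\mu$ to $L^\infty(\lambda)$ majorizes a non-zero weak*-continuous PLF on $L^\infty(\lambda)$. (The zero functional is regarded as both weak* continuous and weak* singular.) - $\mu\ll\lambda$ (absolutely continuous in the sense of Gheondea–Kavruk): there is an increasing sequence $(\mu_n)_{n\in\mathbb{N}}$ of PLFs on $A$ with $\mu_n\uparrow\mu$ pointwise (i.e. in the weak* topology of $A^*$), and for each $n$ there is $t_n>0$ with $\mu_n\le t_n\lambda$. - $\mu\perp\lambda$ (singular): the only PLF majorized by both $\mu$ and $\lambda$ is the zero PLF. *)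

theory Defs
  imports "HOL-Analysis.Analysis"
begin

class scaleC =
  fixes scaleC :: "complex \<Rightarrow> 'a \<Rightarrow> 'a"  (infixr "*\<^sub>C" 75)

text \<open>
  The unit comes from \<^class>\<open>monoid_mult\<close> rather than \<^class>\<open>real_normed_algebra_1\<close>, so that the
  zero algebra is not excluded; if \<open>1 \<noteq> 0\<close> then \<open>norm 1 = 1\<close> follows from the C*-identity.
\<close>

class unital_cstar_algebra = banach + real_normed_algebra + monoid_mult + scaleC +
  fixes star :: "'a \<Rightarrow> 'a"
  assumes scaleC_add_right: "c *\<^sub>C (a + b) = c *\<^sub>C a + c *\<^sub>C b"
    and scaleC_add_left: "(c + d) *\<^sub>C a = c *\<^sub>C a + d *\<^sub>C a"
    and scaleC_scaleC: "c *\<^sub>C d *\<^sub>C a = (c * d) *\<^sub>C a"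
    and scaleR_scaleC: "r *\<^sub>R a = complex_of_real r *\<^sub>C a"
    and norm_scaleC: "norm (c *\<^sub>C a) = cmod c * norm a"
    and mult_scaleC_left: "(c *\<^sub>C a) * b = c *\<^sub>C (a * b)"
    and mult_scaleC_right: "a * (c *\<^sub>C b) = c *\<^sub>C (a * b)"
    and star_add: "star (a + b) = star a + star b"
    and star_scaleC: "star (c *\<^sub>C a) = cnj c *\<^sub>C star a"
    and star_mult: "star (a * b) = star b * star a"
    and star_star: "star (star a) = a"
    and cstar_identity: "norm (star a * a) = (norm a)\<^sup>2"

definition plf :: "('a::unital_cstar_algebra \<Rightarrow> complex) \<Rightarrow> bool" where
  "plf \<tau> \<longleftrightarrow> Vector_Spaces.linear scaleC (*) \<tau> \<and> (\<forall>a. \<tau> (star a * a) \<in> \<real>\<^sub>\<ge>\<^sub>0)"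

definition plf_le :: "('a::unital_cstar_algebra \<Rightarrow> complex) \<Rightarrow> ('a \<Rightarrow> complex) \<Rightarrow> bool" where
  "plf_le \<nu> \<mu> \<longleftrightarrow> plf (\<lambda>a. \<mu> a - \<nu> a)"

definition null_ideal :: "('a::unital_cstar_algebra \<Rightarrow> complex) \<Rightarrow> 'a set" where
  "null_ideal \<tau> = {a. \<tau> (star a * a) = 0}"

definition abs_cont :: "('a::unital_cstar_algebra \<Rightarrow> complex) \<Rightarrow> ('a \<Rightarrow> complex) \<Rightarrow> bool" where
  "abs_cont \<mu> \<tau> \<longleftrightarrow> (\<exists>m :: nat \<Rightarrow> 'a \<Rightarrow> complex.
     (\<forall>n. plf (m n)) \<and> (\<forall>n. plf_le (m n) (m (Suc n))) \<and>
     (\<forall>a. (\<lambda>n. m n a) \<longlonglongrightarrow> \<mu> a) \<and>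
     (\<forall>n. \<exists>t>0. plf_le (m n) (\<lambda>a. complex_of_real t * \<tau> a)))"

definition singular :: "('a::unital_cstar_algebra \<Rightarrow> complex) \<Rightarrow> ('a \<Rightarrow> complex) \<Rightarrow> bool" where
  "singular \<mu> \<tau> \<longleftrightarrow> (\<forall>\<nu>. plf \<nu> \<longrightarrow> plf_le \<nu> \<mu> \<longrightarrow> plf_le \<nu> \<tau> \<longrightarrow> \<nu> = (\<lambda>_. 0))"

definition star_automorphism :: "('a::unital_cstar_algebra \<Rightarrow> 'a) \<Rightarrow> bool" where
  "star_automorphism \<theta> \<longleftrightarrow> bij \<theta> \<and> Vector_Spaces.linear scaleC scaleC \<theta> \<and>
     (\<forall>a b. \<theta> (a * b) = \<theta> a * \<theta> b) \<and> (\<forall>a. \<theta> (star a) = star (\<theta> a))"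

definition cstar_dynamical_system :: "(real \<Rightarrow> 'a::unital_cstar_algebra \<Rightarrow> 'a) \<Rightarrow> bool" where
  "cstar_dynamical_system \<sigma> \<longleftrightarrow>
     (\<forall>t. star_automorphism (\<sigma> t)) \<and> (\<forall>s t. \<sigma> (s + t) = \<sigma> s \<circ> \<sigma> t) \<and>
     continuous_on UNIV (\<lambda>(t, a). \<sigma> t a)"

text \<open>
  Analyticity in the open strip is complex differentiability there: the Frechet derivative is
  of the form \<open>h \<mapsto> h D\<close>. Such an extension is unique on the closed strip, and its value at
  \<open>z\<close> is what is usually written \<open>\<sigma>\<^sub>z(a)\<close>.
\<close>

definition strip_extension ::
  "(real \<Rightarrow> 'a::unital_cstar_algebra \<Rightarrow> 'a) \<Rightarrow> 'a \<Rightarrow> (complex \<Rightarrow> 'a) \<Rightarrow> bool" where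
  "strip_extension \<sigma> a f \<longleftrightarrow>
     continuous_on {z. 0 \<le> Im z \<and> Im z \<le> 1} f \<and>
     (\<forall>z. 0 < Im z \<and> Im z < 1 \<longrightarrow> (\<exists>D. (f has_derivative (\<lambda>h. h *\<^sub>C D)) (at z))) \<and>
     (\<forall>t. f (complex_of_real t) = \<sigma> t a)"

definition kms_plf ::
  "(real \<Rightarrow> 'a::unital_cstar_algebra \<Rightarrow> 'a) \<Rightarrow> ('a \<Rightarrow> complex) \<Rightarrow> bool" where
  "kms_plf \<sigma> \<tau> \<longleftrightarrow> plf \<tau> \<and>
     (\<forall>a. \<exists>f. strip_extension \<sigma> a f \<and> (\<forall>b. \<tau> (a * b) = \<tau> (b * f \<i>))) \<and>
     (\<forall>t. \<tau> \<circ> \<sigma> t = \<tau>)"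

text \<open>
  The GNS space depends on the functional, so Hilbert spaces are records with an explicit
  carrier. The inner product is linear in its first argument.
\<close>

record 'h cspace =
  vecs :: "'h set"
  vadd :: "'h \<Rightarrow> 'h \<Rightarrow> 'h"
  vscale :: "complex \<Rightarrow> 'h \<Rightarrow> 'h"
  vinner :: "'h \<Rightarrow> 'h \<Rightarrow> complex"

definition vnorm :: "'h cspace \<Rightarrow> 'h \<Rightarrow> real" where
  "vnorm H u = sqrt (Re (vinner H u u))"

definition bounded_ops :: "'h cspace \<Rightarrow> ('h \<Rightarrow> 'h) set" where
  "bounded_ops H = {T \<in> vecs H \<rightarrow>\<^sub>E vecs H.
     (\<forall>u\<in>vecs H. \<forall>v\<in>vecs H. T (vadd H u v) = vadd H (T u) (T v)) \<and>
     (\<forall>c. \<forall>u\<in>vecs H. T (vscale H c u) = vscale H c (T u)) \<and>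
     (\<exists>K. \<forall>u\<in>vecs H. vnorm H (T u) \<le> K * vnorm H u)}"

definition op_add :: "'h cspace \<Rightarrow> ('h \<Rightarrow> 'h) \<Rightarrow> ('h \<Rightarrow> 'h) \<Rightarrow> 'h \<Rightarrow> 'h" where
  "op_add H S T = (\<lambda>u\<in>vecs H. vadd H (S u) (T u))"

definition op_scale :: "'h cspace \<Rightarrow> complex \<Rightarrow> ('h \<Rightarrow> 'h) \<Rightarrow> 'h \<Rightarrow> 'h" where
  "op_scale H c T = (\<lambda>u\<in>vecs H. vscale H c (T u))"

definition op_mult :: "'h cspace \<Rightarrow> ('h \<Rightarrow> 'h) \<Rightarrow> ('h \<Rightarrow> 'h) \<Rightarrow> 'h \<Rightarrow> 'h" where
  "op_mult H S T = compose (vecs H) S T"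

definition op_adj :: "'h cspace \<Rightarrow> ('h \<Rightarrow> 'h) \<Rightarrow> 'h \<Rightarrow> 'h" where
  "op_adj H T = (THE S. S \<in> bounded_ops H \<and>
     (\<forall>u\<in>vecs H. \<forall>v\<in>vecs H. vinner H (T u) v = vinner H u (S v)))"

definition commutant :: "'h cspace \<Rightarrow> ('h \<Rightarrow> 'h) set \<Rightarrow> ('h \<Rightarrow> 'h) set" where
  "commutant H M = {T \<in> bounded_ops H. \<forall>S\<in>M. op_mult H T S = op_mult H S T}"

text \<open>In the following, functionals on an operator algebra \<open>M\<close> matter only through their values on \<open>M\<close>.\<close>

definition op_plf :: "'h cspace \<Rightarrow> ('h \<Rightarrow> 'h) set \<Rightarrow> (('h \<Rightarrow> 'h) \<Rightarrow> complex) \<Rightarrow> bool" where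
  "op_plf H M \<phi> \<longleftrightarrow>
     (\<forall>S\<in>M. \<forall>T\<in>M. \<phi> (op_add H S T) = \<phi> S + \<phi> T) \<and>
     (\<forall>c. \<forall>T\<in>M. \<phi> (op_scale H c T) = c * \<phi> T) \<and>
     (\<forall>T\<in>M. \<phi> (op_mult H (op_adj H T) T) \<in> \<real>\<^sub>\<ge>\<^sub>0)"

definition op_plf_le ::
  "'h cspace \<Rightarrow> ('h \<Rightarrow> 'h) set \<Rightarrow> (('h \<Rightarrow> 'h) \<Rightarrow> complex) \<Rightarrow> (('h \<Rightarrow> 'h) \<Rightarrow> complex) \<Rightarrow> bool" where
  "op_plf_le H M \<psi> \<phi> \<longleftrightarrow> op_plf H M (\<lambda>T. \<phi> T - \<psi> T)"

text \<open>
  The predual of a von Neumann algebra \<open>M\<close> on \<open>H\<close> is the trace class modulo the annihilator of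
  \<open>M\<close>, i.e. it consists of the restrictions to \<open>M\<close> of the functionals \<open>T \<mapsto> tr (K T)\<close> with \<open>K\<close>
  of trace class. Writing \<open>K\<close> as a sum of rank-one operators, these are the functionals
  \<open>T \<mapsto> (\<Sum>n. \<langle>T x\<^sub>n, y\<^sub>n\<rangle>)\<close> for square-summable sequences \<open>x\<close>, \<open>y\<close> in \<open>H\<close>. The weak* topology
  is the one they induce on \<open>M\<close> (the ultraweak topology).
\<close>

definition predual_functionals :: "'h cspace \<Rightarrow> (('h \<Rightarrow> 'h) \<Rightarrow> complex) set" where
  "predual_functionals H = {\<lambda>T. \<Sum>n. vinner H (T (x n)) (y n) | x y :: nat \<Rightarrow> 'h.
     range x \<subseteq> vecs H \<and> range y \<subseteq> vecs H \<and>
     summable (\<lambda>n. (vnorm H (x n))\<^sup>2) \<and> summable (\<lambda>n. (vnorm H (y n))\<^sup>2)}"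

definition weak_star_topology :: "'h cspace \<Rightarrow> ('h \<Rightarrow> 'h) set \<Rightarrow> ('h \<Rightarrow> 'h) topology" where
  "weak_star_topology H M =
     topology_generated_by {{T \<in> M. \<omega> T \<in> U} | \<omega> U. \<omega> \<in> predual_functionals H \<and> open U}"

definition weak_star_continuous ::
  "'h cspace \<Rightarrow> ('h \<Rightarrow> 'h) set \<Rightarrow> (('h \<Rightarrow> 'h) \<Rightarrow> complex) \<Rightarrow> bool" where
  "weak_star_continuous H M \<phi> \<longleftrightarrow> continuous_map (weak_star_topology H M) euclidean \<phi>"

definition gns_norm :: "('a::unital_cstar_algebra \<Rightarrow> complex) \<Rightarrow> 'a \<Rightarrow> real" where
  "gns_norm \<tau> a = sqrt (Re (\<tau> (star a * a)))"

text \<open>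
  The GNS space is the completion of \<open>A / N\<^sub>\<tau>\<close> with respect to \<open>\<langle>a + N\<^sub>\<tau>, b + N\<^sub>\<tau>\<rangle> = \<tau> (b\<^sup>* a)\<close>,
  realised as Cauchy sequences modulo null sequences for the seminorm \<^const>\<open>gns_norm\<close>. The
  quotient by \<open>N\<^sub>\<tau>\<close> is taken in the same step: constant sequences \<open>a\<close>, \<open>b\<close> are identified iff
  \<open>a - b \<in> N\<^sub>\<tau>\<close>.
\<close>

definition gns_cauchy :: "('a::unital_cstar_algebra \<Rightarrow> complex) \<Rightarrow> (nat \<Rightarrow> 'a) set" where
  "gns_cauchy \<tau> = {x. \<forall>e>0. \<exists>N. \<forall>m\<ge>N. \<forall>n\<ge>N. gns_norm \<tau> (x m - x n) < e}"

definition gns_rel :: "('a::unital_cstar_algebra \<Rightarrow> complex) \<Rightarrow> ((nat \<Rightarrow> 'a) \<times> (nat \<Rightarrow> 'a)) set" where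
  "gns_rel \<tau> = {(x, y). x \<in> gns_cauchy \<tau> \<and> y \<in> gns_cauchy \<tau> \<and>
     (\<lambda>n. gns_norm \<tau> (x n - y n)) \<longlonglongrightarrow> 0}"

definition gns_space :: "('a::unital_cstar_algebra \<Rightarrow> complex) \<Rightarrow> (nat \<Rightarrow> 'a) set cspace" where
  "gns_space \<tau> = \<lparr>
     vecs = gns_cauchy \<tau> // gns_rel \<tau>,
     vadd = (\<lambda>u v. \<Union>x\<in>u. \<Union>y\<in>v. gns_rel \<tau> `` {\<lambda>n. x n + y n}),
     vscale = (\<lambda>c u. \<Union>x\<in>u. gns_rel \<tau> `` {\<lambda>n. c *\<^sub>C x n}),
     vinner = (\<lambda>u v. THE c. \<forall>x\<in>u. \<forall>y\<in>v. (\<lambda>n. \<tau> (star (y n) * x n)) \<longlonglongrightarrow> c)\<rparr>"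

definition gns_rep ::
  "('a::unital_cstar_algebra \<Rightarrow> complex) \<Rightarrow> 'a \<Rightarrow> (nat \<Rightarrow> 'a) set \<Rightarrow> (nat \<Rightarrow> 'a) set" where
  "gns_rep \<tau> a = (\<lambda>u\<in>vecs (gns_space \<tau>). \<Union>x\<in>u. gns_rel \<tau> `` {\<lambda>n. a * x n})"

definition gns_Linf ::
  "('a::unital_cstar_algebra \<Rightarrow> complex) \<Rightarrow> ((nat \<Rightarrow> 'a) set \<Rightarrow> (nat \<Rightarrow> 'a) set) set" where
  "gns_Linf \<tau> = commutant (gns_space \<tau>) (commutant (gns_space \<tau>) (range (gns_rep \<tau>)))"

definition plf_extension ::
  "('a::unital_cstar_algebra \<Rightarrow> complex) \<Rightarrow> ('a \<Rightarrow> complex) \<Rightarrow>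
   (((nat \<Rightarrow> 'a) set \<Rightarrow> (nat \<Rightarrow> 'a) set) \<Rightarrow> complex) \<Rightarrow> bool" where
  "plf_extension \<tau> \<mu> \<phi> \<longleftrightarrow>
     op_plf (gns_space \<tau>) (gns_Linf \<tau>) \<phi> \<and> (\<forall>a. \<phi> (gns_rep \<tau> a) = \<mu> a)"

definition weak_star_abs_cont ::
  "('a::unital_cstar_algebra \<Rightarrow> complex) \<Rightarrow> ('a \<Rightarrow> complex) \<Rightarrow> bool" where
  "weak_star_abs_cont \<mu> \<tau> \<longleftrightarrow>
     (\<exists>\<phi>. plf_extension \<tau> \<mu> \<phi> \<and> weak_star_continuous (gns_space \<tau>) (gns_Linf \<tau>) \<phi>)"

definition weak_star_singular ::
  "('a::unital_cstar_algebra \<Rightarrow> complex) \<Rightarrow> ('a \<Rightarrow> complex) \<Rightarrow> bool" where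
  "weak_star_singular \<mu> \<tau> \<longleftrightarrow>
     \<not> (\<exists>\<phi> \<psi>. plf_extension \<tau> \<mu> \<phi> \<and>
          op_plf (gns_space \<tau>) (gns_Linf \<tau>) \<psi> \<and>
          weak_star_continuous (gns_space \<tau>) (gns_Linf \<tau>) \<psi> \<and>
          (\<exists>T\<in>gns_Linf \<tau>. \<psi> T \<noteq> 0) \<and>
          op_plf_le (gns_space \<tau>) (gns_Linf \<tau>) \<psi> \<phi>)"

end

theory Submission
  imports Defs
begin

text \<open>
  Of the KMS condition only the following is used: for every \<open>a\<close> there is a \<open>d\<close> with
  \<open>\<lambda>(a b) = \<lambda>(b d)\<close> for all \<open>b\<close>. By the closed graph theorem \<open>d\<close> can be chosen with \<open>\<parallel>d\<parallel> \<le> K \<parallel>a\<parallel>\<close>,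
  and since \<open>a \<mapsto> d\<close> is symmetric for \<open>\<langle>a, b\<rangle> = \<lambda>(b\<^sup>* a)\<close>, an argument of Lax gives
  \<open>\<lambda>(a a\<^sup>*) \<le> K \<lambda>(a\<^sup>* a)\<close>. Hence \<open>\<lambda>(a\<^sub>k\<^sup>* a\<^sub>k) \<rightarrow> 0\<close> implies \<open>\<lambda>(a\<^sub>k a\<^sub>k\<^sup>*) \<rightarrow> 0\<close>, and cutting \<open>a\<^sub>k\<close> off from the
  left by polynomials in \<open>a\<^sub>k a\<^sub>k\<^sup>*\<close> shows \<open>\<mu>(b\<^sup>* a\<^sub>k) \<rightarrow> 0\<close> for every weak* continuous \<open>\<mu>\<close> for which
  \<open>\<mu>(a\<^sub>k\<^sup>* a\<^sub>k)\<close> stays bounded. This makes the \<open>\<lambda>\<close>-singular part of \<open>\<mu>\<close> vanish.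

  Conversely, a functional dominated by a multiple of \<open>\<lambda>\<close> is a sum of vector functionals on
  \<open>L\<^sup>2(\<lambda>)\<close>, by the Radon-Nikodym theorem in the commutant; an increasing sequence of such functionals is
  summed term by term. The statement on singularity is reduced to these facts; in one direction the
  positive functional \<open>\<mu> - \<nu>\<close> on \<open>\<pi>\<^sub>\<lambda>(A)\<close> has to be extended to \<open>L\<^sup>\<infinity>(\<lambda>)\<close> by a Hahn-Banach argument.
\<close>

section \<open>Unital C*-algebras and positive functionals\<close>

text \<open>The obstacle: \<open>\<lambda> (star (a k) * a k)\<close> tending to 0 controls the
  operators of \<open>a k\<close> at the cyclic vector only, whereas a weak* continuous functional
  tests them on a whole square-summable sequence of vectors, and \<open>norm (a k)\<close> need not
  be bounded. Almost traciality meets both points. For self-adjoint elements it makes right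
  multiplication bounded, so smallness at the cyclic vector spreads to a dense set of vectors; and
  since \<open>a k * star (a k)\<close> becomes small, a cutoff \<open>g k\<close> built from it
  tends strongly to the unit, while \<open>g k * a k\<close> has an operator norm that is small
  uniformly in \<open>k\<close>. The outcome is that the form of \<open>\<mu>\<close> is closable
  with respect to that of \<open>\<lambda>\<close>. Spectral theory is avoided throughout. Square
  roots in the algebra come from an iteration. For positive contractions on a Hilbert space, moments
  replace the spectral measure and sums of squares replace the square root, which is why a dominated
  functional is represented by a sequence of vectors and not by a single one.\<close>

lemma scaleC_one_left [simp]: "1 *\<^sub>C (a::'a::unital_cstar_algebra) = a"
  using scaleR_scaleC[of 1 a] by simp

interpretation scaleC: vector_space "scaleC :: complex \<Rightarrow> 'a \<Rightarrow> 'a::unital_cstar_algebra"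
  by unfold_locales (simp_all add: scaleC_add_right scaleC_add_left scaleC_scaleC)

lemma vector_space_mult: "vector_space ((*) :: complex \<Rightarrow> complex \<Rightarrow> complex)"
  by unfold_locales (simp_all add: algebra_simps)

lemma star_zero [simp]: "star (0::'a::unital_cstar_algebra) = 0"
  using star_add[of "0::'a" 0] by simp

lemma star_minus [simp]: "star (- a) = - star (a::'a::unital_cstar_algebra)"
  using star_add[of a "- a"] by (simp add: add_eq_0_iff2)

lemma star_diff: "star (a - b) = star a - star (b::'a::unital_cstar_algebra)"
  using star_add[of a "- b"] by simp

lemma star_one [simp]: "star (1::'a::unital_cstar_algebra) = 1"
  by (metis mult_1_left mult_1_right star_mult star_star)

lemma star_scaleR: "star (r *\<^sub>R a) = r *\<^sub>R star (a::'a::unital_cstar_algebra)"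
  by (simp add: scaleR_scaleC star_scaleC)

lemma star_power: "star (a ^ n) = star (a::'a::unital_cstar_algebra) ^ n"
  by (induction n) (simp_all add: star_mult power_commutes)

text \<open>The C*-identity makes this norm equal to its own square. In the zero algebra it is 0, so
  only an inequality holds in general.\<close>

lemma norm_one_le: "norm (1::'a::unital_cstar_algebra) \<le> 1"
proof -
  have "norm (1::'a) = (norm (1::'a))\<^sup>2"
    using cstar_identity[of "1::'a"] by simp
  then show ?thesis
    by (metis norm_ge_zero order_refl power2_eq_square mult_cancel_right1 zero_le_one)
qed

lemma norm_star: "norm (star (a::'a::unital_cstar_algebra)) = norm a"
proof -
  have "norm b \<le> norm (star b)" for b :: 'a
  proof (cases "norm b = 0")
    case False
    have "norm b * norm b \<le> norm (star b) * norm b"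
      using cstar_identity[of b] norm_mult_ineq[of "star b" b] by (simp add: power2_eq_square)
    with False show ?thesis
      by (simp add: mult_le_cancel_right)
  qed simp
  from this[of a] this[of "star a"] show ?thesis
    by (simp add: star_star)
qed

lemma norm_square_selfadjoint: "star a = a \<Longrightarrow> norm (a * a) = (norm (a::'a::unital_cstar_algebra))\<^sup>2"
  using cstar_identity[of a] by simp

lemma bounded_linear_star: "bounded_linear (star :: 'a::unital_cstar_algebra \<Rightarrow> 'a)"
  by (rule bounded_linear_intro[of _ 1]) (simp_all add: star_add star_scaleR norm_star)

section \<open>Square roots in a C*-algebra\<close>

lemma Cauchy_of_dominated_steps:
  fixes y :: "nat \<Rightarrow> 'b::real_normed_vector"
  assumes step: "\<And>n. norm (y (Suc n) - y n) \<le> r (Suc n) - r n" and r: "Cauchy r"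
  shows "Cauchy y"
proof -
  have mn: "norm (y (n + k) - y n) \<le> r (n + k) - r n" for n k
  proof (induction k)
    case (Suc k)
    have "norm (y (n + Suc k) - y n) \<le> norm (y (Suc (n + k)) - y (n + k)) + norm (y (n + k) - y n)"
      using norm_triangle_ineq[of "y (Suc (n + k)) - y (n + k)" "y (n + k) - y n"] by simp
    then show ?case
      using step[of "n + k"] Suc by simp
  qed simp
  have le: "norm (y m - y n) \<le> \<bar>r m - r n\<bar>" for m n
  proof (cases "n \<le> m")
    case True
    then show ?thesis using mn[of n "m - n"] by simp
  next
    case False
    then show ?thesis using mn[of m "n - m"] by (simp add: norm_minus_commute)
  qed
  show ?thesis
    unfolding Cauchy_def dist_norm using le r[unfolded Cauchy_def dist_norm real_norm_def]
    by (meson order_le_less_trans)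
qed

text \<open>The scalar recursion majorizes the recursion \<open>y\<^sub>n\<^sub>+\<^sub>1 = (x + y\<^sub>n\<^sup>2) / 2\<close>, whose limit
  solves \<open>(1 - y)\<^sup>2 = 1 - x\<close>.\<close>

primrec sqrt_majorant :: "nat \<Rightarrow> real" where
  "sqrt_majorant 0 = 0"
| "sqrt_majorant (Suc n) = (1 + (sqrt_majorant n)\<^sup>2) / 2"

primrec sqrt_iter :: "'a::unital_cstar_algebra \<Rightarrow> nat \<Rightarrow> 'a" where
  "sqrt_iter x 0 = 0"
| "sqrt_iter x (Suc n) = (1 / 2) *\<^sub>R (x + sqrt_iter x n * sqrt_iter x n)"

lemma sqrt_majorant_bounds: "0 \<le> sqrt_majorant n" "sqrt_majorant n \<le> 1"
proof -
  have "0 \<le> sqrt_majorant n \<and> sqrt_majorant n \<le> 1"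
    by (induction n) (auto simp: power_le_one)
  then show "0 \<le> sqrt_majorant n" "sqrt_majorant n \<le> 1" by auto
qed

lemma sqrt_majorant_mono: "sqrt_majorant n \<le> sqrt_majorant (Suc n)"
proof -
  have "0 \<le> (1 - sqrt_majorant n)\<^sup>2" by simp
  then show ?thesis by (simp add: power2_eq_square algebra_simps)
qed

lemma Cauchy_sqrt_majorant: "Cauchy sqrt_majorant"
proof -
  have "incseq sqrt_majorant"
    by (rule incseq_SucI) (rule sqrt_majorant_mono)
  then have "convergent sqrt_majorant"
    using sqrt_majorant_bounds(2) by (meson incseq_convergent convergentI)
  then show ?thesis by (rule convergent_Cauchy)
qed

text \<open>Stand-in for the functional calculus: \<open>s\<close> is a limit of polynomials in
  \<open>x\<close>, hence self-adjoint and commuting with whatever commutes with \<open>x\<close>.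
  The bound on \<open>1 - s\<close> allows a second application, to \<open>1 - s\<close>, yielding a
  root of \<open>s\<close> itself. For \<open>norm x = 1\<close> the steps need not decay
  geometrically; they are compared with the increments of the bounded monotone
  \<open>sqrt_majorant\<close>.\<close>

lemma sqrt_exists:
  fixes x :: "'a::unital_cstar_algebra"
  assumes sa: "star x = x" and nx: "norm x \<le> 1"
  obtains s where "star s = s" "s * s = 1 - x" "norm (1 - s) \<le> 1"
    "\<And>b. b * x = x * b \<Longrightarrow> b * s = s * b"
proof -
  let ?y = "sqrt_iter x"
  have comm: "b * ?y n = ?y n * b" if "b * x = x * b" for b n
  proof (induction n)
    case (Suc n)
    have "b * (?y n * ?y n) = ?y n * ?y n * b"
      by (metis Suc mult.assoc)
    then show ?case using that by (simp add: algebra_simps)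
  qed simp
  \<comment> \<open>The iterates are polynomials in \<open>x\<close>; their commutation lets the
    difference of squares below factor.\<close>
  have ycomm: "?y m * ?y n = ?y n * ?y m" for m n
    by (rule comm) (rule comm[symmetric], rule refl)
  have sy: "star (?y n) = ?y n" for n
    by (induction n) (simp_all add: star_scaleR star_add star_mult sa)
  have ny: "norm (?y n) \<le> sqrt_majorant n" for n
  proof (induction n)
    case (Suc n)
    have "norm (x + ?y n * ?y n) \<le> 1 + sqrt_majorant n * sqrt_majorant n"
      using norm_triangle_ineq[of x "?y n * ?y n"] norm_mult_ineq[of "?y n" "?y n"] nx
        mult_mono[OF Suc Suc sqrt_majorant_bounds(1) norm_ge_zero] by linarith
    then show ?case by (simp add: power2_eq_square)
  qed simp
  have step: "norm (?y (Suc n) - ?y n) \<le> sqrt_majorant (Suc n) - sqrt_majorant n" for n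
  proof (induction n)
    case 0
    show ?case using nx by simp
  next
    case (Suc n)
    have "?y (Suc (Suc n)) - ?y (Suc n) = (1 / 2) *\<^sub>R (?y (Suc n) * ?y (Suc n) - ?y n * ?y n)"
      by (subst (1 2) sqrt_iter.simps(2)) (simp add: scaleR_diff_right[symmetric] del: sqrt_iter.simps)
    also have "?y (Suc n) * ?y (Suc n) - ?y n * ?y n = (?y (Suc n) - ?y n) * (?y (Suc n) + ?y n)"
      using ycomm[of n "Suc n"] by (simp add: algebra_simps del: sqrt_iter.simps)
    finally have "norm (?y (Suc (Suc n)) - ?y (Suc n)) \<le>
        (1/2) * (norm (?y (Suc n) - ?y n) * norm (?y (Suc n) + ?y n))"
      by (simp add: norm_mult_ineq del: sqrt_iter.simps)
    also have "\<dots> \<le> (1/2) * ((sqrt_majorant (Suc n) - sqrt_majorant n) * (sqrt_majorant (Suc n) + sqrt_majorant n))"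
    proof -
      have "norm (?y (Suc n) + ?y n) \<le> sqrt_majorant (Suc n) + sqrt_majorant n"
        using ny[of n] ny[of "Suc n"] norm_triangle_ineq[of "?y (Suc n)" "?y n"] by linarith
      with Suc show ?thesis
        by (intro mult_left_mono mult_mono)
           (use sqrt_majorant_mono[of n] in \<open>auto simp del: sqrt_iter.simps sqrt_majorant.simps\<close>)
    qed
    also have "\<dots> = sqrt_majorant (Suc (Suc n)) - sqrt_majorant (Suc n)"
    proof -
      have *: "(1/2) * ((b - a) * (b + a)) = c - b" if "c = (1 + b\<^sup>2) / 2" "b = (1 + a\<^sup>2) / 2" for a b c :: real
      proof -
        have "c - b = (1 + b\<^sup>2) / 2 - (1 + a\<^sup>2) / 2" using that by linarith
        then show ?thesis by (simp add: power2_eq_square field_simps)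
      qed
      show ?thesis by (rule *[OF sqrt_majorant.simps(2) sqrt_majorant.simps(2)])
    qed
    finally show ?case .
  qed
  have "Cauchy ?y"
    by (rule Cauchy_of_dominated_steps[OF step Cauchy_sqrt_majorant])
  then obtain y where lim: "?y \<longlonglongrightarrow> y"
    using Cauchy_convergent convergent_def by blast
  have "(\<lambda>n. ?y (Suc n)) \<longlonglongrightarrow> (1/2) *\<^sub>R (x + y * y)"
    by simp (intro tendsto_intros lim)
  moreover have "(\<lambda>n. ?y (Suc n)) \<longlonglongrightarrow> y"
    using lim by (rule LIMSEQ_Suc)
  ultimately have eq: "y = (1/2) *\<^sub>R (x + y * y)"
    using LIMSEQ_unique by blast
  then have "y + y = x + y * y"
    by (metis scaleR_half_double scaleR_right_distrib)
  then have sq: "(1 - y) * (1 - y) = 1 - x"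
    by (simp add: algebra_simps)
  have "(\<lambda>n. star (?y n)) \<longlonglongrightarrow> star y"
    by (rule bounded_linear.tendsto[OF bounded_linear_star lim])
  then have "star y = y"
    using lim sy LIMSEQ_unique by simp
  moreover have "norm y \<le> 1"
    by (rule LIMSEQ_le_const2[OF tendsto_norm[OF lim]])
       (meson ny order_trans sqrt_majorant_bounds(2))
  moreover have "b * y = y * b" if "b * x = x * b" for b
  proof -
    have "(\<lambda>n. b * ?y n) \<longlonglongrightarrow> b * y" "(\<lambda>n. ?y n * b) \<longlonglongrightarrow> y * b"
      by (intro tendsto_intros lim)+
    then show ?thesis using comm[OF that] LIMSEQ_unique by simp
  qed
  ultimately have y: "star y = y" "norm y \<le> 1" "\<And>b. b * x = x * b \<Longrightarrow> b * y = y * b"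
    by blast+
  show ?thesis
  proof (rule that[of "1 - y"])
    show "star (1 - y) = 1 - y" by (simp add: star_diff y)
    show "(1 - y) * (1 - y) = 1 - x" by (rule sq)
    show "norm (1 - (1 - y)) \<le> 1" using y by simp
    show "b * (1 - y) = (1 - y) * b" if "b * x = x * b" for b
      using y(3)[OF that] by (simp add: right_diff_distrib left_diff_distrib)
  qed
qed

text \<open>Needed so that \<open>sqrt_exists\<close> applies to \<open>x = 1 - k * k\<close>, where
  it yields the absolute value of \<open>k\<close> as a root of \<open>k * k\<close>.\<close>

lemma norm_one_minus_square_le:
  fixes k :: "'a::unital_cstar_algebra"
  assumes sa: "star k = k" and nk: "norm k \<le> 1"
  shows "norm (1 - k * k) \<le> 1"
proof -
  have "norm (k * k) \<le> 1"
    using norm_square_selfadjoint[OF sa] nk by (simp add: power_le_one)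
  moreover have "star (k * k) = k * k"
    by (simp add: star_mult sa)
  ultimately obtain s where s: "star s = s" "s * s = 1 - k * k"
    and "\<And>b. b * (k * k) = (k * k) * b \<Longrightarrow> b * s = s * b"
    using sqrt_exists[of "k * k"] by blast
  then have ks: "k * s = s * k" by (simp add: mult.assoc)
  \<comment> \<open>\<open>s + \<i> k\<close> is unitary and \<open>s\<close> is its real part.\<close>
  define u where "u = s + \<i> *\<^sub>C k"
  have su: "star u = s - \<i> *\<^sub>C k"
    by (simp add: u_def star_add star_scaleC s sa)
  have "star u * u = s * s + k * k"
    unfolding su unfolding u_def
    by (simp add: distrib_left left_diff_distrib mult_scaleC_left mult_scaleC_right scaleC_scaleC
        scaleC.scale_right_diff_distrib scaleC.scale_right_distrib ks)
  then have "star u * u = 1" using s by simp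
  then have "(norm u)\<^sup>2 \<le> 1"
    using cstar_identity[of u] norm_one_le[where 'a='a] by simp
  then have "norm u \<le> 1" by (simp add: power_le_one_iff)
  moreover have "s + s = u + star u" unfolding su unfolding u_def by simp
  ultimately have "norm (s + s) \<le> 2"
    using norm_triangle_ineq[of u "star u"] norm_star[of u] by simp
  then have "norm s \<le> 1"
    by (metis norm_scaleR scaleR_2 abs_numeral mult_le_cancel_left_pos mult.right_neutral zero_less_numeral)
  then show ?thesis
    using norm_square_selfadjoint[OF s(1)] s(2) by (simp add: power_le_one)
qed

text \<open>Here \<open>p\<close> and \<open>q\<close> are the diagonal values and \<open>z\<close>
  is the mixed value of a positive sesquilinear form. Stated for numbers, it serves functionals,
  inner products and operator forms alike; with \<open>p = 0\<close> or \<open>q = 0\<close> it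
  forces \<open>z = 0\<close>.\<close>

lemma cauchy_schwarz_of_nonneg:
  fixes z :: complex and p q :: real
  assumes nonneg: "\<And>c. 0 \<le> p + 2 * Re (c * z) + (cmod c)\<^sup>2 * q" and q: "0 \<le> q"
  shows "(cmod z)\<^sup>2 \<le> p * q"
proof (cases "q = 0")
  case True
  have "z = 0"
  proof (rule ccontr)
    assume "z \<noteq> 0"
    \<comment> \<open>With \<open>q = 0\<close> the expression is affine along this ray. This length
      brings it down to \<open>- p - 2\<close>, while \<open>c = 0\<close> gives
      \<open>0 \<le> p\<close>.\<close>
    define t where "t = (p + 1) / (cmod z)\<^sup>2"
    have "0 \<le> p + 2 * Re (- (of_real t * cnj z) * z)"
      using nonneg[of "- (of_real t * cnj z)"] True by simp
    also have "cnj z * z = of_real ((cmod z)\<^sup>2)"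
      by (metis complex_norm_square mult.commute of_real_power)
    then have "Re (- (of_real t * cnj z) * z) = - t * (cmod z)\<^sup>2"
      by (simp add: mult.assoc)
    also have "p + 2 * (- t * (cmod z)\<^sup>2) = - p - 2"
      using \<open>z \<noteq> 0\<close> by (simp add: t_def)
    finally show False using nonneg[of 0] by simp
  qed
  then show ?thesis using True by simp
next
  case False
  with q have q: "q > 0" by simp
  have zz: "cnj z * z = of_real ((cmod z)\<^sup>2)"
    by (metis complex_norm_square mult.commute of_real_power)
  \<comment> \<open>The minimizer of the quadratic expression.\<close>
  define c where "c = - (of_real (1/q) * cnj z)"
  have "c * z = of_real (- (1/q) * (cmod z)\<^sup>2)"
    unfolding c_def using zz by (simp add: mult.assoc)
  then have "Re (c * z) = - (1/q) * (cmod z)\<^sup>2"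
    by simp
  moreover have "(cmod c)\<^sup>2 * q = (1/q) * (cmod z)\<^sup>2"
    using q by (simp add: c_def norm_mult norm_divide power2_eq_square field_simps)
  ultimately have "0 \<le> p - (1/q) * (cmod z)\<^sup>2"
    using nonneg[of c] by simp
  then show ?thesis using q by (simp add: field_simps)
qed

text \<open>Polarization: \<open>x\<close> and \<open>y\<close> are the two mixed values of a form,
  and the assumptions express that its values at \<open>a + b\<close> and at
  \<open>a + \<i> b\<close> are real.\<close>

lemma hermitian_of_real_parts:
  assumes "Im (x + y) = 0" "Im (\<i> * x - \<i> * y) = 0"
  shows "x = cnj y"
  using assms by (auto simp: complex_eq_iff)

section \<open>Positive functionals: Cauchy-Schwarz inequality and automatic continuity\<close>

lemma plfI:
  assumes "\<And>a b. \<tau> (a + b) = \<tau> a + \<tau> b" "\<And>c a. \<tau> (c *\<^sub>C a) = c * \<tau> a"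
    "\<And>a. Im (\<tau> (star a * a)) = 0" "\<And>a. 0 \<le> Re (\<tau> (star a * a))"
  shows "plf \<tau>"
  unfolding plf_def Vector_Spaces.linear_def module_hom_def module_hom_axioms_def module_iff_vector_space
  using assms scaleC.vector_space_axioms vector_space_mult
  by (auto simp: complex_nonneg_Reals_iff)

context
  fixes \<tau> :: "'a::unital_cstar_algebra \<Rightarrow> complex"
  assumes plf: "plf \<tau>"
begin

lemma plf_linear: "Vector_Spaces.linear scaleC (*) \<tau>"
  using plf by (simp add: plf_def)

lemma plf_add: "\<tau> (a + b) = \<tau> a + \<tau> b"
  using plf_linear by (simp add: Vector_Spaces.linear_iff)

lemma plf_scale: "\<tau> (c *\<^sub>C a) = c * \<tau> a"
  using plf_linear by (simp add: Vector_Spaces.linear_iff)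

lemma plf_scaleR: "\<tau> (r *\<^sub>R a) = of_real r * \<tau> a"
  by (simp add: scaleR_scaleC plf_scale)

lemma plf_zero: "\<tau> 0 = 0"
  using plf_add[of 0 0] by simp

lemma plf_minus: "\<tau> (- a) = - \<tau> a"
  using plf_add[of a "- a"] plf_zero by (simp add: add_eq_0_iff2)

lemma plf_diff: "\<tau> (a - b) = \<tau> a - \<tau> b"
  using plf_add[of a "- b"] plf_minus by simp

lemma plf_nonneg: "0 \<le> Re (\<tau> (star a * a))" "Im (\<tau> (star a * a)) = 0"
  using plf by (simp_all add: plf_def complex_nonneg_Reals_iff)

lemma plf_hermitian: "\<tau> (star a * b) = cnj (\<tau> (star b * a))"
proof (rule hermitian_of_real_parts)
  have "star (a + b) * (a + b) = star a * a + star b * b + (star a * b + star b * a)"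
    by (simp add: star_add algebra_simps)
  then show "Im (\<tau> (star a * b) + \<tau> (star b * a)) = 0"
    using plf_nonneg(2)[of "a + b"] plf_nonneg(2)[of a] plf_nonneg(2)[of b] by (simp add: plf_add)
  have "star (a + \<i> *\<^sub>C b) * (a + \<i> *\<^sub>C b)
      = star a * a + star b * b + (\<i> *\<^sub>C (star a * b) - \<i> *\<^sub>C (star b * a))"
    by (simp add: star_add star_scaleC algebra_simps mult_scaleC_left mult_scaleC_right scaleC_scaleC)
  then show "Im (\<i> * \<tau> (star a * b) - \<i> * \<tau> (star b * a)) = 0"
    using plf_nonneg(2)[of "a + \<i> *\<^sub>C b"] plf_nonneg(2)[of a] plf_nonneg(2)[of b]
    by (simp add: plf_add plf_diff plf_scale)
qed

lemma plf_star: "\<tau> (star a) = cnj (\<tau> a)"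
  using plf_hermitian[of a 1] by simp

lemma plf_cauchy_schwarz:
  "(cmod (\<tau> (star b * a)))\<^sup>2 \<le> Re (\<tau> (star a * a)) * Re (\<tau> (star b * b))"
proof (rule cauchy_schwarz_of_nonneg)
  fix c
  have "star (a + cnj c *\<^sub>C b) * (a + cnj c *\<^sub>C b)
      = star a * a + c *\<^sub>C (star b * a) + cnj c *\<^sub>C (star a * b) + (cnj c * c) *\<^sub>C (star b * b)"
    by (simp add: star_add star_scaleC algebra_simps mult_scaleC_left mult_scaleC_right scaleC_scaleC)
  then have "Re (\<tau> (star (a + cnj c *\<^sub>C b) * (a + cnj c *\<^sub>C b)))
     = Re (\<tau> (star a * a)) + Re (c * \<tau> (star b * a)) + Re (cnj c * cnj (\<tau> (star b * a))) + Re (cnj c * c * \<tau> (star b * b))"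
    by (simp only: plf_add plf_scale plf_hermitian[of a b] plus_complex.sel)
  also have "Re (cnj c * cnj (\<tau> (star b * a))) = Re (c * \<tau> (star b * a))"
    by simp
  also have "Re (cnj c * c * \<tau> (star b * b)) = (cmod c)\<^sup>2 * Re (\<tau> (star b * b))"
    using plf_nonneg(2)[of b] unfolding cmod_power2 by (simp add: power2_eq_square)
  finally show "0 \<le> Re (\<tau> (star a * a)) + 2 * Re (c * \<tau> (star b * a)) + (cmod c)\<^sup>2 * Re (\<tau> (star b * b))"
    using plf_nonneg(1)[of "a + cnj c *\<^sub>C b"] by simp
qed (rule plf_nonneg)

text \<open>After normalization \<open>1 - x\<close> is a square by \<open>sqrt_exists\<close>, so
  \<open>\<tau>\<close> is non-negative on it.\<close>

lemma plf_square_le_norm: "Re (\<tau> (star a * a)) \<le> (norm a)\<^sup>2 * Re (\<tau> 1)"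
proof (cases "a = 0")
  case False
  define x where "x = (1 / (norm a)\<^sup>2) *\<^sub>R (star a * a)"
  have "star x = x" by (simp add: x_def star_scaleR star_mult star_star)
  moreover have "norm x \<le> 1" using False by (simp add: x_def cstar_identity)
  ultimately obtain s where s: "star s = s" "s * s = 1 - x"
    using sqrt_exists by metis
  have "0 \<le> Re (\<tau> (1 - x))"
    using plf_nonneg(1)[of s] s by simp
  then have "Re (\<tau> x) \<le> Re (\<tau> 1)" by (simp add: plf_diff)
  moreover have "Re (\<tau> x) = Re (\<tau> (star a * a)) / (norm a)\<^sup>2"
    by (simp add: x_def plf_scaleR)
  ultimately show ?thesis using False by (simp add: field_simps)
qed (simp add: plf_zero)

lemma plf_one_nonneg: "0 \<le> Re (\<tau> 1)" "Im (\<tau> 1) = 0"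
  using plf_nonneg[of 1] by simp_all

lemma plf_bounded: "cmod (\<tau> a) \<le> norm a * Re (\<tau> 1)"
proof -
  have "(cmod (\<tau> a))\<^sup>2 \<le> Re (\<tau> (star a * a)) * Re (\<tau> 1)"
    using plf_cauchy_schwarz[of 1 a] by simp
  also have "\<dots> \<le> ((norm a)\<^sup>2 * Re (\<tau> 1)) * Re (\<tau> 1)"
    by (intro mult_right_mono plf_square_le_norm plf_one_nonneg)
  also have "\<dots> = (norm a * Re (\<tau> 1))\<^sup>2" by (simp add: power2_eq_square)
  finally show ?thesis
    using plf_one_nonneg by (simp add: power2_le_iff_abs_le)
qed

lemma plf_bounded_linear: "bounded_linear \<tau>"
  by (rule bounded_linear_intro[of _ "Re (\<tau> 1)"])
     (simp_all add: plf_add plf_scaleR plf_bounded scaleR_conv_of_real)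

lemma plf_vanish: "\<tau> (star a * a) = 0 \<Longrightarrow> \<tau> (b * a) = 0"
  using plf_cauchy_schwarz[of "star b" a] by (simp add: star_star)

lemma plf_conj: "plf (\<lambda>a. \<tau> (star d * a * d))"
proof (rule plfI)
  fix a
  have "star d * (star a * a) * d = star (a * d) * (a * d)"
    by (simp add: star_mult mult.assoc)
  then show "Im (\<tau> (star d * (star a * a) * d)) = 0" "0 \<le> Re (\<tau> (star d * (star a * a) * d))"
    using plf_nonneg[of "a * d"] by simp_all
qed (simp_all add: algebra_simps plf_add mult_scaleC_left mult_scaleC_right plf_scale)

lemma plf_scale_pos: "0 \<le> r \<Longrightarrow> plf (\<lambda>a. of_real r * \<tau> a)"
  by (rule plfI) (simp_all add: plf_add plf_scale plf_nonneg algebra_simps)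

end

lemma plf_plus: "plf \<mu> \<Longrightarrow> plf \<tau> \<Longrightarrow> plf (\<lambda>a. \<mu> a + \<tau> a)"
  by (rule plfI) (simp_all add: plf_add plf_scale plf_nonneg algebra_simps)

section \<open>A functional with everywhere defined modular automorphism is almost tracial\<close>

text \<open>Log-convexity makes the ratios \<open>U (Suc n) / U n\<close> non-decreasing, so a first
  ratio above \<open>L\<close> would force geometric growth faster than
  \<open>L ^ n\<close>.\<close>

lemma log_convex_growth:
  fixes U :: "nat \<Rightarrow> real"
  assumes nn: "\<And>n. 0 \<le> U n" and lc: "\<And>n. (U (Suc n))\<^sup>2 \<le> U n * U (Suc (Suc n))"
    and bd: "\<And>n. U n \<le> M * L ^ n" and L: "0 < L"
  shows "U 1 \<le> L * U 0"
proof (rule ccontr)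
  assume "\<not> U 1 \<le> L * U 0"
  then have gt: "U 1 > L * U 0" by simp
  have "U 0 \<noteq> 0"
  proof
    assume "U 0 = 0"
    then have "(U (Suc 0))\<^sup>2 \<le> 0" using lc[of 0] by simp
    then show False using gt \<open>U 0 = 0\<close> by simp
  qed
  then have U0: "U 0 > 0" using nn[of 0] by simp
  define \<rho> where "\<rho> = U 1 / U 0"
  have \<rho>: "\<rho> > L" using gt U0 by (simp add: \<rho>_def field_simps)
  have step: "U n > 0 \<and> U (Suc n) \<ge> \<rho> * U n" for n
  proof (induction n)
    case 0
    then show ?case using U0 by (simp add: \<rho>_def)
  next
    case (Suc n)
    have p: "U (Suc n) > 0"
      using Suc \<rho> L by (meson less_le_trans less_trans mult_pos_pos)
    have "\<rho> * U n * U (Suc n) \<le> U (Suc n) * U (Suc n)"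
      using Suc p by (intro mult_right_mono) auto
    also have "\<dots> \<le> U n * U (Suc (Suc n))"
      using lc[of n] by (simp add: power2_eq_square)
    finally have "U n * (\<rho> * U (Suc n)) \<le> U n * U (Suc (Suc n))"
      by (simp add: mult_ac)
    then show ?case using p Suc by (simp add: mult_le_cancel_left)
  qed
  have pw: "\<rho> ^ n * U 0 \<le> U n" for n
  proof (induction n)
    case (Suc n)
    have "\<rho> ^ Suc n * U 0 = \<rho> * (\<rho> ^ n * U 0)" by simp
    also have "\<dots> \<le> \<rho> * U n" using Suc \<rho> L by (intro mult_left_mono) auto
    finally show ?case using step[of n] by linarith
  qed simp
  have r: "\<rho> / L > 1" using \<rho> L by simp
  obtain n where "M / U 0 < (\<rho> / L) ^ n"
    using real_arch_pow[OF r] by blast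
  then have "M * L ^ n < \<rho> ^ n * U 0"
    using U0 L by (simp add: power_divide field_simps)
  then show False using pw[of n] bd[of n] by simp
qed

text \<open>The graph of \<open>a \<mapsto> d + N\<^sub>\<tau>\<close> is closed, so the closed graph argument applies to the quotient
  by \<open>N\<^sub>\<tau>\<close>; representatives \<open>d\<close> are chosen along the way.\<close>

lemma twisted_trace_bounded:
  fixes \<tau> :: "'a::unital_cstar_algebra \<Rightarrow> complex"
  assumes plf: "plf \<tau>" and tw: "\<And>a. \<exists>d. \<forall>b. \<tau> (a * b) = \<tau> (b * d)"
  obtains K where "0 < K" "\<And>a. \<exists>d. norm d \<le> K * norm a \<and> (\<forall>b. \<tau> (a * b) = \<tau> (b * d))"
proof -
  define R where "R a d \<longleftrightarrow> (\<forall>b. \<tau> (a * b) = \<tau> (b * d))" for a d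
  have R_diff: "R (a - a') (d - d')" if "R a d" "R a' d'" for a a' d d'
    using that by (simp add: R_def left_diff_distrib right_diff_distrib plf_diff[OF plf])
  have R_scale: "R (r *\<^sub>R a) (r *\<^sub>R d)" if "R a d" for r a d
    using that by (simp add: R_def plf_scaleR[OF plf])
  define E where "E m = {a. \<exists>d. norm d \<le> real m \<and> R a d}" for m
  have "\<exists>m. interior (closure (E m)) \<noteq> {}"
  proof (rule ccontr)
    assume neg: "\<not> (\<exists>m. interior (closure (E m)) \<noteq> {})"
    have "euclidean interior_of \<Union> (range (\<lambda>m. closure (E m))) = {}"
    proof (rule Baire_category_alt)
      show "completely_metrizable_space (euclidean :: 'a topology) \<or>
          locally_compact_space (euclidean :: 'a topology) \<and> regular_space (euclidean :: 'a topology)"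
        by (simp add: completely_metrizable_space_euclidean)
    qed (use neg in \<open>auto simp: euclidean_interior_of\<close>)
    moreover have "a \<in> (\<Union>m. closure (E m))" for a
    proof -
      obtain d where "R a d" using tw[of a] by (auto simp: R_def)
      moreover obtain m where "norm d \<le> real m" using real_arch_simple by blast
      ultimately have "a \<in> E m" by (auto simp: E_def)
      then show ?thesis using closure_subset by blast
    qed
    then have "(\<Union>m. closure (E m)) = UNIV" by blast
    ultimately show False by simp
  qed
  then obtain m a0 r where r: "r > 0" "ball a0 r \<subseteq> closure (E m)"
    by (metis all_not_in_conv mem_interior)
  \<comment> \<open>A difference of two elements of \<open>E m\<close> costs
    \<open>2 * real m\<close>, and rescaling from norm \<open>r / 2\<close> to \<open>norm a\<close>
    costs the factor \<open>2 * norm a / r\<close>.\<close>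
  define c where "c = 4 * real m / r"
  have c: "c \<ge> 0" using r by (simp add: c_def)
  have approx0: "\<exists>a' d. R a' d \<and> norm d \<le> 2 * real m \<and> norm (a - a') \<le> e"
    if "norm a < r" "e > 0" for a e
  proof -
    have e2: "e / 2 > 0" using that by simp
    have "a0 + a \<in> closure (E m)" "a0 \<in> closure (E m)"
      using r that by (auto simp: dist_norm subset_eq)
    then obtain e1 e2 where e: "e1 \<in> E m" "dist e1 (a0 + a) < e/2" "e2 \<in> E m" "dist e2 a0 < e/2"
      unfolding closure_approachable using e2 by meson
    then obtain d1 d2 where d: "R e1 d1" "norm d1 \<le> real m" "R e2 d2" "norm d2 \<le> real m"
      by (auto simp: E_def)
    have "norm (a - (e1 - e2)) = norm ((e2 - a0) - (e1 - (a0 + a)))"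
      by (simp add: algebra_simps)
    also have "\<dots> \<le> e"
      using e norm_triangle_ineq4[of "e2 - a0" "e1 - (a0 + a)"] by (simp add: dist_norm)
    finally show ?thesis
      using R_diff[OF d(1,3)] d norm_triangle_ineq4[of d1 d2] by (intro exI[of _ "e1 - e2"] exI[of _ "d1 - d2"]) auto
  qed
  have approx: "\<exists>a' d. R a' d \<and> norm d \<le> c * norm a \<and> norm (a - a') \<le> norm a / 2" for a
  proof (cases "a = 0")
    case True
    have "R 0 0" by (simp add: R_def plf_zero[OF plf])
    then show ?thesis using True by (intro exI[of _ 0]) auto
  next
    case False
    define t where "t = r / (2 * norm a)"
    have t: "t > 0" using r False by (simp add: t_def)
    have "norm (t *\<^sub>R a) < r" using r False by (simp add: t_def)
    then obtain a' d where ad: "R a' d" "norm d \<le> 2 * real m" "norm (t *\<^sub>R a - a') \<le> t * norm a / 2"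
      using approx0[of "t *\<^sub>R a" "t * norm a / 2"] t False by auto
    have "a - (1/t) *\<^sub>R a' = (1/t) *\<^sub>R (t *\<^sub>R a - a')"
      using t by (simp add: scaleR_diff_right)
    then have "norm (a - (1/t) *\<^sub>R a') = (1/t) * norm (t *\<^sub>R a - a')"
      using t by simp
    also have "\<dots> \<le> (1/t) * (t * norm a / 2)"
      using ad t by (intro mult_left_mono) auto
    also have "\<dots> = norm a / 2" using t by simp
    finally have 1: "norm (a - (1/t) *\<^sub>R a') \<le> norm a / 2" .
    have "norm ((1/t) *\<^sub>R d) = (1/t) * norm d" using t by simp
    also have "\<dots> \<le> (1/t) * (2 * real m)" using ad t by (intro mult_left_mono) auto
    also have "\<dots> = c * norm a" using r False by (simp add: t_def c_def)
    finally show ?thesis using 1 R_scale[OF ad(1), of "1/t"] by blast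
  qed
  obtain p q where pq: "\<And>a. R (p a) (q a)" "\<And>a. norm (q a) \<le> c * norm a" "\<And>a. norm (a - p a) \<le> norm a / 2"
    using approx by metis
  \<comment> \<open>Successive approximation: each correction at least halves the remainder, and the
    bounds on \<open>q (x n)\<close> add up to \<open>2 * c * norm a\<close>. The added 1 makes the
    constant positive even if \<open>c = 0\<close>.\<close>
  have "\<exists>d. norm d \<le> (2 * c + 1) * norm a \<and> R a d" for a
  proof -
    define x where "x n = ((\<lambda>a. a - p a) ^^ n) a" for n
    have x0: "x 0 = a" and xS: "x (Suc n) = x n - p (x n)" for n
      by (simp_all add: x_def)
    have nx: "norm (x n) \<le> norm a * (1/2) ^ n" for n
    proof (induction n)
      case (Suc n)
      then show ?case using pq(3)[of "x n"] by (simp add: xS)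
    qed (simp add: x0)
    have nq: "norm (q (x n)) \<le> c * norm a * (1/2) ^ n" for n
      using pq(2)[of "x n"] mult_left_mono[OF nx[of n] c] by (simp add: mult.assoc)
    have geo: "(\<lambda>n. c * norm a * (1/2) ^ n) sums (c * norm a * 2)"
      using sums_mult[OF geometric_sums[of "1/2::real"]] by simp
    have summ: "summable (\<lambda>n. q (x n))"
      by (rule summable_comparison_test'[OF sums_summable[OF geo]]) (use nq in auto)
    define y where "y = (\<Sum>n. q (x n))"
    have "norm y \<le> (\<Sum>n. c * norm a * (1/2) ^ n)"
      unfolding y_def by (rule norm_suminf_le[OF nq sums_summable[OF geo]])
    then have ny: "norm y \<le> (2 * c + 1) * norm a"
      unfolding sums_unique[OF geo, symmetric] by (rule order_trans) (simp add: distrib_right)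
    have tele: "a - x N = (\<Sum>n<N. p (x n))" for N
      by (induction N) (simp_all add: x0 xS algebra_simps)
    have x0lim: "x \<longlonglongrightarrow> 0"
    proof (rule Lim_null_comparison)
      show "\<forall>\<^sub>F n in sequentially. norm (x n) \<le> norm a * (1/2) ^ n" using nx by simp
      show "(\<lambda>n. norm a * (1/2) ^ n) \<longlonglongrightarrow> 0"
        by (rule tendsto_mult_right_zero) (rule LIMSEQ_power_zero, simp)
    qed
    \<comment> \<open>Closedness of the graph: the relation holds for the partial sums, and both
      sides pass to the limit.\<close>
    have "R a y" unfolding R_def
    proof
      fix b
      have "bounded_linear \<tau>" by (rule plf_bounded_linear[OF plf])
      have 1: "(\<lambda>N. \<tau> ((a - x N) * b)) \<longlonglongrightarrow> \<tau> ((a - 0) * b)"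
        by (intro bounded_linear.tendsto[OF \<open>bounded_linear \<tau>\<close>] tendsto_intros x0lim)
      have "\<tau> ((\<Sum>n<N. p (x n)) * b) = \<tau> (b * (\<Sum>n<N. q (x n)))" for N
      proof (induction N)
        case (Suc N)
        then show ?case
          using pq(1)[of "x N"] by (simp add: distrib_left distrib_right plf_add[OF plf] R_def)
      qed (simp add: plf_zero[OF plf])
      then have "\<tau> ((a - x N) * b) = \<tau> (b * (\<Sum>n<N. q (x n)))" for N
        by (simp add: tele)
      moreover have "(\<lambda>N. \<tau> (b * (\<Sum>n<N. q (x n)))) \<longlonglongrightarrow> \<tau> (b * y)"
        unfolding y_def
        by (intro bounded_linear.tendsto[OF \<open>bounded_linear \<tau>\<close>] tendsto_intros summable_LIMSEQ summ)
      ultimately show "\<tau> (a * b) = \<tau> (b * y)"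
        using 1 LIMSEQ_unique by fastforce
    qed
    with ny show ?thesis by blast
  qed
  then show ?thesis
    using c that[of "2 * c + 1"] by (auto simp: R_def)
qed

text \<open>Lax's argument: the modular operator is symmetric for \<open>\<tau>\<close> and maps the algebra into itself,
  hence its bound in the algebra norm also bounds it in the seminorm of \<open>\<tau>\<close>.\<close>

lemma twisted_trace_almost_tracial:
  fixes \<tau> :: "'a::unital_cstar_algebra \<Rightarrow> complex"
  assumes plf: "plf \<tau>" and tw: "\<And>a. \<exists>d. \<forall>b. \<tau> (a * b) = \<tau> (b * d)"
  obtains K where "0 < K" "\<And>a. Re (\<tau> (a * star a)) \<le> K * Re (\<tau> (star a * a))"
proof -
  obtain K where K: "0 < K"
    and ex: "\<And>a. \<exists>d. norm d \<le> K * norm a \<and> (\<forall>b. \<tau> (a * b) = \<tau> (b * d))"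
    using twisted_trace_bounded[OF plf tw] by metis
  obtain D where D: "\<And>a. norm (D a) \<le> K * norm a" "\<And>a b. \<tau> (a * b) = \<tau> (b * D a)"
    using ex by metis
  have "Re (\<tau> (a * star a)) \<le> K * Re (\<tau> (star a * a))" for a
  proof -
    \<comment> \<open>\<open>D\<close> is a mere choice of representatives, not known to be linear;
      only its iterates at this one \<open>a\<close> enter. \<open>U n\<close> is the squared
      seminorm of \<open>(D ^^ n) a\<close>.\<close>
    define U where "U n = Re (\<tau> (star ((D ^^ n) a) * (D ^^ n) a))" for n
    have "U 1 \<le> K\<^sup>2 * U 0"
    proof (rule log_convex_growth)
      show "0 \<le> U n" for n by (simp add: U_def plf_nonneg[OF plf])
      show "(U (Suc n))\<^sup>2 \<le> U n * U (Suc (Suc n))" for n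
      proof -
        \<comment> \<open>Symmetry: moving \<open>D\<close> around twice expresses the squared
          seminorm of \<open>D ?b\<close> through \<open>?b\<close> and \<open>D (D ?b)\<close>;
          log-convexity is then Cauchy-Schwarz.\<close>
        let ?b = "(D ^^ n) a"
        have "\<tau> (star (D ?b) * D ?b) = \<tau> (?b * star (D ?b))"
          by (rule D(2)[symmetric])
        also have "\<dots> = cnj (\<tau> (D ?b * star ?b))"
          using plf_star[OF plf, of "D ?b * star ?b"] by (simp add: star_mult star_star)
        also have "\<tau> (D ?b * star ?b) = \<tau> (star ?b * D (D ?b))"
          by (rule D(2))
        finally have "U (Suc n) = Re (\<tau> (star ?b * D (D ?b)))"
          by (simp add: U_def)
        then have "(U (Suc n))\<^sup>2 \<le> (cmod (\<tau> (star ?b * D (D ?b))))\<^sup>2"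
          by (simp add: cmod_power2)
        also have "\<dots> \<le> U (Suc (Suc n)) * U n"
          using plf_cauchy_schwarz[OF plf, of ?b "D (D ?b)"] by (simp add: U_def)
        finally show ?thesis by (simp add: mult.commute)
      qed
      show "U n \<le> ((norm a)\<^sup>2 * Re (\<tau> 1)) * (K\<^sup>2) ^ n" for n
      proof -
        have "norm ((D ^^ n) a) \<le> K ^ n * norm a"
        proof (induction n)
          case (Suc n)
          have "norm (D ((D ^^ n) a)) \<le> K * (K ^ n * norm a)"
            using D(1)[of "(D ^^ n) a"] mult_left_mono[OF Suc, of K] K by linarith
          then show ?case by (simp add: mult.assoc)
        qed simp
        then have "(norm ((D ^^ n) a))\<^sup>2 \<le> (K ^ n * norm a)\<^sup>2"
          by (intro power_mono) auto
        then have "(norm ((D ^^ n) a))\<^sup>2 * Re (\<tau> 1) \<le> (K ^ n * norm a)\<^sup>2 * Re (\<tau> 1)"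
          by (intro mult_right_mono plf_one_nonneg[OF plf])
        moreover have "(K ^ n * norm a)\<^sup>2 * Re (\<tau> 1) = (norm a)\<^sup>2 * Re (\<tau> 1) * (K\<^sup>2) ^ n"
        proof -
          have "(K ^ n)\<^sup>2 = (K\<^sup>2) ^ n" by (metis power_mult mult.commute)
          then show ?thesis by (simp add: power_mult_distrib)
        qed
        ultimately show ?thesis
          using plf_square_le_norm[OF plf, of "(D ^^ n) a"] unfolding U_def by linarith
      qed
      show "0 < K\<^sup>2" using K by simp
    qed
    moreover have U0: "0 \<le> U 0" using plf_nonneg(1)[OF plf, of a] by (simp add: U_def)
    ultimately have "U 1 * U 0 \<le> K\<^sup>2 * U 0 * U 0"
      by (rule mult_right_mono)
    then have U1: "U 1 * U 0 \<le> (K * U 0)\<^sup>2"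
      by (simp only: power_mult_distrib power2_eq_square[of "U 0"] mult.assoc)
    \<comment> \<open>Read as the form of \<open>D\<close> at \<open>a\<close>, this is bounded by
      the product of the seminorms of \<open>D a\<close> and \<open>a\<close>, so the final constant
      is \<open>K\<close> and not \<open>K\<^sup>2\<close>.\<close>
    have "\<tau> (a * star a) = \<tau> (star a * D a)" by (rule D(2))
    then have "(Re (\<tau> (a * star a)))\<^sup>2 \<le> (cmod (\<tau> (star a * D a)))\<^sup>2"
      by (simp add: cmod_power2)
    also have "\<dots> \<le> U 1 * U 0"
      using plf_cauchy_schwarz[OF plf, of a "D a"] by (simp add: U_def)
    also note U1
    finally have "Re (\<tau> (a * star a)) \<le> K * U 0"
      by (rule power2_le_imp_le) (use K U0 in simp)
    then show ?thesis by (simp add: U_def)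
  qed
  with K show ?thesis using that by blast
qed

section \<open>Hilbert spaces with explicit carrier\<close>

definition vdiff :: "'h cspace \<Rightarrow> 'h \<Rightarrow> 'h \<Rightarrow> 'h" where
  "vdiff H u v = vadd H u (vscale H (-1) v)"

text \<open>The vector space laws are not assumed: they follow from those of the inner product by
  extensionality.\<close>

locale pre_hilbert_space =
  fixes H :: "'h cspace" (structure)
  assumes nonempty: "vecs H \<noteq> {}"
    and add_closed [simp, intro]: "u \<in> vecs H \<Longrightarrow> v \<in> vecs H \<Longrightarrow> vadd H u v \<in> vecs H"
    and scale_closed [simp, intro]: "u \<in> vecs H \<Longrightarrow> vscale H c u \<in> vecs H"
    and inner_add_left: "u \<in> vecs H \<Longrightarrow> v \<in> vecs H \<Longrightarrow> w \<in> vecs H \<Longrightarrow>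
      vinner H (vadd H u v) w = vinner H u w + vinner H v w"
    and inner_scale_left: "u \<in> vecs H \<Longrightarrow> w \<in> vecs H \<Longrightarrow>
      vinner H (vscale H c u) w = c * vinner H u w"
    and inner_cnj: "u \<in> vecs H \<Longrightarrow> v \<in> vecs H \<Longrightarrow> vinner H u v = cnj (vinner H v u)"
    and inner_self_nonneg: "u \<in> vecs H \<Longrightarrow> 0 \<le> Re (vinner H u u)"
    and vec_eqI: "u \<in> vecs H \<Longrightarrow> v \<in> vecs H \<Longrightarrow>
      (\<And>w. w \<in> vecs H \<Longrightarrow> vinner H u w = vinner H v w) \<Longrightarrow> u = v"
begin

abbreviation inner where "inner \<equiv> vinner H"
abbreviation nrm where "nrm \<equiv> vnorm H"
abbreviation V where "V \<equiv> vecs H"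

lemma diff_closed [simp, intro]: "u \<in> V \<Longrightarrow> v \<in> V \<Longrightarrow> vdiff H u v \<in> V"
  by (simp add: vdiff_def)

lemma inner_add_right: "u \<in> V \<Longrightarrow> v \<in> V \<Longrightarrow> w \<in> V \<Longrightarrow>
    inner w (vadd H u v) = inner w u + inner w v"
  using inner_cnj[of w "vadd H u v"] inner_cnj[of w u] inner_cnj[of w v] by (simp add: inner_add_left)

lemma inner_scale_right: "u \<in> V \<Longrightarrow> w \<in> V \<Longrightarrow> inner w (vscale H c u) = cnj c * inner w u"
  using inner_cnj[of w "vscale H c u"] inner_cnj[of w u] by (simp add: inner_scale_left)

lemma inner_diff_left: "u \<in> V \<Longrightarrow> v \<in> V \<Longrightarrow> w \<in> V \<Longrightarrow>
    inner (vdiff H u v) w = inner u w - inner v w"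
  by (simp add: vdiff_def inner_add_left inner_scale_left)

lemma inner_diff_right: "u \<in> V \<Longrightarrow> v \<in> V \<Longrightarrow> w \<in> V \<Longrightarrow>
    inner w (vdiff H u v) = inner w u - inner w v"
  by (simp add: vdiff_def inner_add_right inner_scale_right)

lemmas inner_simps = inner_add_left inner_add_right inner_scale_left inner_scale_right
  inner_diff_left inner_diff_right

lemma inner_self_Im: "u \<in> V \<Longrightarrow> Im (inner u u) = 0"
  using inner_cnj[of u u] by (metis cnj.sel(2) equal_neg_zero)

lemma nrm_nonneg [simp]: "u \<in> V \<Longrightarrow> 0 \<le> nrm u"
  by (simp add: vnorm_def inner_self_nonneg)

lemma nrm_square: "u \<in> V \<Longrightarrow> (nrm u)\<^sup>2 = Re (inner u u)"
  by (simp add: vnorm_def inner_self_nonneg)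

lemma inner_self: "u \<in> V \<Longrightarrow> inner u u = of_real ((nrm u)\<^sup>2)"
  by (simp add: complex_eq_iff inner_self_Im nrm_square)

lemma Re_inner_commute: "u \<in> V \<Longrightarrow> v \<in> V \<Longrightarrow> Re (inner v u) = Re (inner u v)"
  using inner_cnj[of v u] by simp

lemma inner_le_nrm:
  assumes "u \<in> V" "v \<in> V"
  shows "cmod (inner u v) \<le> nrm u * nrm v"
proof -
  have "(cmod (inner v u))\<^sup>2 \<le> (nrm u)\<^sup>2 * (nrm v)\<^sup>2"
  proof (rule cauchy_schwarz_of_nonneg)
    fix c
    let ?w = "vadd H u (vscale H c v)"
    have "inner ?w ?w = inner u u + c * inner v u + cnj c * inner u v + (c * cnj c) * inner v v"
      using assms by (simp add: inner_simps algebra_simps)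
    also have "inner u v = cnj (inner v u)" by (rule inner_cnj[OF assms])
    finally have "Re (inner ?w ?w) = Re (inner u u) + 2 * Re (c * inner v u) + Re ((c * cnj c) * inner v v)"
      by simp
    also have "(c * cnj c) = of_real ((cmod c)\<^sup>2)"
      by (rule complex_norm_square[symmetric])
    finally show "0 \<le> (nrm u)\<^sup>2 + 2 * Re (c * inner v u) + (cmod c)\<^sup>2 * (nrm v)\<^sup>2"
      using assms inner_self_nonneg[of ?w] by (simp add: nrm_square)
  qed simp
  then have "(cmod (inner u v))\<^sup>2 \<le> (nrm u * nrm v)\<^sup>2"
    using inner_cnj[OF assms] by (simp add: power_mult_distrib)
  then show ?thesis
    by (rule power2_le_imp_le) (use assms in simp)
qed

lemma nrm_triangle:
  assumes "u \<in> V" "v \<in> V"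
  shows "nrm (vadd H u v) \<le> nrm u + nrm v"
proof (rule power2_le_imp_le)
  have "Re (inner u v) \<le> nrm u * nrm v"
    using inner_le_nrm[OF assms] complex_Re_le_cmod[of "inner u v"] by linarith
  then show "(nrm (vadd H u v))\<^sup>2 \<le> (nrm u + nrm v)\<^sup>2"
    using assms Re_inner_commute[of u v]
    by (simp add: nrm_square inner_simps power2_sum)
qed (use assms in simp)

lemma nrm_scale: "u \<in> V \<Longrightarrow> nrm (vscale H c u) = cmod c * nrm u"
proof (rule power2_eq_imp_eq)
  assume u: "u \<in> V"
  have "inner (vscale H c u) (vscale H c u) = (c * cnj c) * inner u u"
    using u by (simp add: inner_simps)
  also have "\<dots> = of_real ((cmod c)\<^sup>2) * inner u u"
    by (simp only: complex_norm_square)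
  finally show "(nrm (vscale H c u))\<^sup>2 = (cmod c * nrm u)\<^sup>2"
    using u by (simp add: nrm_square power_mult_distrib)
qed (auto)

lemma nrm_diff_commute: "u \<in> V \<Longrightarrow> v \<in> V \<Longrightarrow> nrm (vdiff H u v) = nrm (vdiff H v u)"
  by (rule power2_eq_imp_eq) (simp_all add: nrm_square inner_simps)

lemma diff_add_eq: "u \<in> V \<Longrightarrow> v \<in> V \<Longrightarrow> w \<in> V \<Longrightarrow> vadd H (vdiff H u v) (vdiff H v w) = vdiff H u w"
  by (rule vec_eqI) (simp_all add: inner_simps)

lemma nrm_diff_triangle: "u \<in> V \<Longrightarrow> v \<in> V \<Longrightarrow> w \<in> V \<Longrightarrow>
    nrm (vdiff H u w) \<le> nrm (vdiff H u v) + nrm (vdiff H v w)"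
  using nrm_triangle[of "vdiff H u v" "vdiff H v w"] by (simp add: diff_add_eq)

lemma nrm_le_diff: "u \<in> V \<Longrightarrow> v \<in> V \<Longrightarrow> nrm u \<le> nrm (vdiff H u v) + nrm v"
proof -
  assume uv: "u \<in> V" "v \<in> V"
  then have "vadd H (vdiff H u v) v = u"
    by (intro vec_eqI) (simp_all add: inner_simps)
  then show ?thesis using nrm_triangle[of "vdiff H u v" v] uv by simp
qed

lemma inner_tendsto:
  assumes "\<And>n. x n \<in> V" "u \<in> V" "w \<in> V" and lim: "(\<lambda>n. nrm (vdiff H (x n) u)) \<longlonglongrightarrow> 0"
  shows "(\<lambda>n. inner (x n) w) \<longlonglongrightarrow> inner u w"
proof -
  have "(\<lambda>n. inner (x n) w - inner u w) \<longlonglongrightarrow> 0"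
  proof (rule Lim_null_comparison)
    show "\<forall>\<^sub>F n in sequentially. norm (inner (x n) w - inner u w) \<le> nrm (vdiff H (x n) u) * nrm w"
      using assms inner_le_nrm[of "vdiff H (x _) u" w] by (simp add: inner_simps)
    show "(\<lambda>n. nrm (vdiff H (x n) u) * nrm w) \<longlonglongrightarrow> 0"
      by (rule tendsto_mult_left_zero[OF lim])
  qed
  then show ?thesis by (rule LIM_zero_cancel)
qed

lemma nrm_tendsto:
  assumes "\<And>n. x n \<in> V" "u \<in> V" and lim: "(\<lambda>n. nrm (vdiff H (x n) u)) \<longlonglongrightarrow> 0"
  shows "(\<lambda>n. nrm (x n)) \<longlonglongrightarrow> nrm u"
proof -
  have "(\<lambda>n. nrm (x n) - nrm u) \<longlonglongrightarrow> 0"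
  proof (rule Lim_null_comparison[OF _ lim])
    have "\<bar>nrm (x n) - nrm u\<bar> \<le> nrm (vdiff H (x n) u)" for n
      using nrm_le_diff[of "x n" u] nrm_le_diff[of u "x n"] nrm_diff_commute[of "x n" u] assms by simp
    then show "\<forall>\<^sub>F n in sequentially. norm (nrm (x n) - nrm u) \<le> nrm (vdiff H (x n) u)"
      by simp
  qed
  then show ?thesis by (rule LIM_zero_cancel)
qed

end

locale hilbert_space = pre_hilbert_space +
  assumes complete: "(\<And>n. x n \<in> vecs H) \<Longrightarrow>
      (\<And>e. e > 0 \<Longrightarrow> \<exists>N. \<forall>m\<ge>N. \<forall>n\<ge>N. vnorm H (vdiff H (x m) (x n)) < e) \<Longrightarrow>
      \<exists>u\<in>vecs H. (\<lambda>n. vnorm H (vdiff H (x n) u)) \<longlonglongrightarrow> 0"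
begin

lemma riesz_representation:
  assumes add: "\<And>u v. u \<in> V \<Longrightarrow> v \<in> V \<Longrightarrow> f (vadd H u v) = f u + f v"
    and scale: "\<And>c u. u \<in> V \<Longrightarrow> f (vscale H c u) = c * f u"
    and bd: "\<And>u. u \<in> V \<Longrightarrow> cmod (f u) \<le> K * nrm u"
  obtains w where "w \<in> V" "\<And>v. v \<in> V \<Longrightarrow> f v = inner v w"
proof -
  \<comment> \<open>The representing vector minimizes \<open>\<parallel>v\<parallel>\<^sup>2 - 2 Re f(v)\<close>.\<close>
  define J where "J v = Re (inner v v) - 2 * Re (f v)" for v
  have fdiff: "f (vdiff H u v) = f u - f v" if "u \<in> V" "v \<in> V" for u v
    using that by (simp add: vdiff_def add scale)
  have "- K\<^sup>2 \<le> J v" if v: "v \<in> V" for v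
  proof -
    have "Re (f v) \<le> K * nrm v"
      using bd[OF v] complex_Re_le_cmod[of "f v"] by linarith
    moreover have "0 \<le> (nrm v)\<^sup>2 + K\<^sup>2 - 2 * (K * nrm v)"
      using zero_le_power2[of "nrm v - K"] by (simp add: power2_diff algebra_simps)
    ultimately show ?thesis
      unfolding J_def nrm_square[OF v, symmetric] by linarith
  qed
  then have bdd: "bdd_below (J ` V)" by (meson bdd_belowI2)
  define d where "d = Inf (J ` V)"
  have dle: "d \<le> J v" if "v \<in> V" for v
    unfolding d_def using bdd that by (simp add: cInf_lower)
  have "\<exists>v\<in>V. J v < d + 1 / (real n + 1)" for n
    using cInf_lessD[of "J ` V" "d + 1 / (real n + 1)"] nonempty by (auto simp: d_def)
  then obtain x where x: "\<And>n. x n \<in> V" "\<And>n. J (x n) < d + 1 / (real n + 1)"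
    by metis
  \<comment> \<open>Parallelogram identity for \<open>J\<close>, whose linear terms cancel; it makes
    the minimizing sequence Cauchy.\<close>
  have par: "(nrm (vdiff H u v))\<^sup>2 = 2 * J u + 2 * J v - 4 * J (vscale H (1/2) (vadd H u v))"
    if "u \<in> V" "v \<in> V" for u v
    using that Re_inner_commute[of u v]
    by (simp add: J_def nrm_square inner_simps add scale field_simps)
  have xd: "(nrm (vdiff H (x m) (x n)))\<^sup>2 \<le> 2 / (real m + 1) + 2 / (real n + 1)" for m n
    using par[of "x m" "x n"] x(1)[of m] x(1)[of n] x(2)[of m] x(2)[of n]
      dle[of "vscale H (1/2) (vadd H (x m) (x n))"] by simp
  have "\<exists>u\<in>V. (\<lambda>n. nrm (vdiff H (x n) u)) \<longlonglongrightarrow> 0"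
  proof (rule complete)
    fix e :: real assume e: "e > 0"
    obtain N where N: "4 / e\<^sup>2 < real N" using reals_Archimedean2 by blast
    have "nrm (vdiff H (x m) (x n)) < e" if "m \<ge> N" "n \<ge> N" for m n
    proof (rule power2_less_imp_less)
      have N0: "real N > 0" using N e by (metis less_trans zero_less_divide_iff zero_less_numeral zero_less_power)
      have "2 / (real m + 1) < 2 / real N" "2 / (real n + 1) < 2 / real N"
        using that N0 by (auto simp: field_simps)
      then have "(nrm (vdiff H (x m) (x n)))\<^sup>2 < 4 / real N"
        using xd[of m n] by linarith
      also have "\<dots> < e\<^sup>2" using N N0 e by (simp add: field_simps)
      finally show "(nrm (vdiff H (x m) (x n)))\<^sup>2 < e\<^sup>2" .
    qed (use e in simp)
    then show "\<exists>N. \<forall>m\<ge>N. \<forall>n\<ge>N. nrm (vdiff H (x m) (x n)) < e" by blast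
  qed (rule x)
  then obtain w where w: "w \<in> V" "(\<lambda>n. nrm (vdiff H (x n) w)) \<longlonglongrightarrow> 0" by blast
  have "(\<lambda>n. f (x n) - f w) \<longlonglongrightarrow> 0"
  proof (rule Lim_null_comparison)
    show "\<forall>\<^sub>F n in sequentially. norm (f (x n) - f w) \<le> K * nrm (vdiff H (x n) w)"
      using bd[of "vdiff H (x _) w"] x w by (simp add: fdiff)
    show "(\<lambda>n. K * nrm (vdiff H (x n) w)) \<longlonglongrightarrow> 0"
      by (rule tendsto_mult_right_zero[OF w(2)])
  qed
  then have flim: "(\<lambda>n. f (x n)) \<longlonglongrightarrow> f w" by (rule LIM_zero_cancel)
  have "(\<lambda>n. (nrm (x n))\<^sup>2 - 2 * Re (f (x n))) \<longlonglongrightarrow> (nrm w)\<^sup>2 - 2 * Re (f w)"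
    by (intro tendsto_intros nrm_tendsto flim x w)
  then have Jlim: "(\<lambda>n. J (x n)) \<longlonglongrightarrow> J w"
    using x w by (simp add: J_def nrm_square)
  have "(\<lambda>n. d + 1 / (real n + 1)) \<longlonglongrightarrow> d + 0"
    using LIMSEQ_inverse_real_of_nat by (intro tendsto_intros) (simp add: inverse_eq_divide add.commute)
  then have Jw: "J w \<le> d"
    using Jlim x(2) by (intro LIMSEQ_le[of "\<lambda>n. J (x n)" _ "\<lambda>n. d + 1 / (real n + 1)"]) (auto intro: less_imp_le)
  have "f v = inner v w" if v: "v \<in> V" for v
  proof -
    have arith: "A - 2 * B \<le> A + (X + X) + Q - 2 * (B + Y) \<Longrightarrow> 0 \<le> 0 + (2 * X - 2 * Y) + Q"
      for A B X Q Y :: real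
      by simp
    \<comment> \<open>As \<open>w\<close> minimizes \<open>J\<close>, the variation in direction
      \<open>v\<close> has no constant term; \<open>p = 0\<close> in the Cauchy-Schwarz lemma
      annihilates its linear coefficient.\<close>
    have "(cmod (inner v w - f v))\<^sup>2 \<le> 0 * (nrm v)\<^sup>2"
    proof (rule cauchy_schwarz_of_nonneg)
      fix c
      have "J w \<le> J (vadd H w (vscale H c v))"
        using Jw dle[of "vadd H w (vscale H c v)"] v w by simp
      moreover have "inner (vadd H w (vscale H c v)) (vadd H w (vscale H c v))
        = inner w w + (c * inner v w + cnj (c * inner v w)) + (c * cnj c) * inner v v"
        using v w inner_cnj[of w v] by (simp add: inner_simps algebra_simps)
      moreover have "(c * cnj c) * inner v v = of_real ((cmod c)\<^sup>2 * (nrm v)\<^sup>2)"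
        using v by (simp only: complex_norm_square[symmetric] inner_self) simp
      ultimately have "J w \<le> Re (inner w w) + (Re (c * inner v w) + Re (cnj (c * inner v w))) + (cmod c)\<^sup>2 * (nrm v)\<^sup>2
          - 2 * (Re (f w) + Re (c * f v))"
        using v w by (simp only: J_def plus_complex.sel Re_complex_of_real add scale scale_closed)
      then show "0 \<le> 0 + 2 * Re (c * (inner v w - f v)) + (cmod c)\<^sup>2 * (nrm v)\<^sup>2"
        using arith[of "Re (inner w w)" "Re (f w)" "Re (c * inner v w)" "(cmod c)\<^sup>2 * (nrm v)\<^sup>2" "Re (c * f v)"]
        by (simp only: J_def right_diff_distrib cnj.sel minus_complex.sel)
    qed simp
    then show ?thesis by simp
  qed
  with w show ?thesis using that by blast
qed

subsection \<open>Bounded operators\<close>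

lemma bounded_opsD:
  assumes "T \<in> bounded_ops H"
  shows "\<And>u. u \<in> V \<Longrightarrow> T u \<in> V"
    "\<And>u v. u \<in> V \<Longrightarrow> v \<in> V \<Longrightarrow> T (vadd H u v) = vadd H (T u) (T v)"
    "\<And>c u. u \<in> V \<Longrightarrow> T (vscale H c u) = vscale H c (T u)"
    "T \<in> extensional V"
  using assms by (auto simp: bounded_ops_def PiE_def)

lemma bounded_ops_diff:
  "T \<in> bounded_ops H \<Longrightarrow> u \<in> V \<Longrightarrow> v \<in> V \<Longrightarrow> T (vdiff H u v) = vdiff H (T u) (T v)"
  by (simp add: vdiff_def bounded_opsD)

lemma bounded_ops_bound:
  assumes "T \<in> bounded_ops H"
  obtains K where "0 \<le> K" "\<And>u. u \<in> V \<Longrightarrow> nrm (T u) \<le> K * nrm u"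
proof -
  obtain K where K: "\<And>u. u \<in> V \<Longrightarrow> nrm (T u) \<le> K * nrm u"
    using assms unfolding bounded_ops_def by blast
  have "nrm (T u) \<le> max K 0 * nrm u" if "u \<in> V" for u
    using K[OF that] mult_right_mono[of K "max K 0" "nrm u"] that by simp
  then show ?thesis using that[of "max K 0"] by simp
qed

lemma bounded_opsI:
  assumes "\<And>u. u \<in> V \<Longrightarrow> T u \<in> V"
    and "\<And>u v w. u \<in> V \<Longrightarrow> v \<in> V \<Longrightarrow> w \<in> V \<Longrightarrow> inner (T (vadd H u v)) w = inner (T u) w + inner (T v) w"
    and "\<And>c u w. u \<in> V \<Longrightarrow> w \<in> V \<Longrightarrow> inner (T (vscale H c u)) w = c * inner (T u) w"
    and "\<And>u. u \<in> V \<Longrightarrow> nrm (T u) \<le> K * nrm u" and "T \<in> extensional V"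
  shows "T \<in> bounded_ops H"
proof -
  have "T (vadd H u v) = vadd H (T u) (T v)" if "u \<in> V" "v \<in> V" for u v
    by (rule vec_eqI) (use assms(1,2) that in \<open>simp_all add: inner_add_left\<close>)
  moreover have "T (vscale H c u) = vscale H c (T u)" if "u \<in> V" for c u
    by (rule vec_eqI) (use assms(1,3) that in \<open>simp_all add: inner_scale_left\<close>)
  ultimately show ?thesis
    unfolding bounded_ops_def PiE_def using assms(1,4,5)
    by (intro CollectI conjI ballI allI IntI Pi_I exI[of _ K]) simp_all
qed

lemma op_eqI:
  assumes "S \<in> bounded_ops H" "T \<in> bounded_ops H"
    and "\<And>u v. u \<in> V \<Longrightarrow> v \<in> V \<Longrightarrow> inner (S u) v = inner (T u) v"
  shows "S = T"
  by (rule extensionalityI[of _ V])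
     (use assms in \<open>auto intro!: vec_eqI simp: bounded_opsD\<close>)

lemma operator_of_form:
  assumes add_left: "\<And>u v w. u \<in> V \<Longrightarrow> v \<in> V \<Longrightarrow> w \<in> V \<Longrightarrow> S (vadd H u v) w = S u w + S v w"
    and scale_left: "\<And>c u w. u \<in> V \<Longrightarrow> w \<in> V \<Longrightarrow> S (vscale H c u) w = c * S u w"
    and add_right: "\<And>u v w. u \<in> V \<Longrightarrow> v \<in> V \<Longrightarrow> w \<in> V \<Longrightarrow> S w (vadd H u v) = S w u + S w v"
    and scale_right: "\<And>c u w. u \<in> V \<Longrightarrow> w \<in> V \<Longrightarrow> S w (vscale H c u) = cnj c * S w u"
    and bd: "\<And>u v. u \<in> V \<Longrightarrow> v \<in> V \<Longrightarrow> cmod (S u v) \<le> K * nrm u * nrm v"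
  obtains T where "T \<in> bounded_ops H" "\<And>u v. u \<in> V \<Longrightarrow> v \<in> V \<Longrightarrow> S u v = inner (T u) v"
proof -
  have "\<exists>w\<in>V. \<forall>v\<in>V. S u v = inner w v" if u: "u \<in> V" for u
  proof -
    \<comment> \<open>The form is conjugate linear in \<open>v\<close>, whereas representable
      functionals are linear; hence the conjugation.\<close>
    obtain w where "w \<in> V" "\<And>v. v \<in> V \<Longrightarrow> cnj (S u v) = inner v w"
      by (rule riesz_representation[of "\<lambda>v. cnj (S u v)" "K * nrm u"])
         (use u bd in \<open>auto simp: add_right scale_right\<close>)
    then show ?thesis
      using inner_cnj[of w] by (metis complex_cnj_cnj)
  qed
  then obtain T0 where T0: "\<And>u. u \<in> V \<Longrightarrow> T0 u \<in> V" "\<And>u v. u \<in> V \<Longrightarrow> v \<in> V \<Longrightarrow> S u v = inner (T0 u) v"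
    by metis
  have "restrict T0 V \<in> bounded_ops H"
  proof (rule bounded_opsI[where K = "\<bar>K\<bar>"])
    fix u assume u: "u \<in> V"
    \<comment> \<open>The form is tested at \<open>T0 u\<close> itself. The absolute value of
      \<open>K\<close> appears because its sign is not given.\<close>
    have "nrm (T0 u) * nrm (T0 u) = cmod (S u (T0 u))"
      using T0 u by (simp add: inner_self norm_mult power2_eq_square)
    also have "\<dots> \<le> K * nrm u * nrm (T0 u)" using bd T0 u by blast
    finally have *: "nrm (T0 u) * nrm (T0 u) \<le> K * nrm u * nrm (T0 u)" .
    have "nrm (T0 u) \<le> \<bar>K\<bar> * nrm u"
    proof (cases "nrm (T0 u) = 0")
      case False
      then have "nrm (T0 u) > 0" using T0(1)[OF u] nrm_nonneg[of "T0 u"] by linarith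
      with * have "nrm (T0 u) \<le> K * nrm u" by simp
      then show ?thesis
        using mult_right_mono[OF abs_ge_self nrm_nonneg[OF u], of K] by linarith
    qed (use u in simp)
    then show "nrm (restrict T0 V u) \<le> \<bar>K\<bar> * nrm u" using u by simp
  qed (auto simp: T0(2)[symmetric] add_left scale_left, simp add: T0)
  then show ?thesis using that[of "restrict T0 V"] T0 by simp
qed

lemma adjoint_exists:
  assumes T: "T \<in> bounded_ops H"
  obtains S where "S \<in> bounded_ops H" "\<And>u v. u \<in> V \<Longrightarrow> v \<in> V \<Longrightarrow> inner (T u) v = inner u (S v)"
proof -
  obtain K where K: "0 \<le> K" "\<And>u. u \<in> V \<Longrightarrow> nrm (T u) \<le> K * nrm u"
    using bounded_ops_bound[OF T] by blast
  obtain S where S: "S \<in> bounded_ops H" "\<And>u v. u \<in> V \<Longrightarrow> v \<in> V \<Longrightarrow> inner u (T v) = inner (S u) v"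
  proof (rule operator_of_form[of "\<lambda>u v. inner u (T v)" K])
    show "cmod (inner u (T v)) \<le> K * nrm u * nrm v" if "u \<in> V" "v \<in> V" for u v
    proof -
      have "cmod (inner u (T v)) \<le> nrm u * nrm (T v)"
        using that inner_le_nrm[of u "T v"] T by (simp add: bounded_opsD)
      also have "\<dots> \<le> nrm u * (K * nrm v)"
        using that K by (intro mult_left_mono) auto
      finally show ?thesis by (simp add: mult_ac)
    qed
  qed (use T in \<open>auto simp: bounded_opsD inner_simps\<close>)
  have "inner (T u) v = inner u (S v)" if uv: "u \<in> V" "v \<in> V" for u v
    using S(2)[OF uv(2,1)] inner_cnj[of "T u" v] inner_cnj[of u "S v"] uv T S(1)
    by (simp add: bounded_opsD)
  with S show ?thesis using that by blast
qed

lemma op_adj_eqI: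
  assumes S: "S \<in> bounded_ops H" and T: "T \<in> bounded_ops H"
    and eq: "\<And>u v. u \<in> V \<Longrightarrow> v \<in> V \<Longrightarrow> inner (T u) v = inner u (S v)"
  shows "op_adj H T = S"
  unfolding op_adj_def
proof (rule the_equality)
  show "S \<in> bounded_ops H \<and> (\<forall>u\<in>V. \<forall>v\<in>V. inner (T u) v = inner u (S v))"
    using assms by blast
next
  fix S' assume S': "S' \<in> bounded_ops H \<and> (\<forall>u\<in>V. \<forall>v\<in>V. inner (T u) v = inner u (S' v))"
  show "S' = S"
  proof (rule op_eqI)
    fix u v assume uv: "u \<in> V" "v \<in> V"
    have "inner v (S' u) = inner v (S u)" using S' eq uv by simp
    then show "inner (S' u) v = inner (S u) v"
      using S S' uv inner_cnj[of "S' u" v] inner_cnj[of "S u" v] by (simp add: bounded_opsD)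
  qed (use S S' in auto)
qed

lemma op_adj:
  assumes T: "T \<in> bounded_ops H"
  shows "op_adj H T \<in> bounded_ops H"
    and inner_op_adj: "\<And>u v. u \<in> V \<Longrightarrow> v \<in> V \<Longrightarrow> inner u (op_adj H T v) = inner (T u) v"
    and inner_op_adj_left: "\<And>u v. u \<in> V \<Longrightarrow> v \<in> V \<Longrightarrow> inner (op_adj H T u) v = inner u (T v)"
proof -
  obtain S where S: "S \<in> bounded_ops H" "\<And>u v. u \<in> V \<Longrightarrow> v \<in> V \<Longrightarrow> inner (T u) v = inner u (S v)"
    using adjoint_exists[OF T] by blast
  then have eq: "op_adj H T = S" by (intro op_adj_eqI T)
  show "op_adj H T \<in> bounded_ops H" using S eq by simp
  show 1: "inner u (op_adj H T v) = inner (T u) v" if "u \<in> V" "v \<in> V" for u v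
    using S that eq by simp
  show "inner (op_adj H T u) v = inner u (T v)" if "u \<in> V" "v \<in> V" for u v
    using 1[of v u] inner_cnj[of "op_adj H T u" v] inner_cnj[of u "T v"] that S(1) eq T
    by (simp add: bounded_opsD)
qed

lemma op_add_apply [simp]: "u \<in> V \<Longrightarrow> op_add H S T u = vadd H (S u) (T u)"
  by (simp add: op_add_def)

lemma op_scale_apply [simp]: "u \<in> V \<Longrightarrow> op_scale H c T u = vscale H c (T u)"
  by (simp add: op_scale_def)

lemma op_mult_apply [simp]: "u \<in> V \<Longrightarrow> op_mult H S T u = S (T u)"
  by (simp add: op_mult_def compose_def)

lemma op_add_closed: "S \<in> bounded_ops H \<Longrightarrow> T \<in> bounded_ops H \<Longrightarrow> op_add H S T \<in> bounded_ops H"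
proof -
  assume ST: "S \<in> bounded_ops H" "T \<in> bounded_ops H"
  obtain K where K: "\<And>u. u \<in> V \<Longrightarrow> nrm (S u) \<le> K * nrm u"
    using bounded_ops_bound[OF ST(1)] by blast
  obtain L where L: "\<And>u. u \<in> V \<Longrightarrow> nrm (T u) \<le> L * nrm u"
    using bounded_ops_bound[OF ST(2)] by blast
  show ?thesis
  proof (rule bounded_opsI[where K = "K + L"])
    show "nrm (op_add H S T u) \<le> (K + L) * nrm u" if "u \<in> V" for u
      using nrm_triangle[of "S u" "T u"] K[OF that] L[OF that] that ST
      by (simp add: bounded_opsD distrib_right)
  qed (use ST in \<open>auto simp: bounded_opsD inner_simps op_add_def algebra_simps\<close>)
qed

lemma op_scale_closed: "T \<in> bounded_ops H \<Longrightarrow> op_scale H c T \<in> bounded_ops H"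
proof -
  assume T: "T \<in> bounded_ops H"
  obtain L where L: "\<And>u. u \<in> V \<Longrightarrow> nrm (T u) \<le> L * nrm u"
    using bounded_ops_bound[OF T] by blast
  show ?thesis
  proof (rule bounded_opsI[where K = "cmod c * L"])
    show "nrm (op_scale H c T u) \<le> cmod c * L * nrm u" if "u \<in> V" for u
      using mult_left_mono[OF L[OF that], of "cmod c"] that T
      by (simp add: bounded_opsD nrm_scale mult.assoc)
  qed (use T in \<open>auto simp: bounded_opsD inner_simps op_scale_def algebra_simps\<close>)
qed

lemma op_mult_closed: "S \<in> bounded_ops H \<Longrightarrow> T \<in> bounded_ops H \<Longrightarrow> op_mult H S T \<in> bounded_ops H"
proof -
  assume ST: "S \<in> bounded_ops H" "T \<in> bounded_ops H"
  obtain K where K: "0 \<le> K" "\<And>u. u \<in> V \<Longrightarrow> nrm (S u) \<le> K * nrm u"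
    using bounded_ops_bound[OF ST(1)] by blast
  obtain L where L: "\<And>u. u \<in> V \<Longrightarrow> nrm (T u) \<le> L * nrm u"
    using bounded_ops_bound[OF ST(2)] by blast
  show ?thesis
  proof (rule bounded_opsI[where K = "K * L"])
    show "nrm (op_mult H S T u) \<le> K * L * nrm u" if "u \<in> V" for u
      using K(2)[of "T u"] mult_left_mono[OF L[OF that] K(1)] that ST
      by (simp add: bounded_opsD mult.assoc)
  qed (use ST in \<open>auto simp: bounded_opsD inner_simps op_mult_def compose_def\<close>)
qed

lemma op_id_closed: "(\<lambda>u\<in>V. u) \<in> bounded_ops H"
  by (rule bounded_opsI[where K = 1]) (auto simp: inner_simps)

lemma op_mult_eq_iff:
  assumes "S \<in> bounded_ops H" "T \<in> bounded_ops H"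
  shows "op_mult H T S = op_mult H S T \<longleftrightarrow> (\<forall>u\<in>V. T (S u) = S (T u))"
proof
  assume "op_mult H T S = op_mult H S T"
  then show "\<forall>u\<in>V. T (S u) = S (T u)"
    using op_mult_apply by metis
qed (auto simp: op_mult_def compose_def restrict_def)

lemma commutant_iff:
  assumes "M \<subseteq> bounded_ops H"
  shows "T \<in> commutant H M \<longleftrightarrow> T \<in> bounded_ops H \<and> (\<forall>S\<in>M. \<forall>u\<in>V. T (S u) = S (T u))"
  using assms op_mult_eq_iff unfolding commutant_def by blast

lemma commutant_subset: "commutant H M \<subseteq> bounded_ops H"
  by (auto simp: commutant_def)

lemma commutant_closed:
  assumes M: "M \<subseteq> bounded_ops H" and S: "S \<in> commutant H M" and T: "T \<in> commutant H M"
  shows "op_add H S T \<in> commutant H M" "op_scale H c T \<in> commutant H M" "op_mult H S T \<in> commutant H M"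
    "(\<lambda>u\<in>V. u) \<in> commutant H M"
  using S T subsetD[OF M] op_add_closed op_scale_closed op_mult_closed op_id_closed
  unfolding commutant_iff[OF M] by (simp_all add: bounded_opsD)

lemma commutant_adj:
  assumes M: "M \<subseteq> bounded_ops H" and adj: "\<And>S. S \<in> M \<Longrightarrow> op_adj H S \<in> M" and T: "T \<in> commutant H M"
  shows "op_adj H T \<in> commutant H M"
  unfolding commutant_iff[OF M]
proof (intro conjI ballI)
  have Tb: "T \<in> bounded_ops H" using T by (simp add: commutant_def)
  then show "op_adj H T \<in> bounded_ops H" by (rule op_adj)
  fix S u assume S: "S \<in> M" and u: "u \<in> V"
  have Sb: "S \<in> bounded_ops H" using S M by blast
  show "op_adj H T (S u) = S (op_adj H T u)"
  proof (rule vec_eqI)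
    fix w assume w: "w \<in> V"
    have c: "T (op_adj H S w) = op_adj H S (T w)"
      using T adj[OF S] w unfolding commutant_iff[OF M] by blast
    have "inner (op_adj H T (S u)) w = inner u (op_adj H S (T w))"
      using u w Tb Sb by (simp add: inner_op_adj_left inner_op_adj bounded_opsD)
    also have "\<dots> = inner (S (op_adj H T u)) w"
      unfolding c[symmetric]
      using u w Tb Sb op_adj(1)[OF Tb] op_adj(1)[OF Sb]
      by (simp add: inner_op_adj_left[symmetric] inner_op_adj[symmetric] bounded_opsD)
    finally show "inner (op_adj H T (S u)) w = inner (S (op_adj H T u)) w" .
  qed (use u Sb op_adj(1)[OF Tb] in \<open>auto simp: bounded_opsD\<close>)
qed

end

subsection \<open>Positive contractions\<close>

text \<open>The decrements are non-increasing: the first one dominates all of them, and the last one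
  is at most their average.\<close>

lemma convex_seq_increments:
  fixes f :: "nat \<Rightarrow> real"
  assumes "\<And>n. f (Suc n) - f (Suc (Suc n)) \<le> f n - f (Suc n)"
  shows "f 0 - f m \<le> real m * (f 0 - f 1)" "real (Suc n) * (f n - f (Suc n)) \<le> f 0 - f (Suc n)"
proof -
  have d: "f n - f (Suc n) \<le> f 0 - f 1" for n
  proof (induction n)
    case (Suc n)
    then show ?case using assms[of n] by simp
  qed simp
  show "f 0 - f m \<le> real m * (f 0 - f 1)"
  proof (induction m)
    case (Suc m)
    then show ?case using d[of m] by (simp add: algebra_simps)
  qed simp
  show "real (Suc n) * (f n - f (Suc n)) \<le> f 0 - f (Suc n)"
  proof (induction n)
    case (Suc n)
    have "real (Suc n) * (f (Suc n) - f (Suc (Suc n))) \<le> real (Suc n) * (f n - f (Suc n))"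
      using assms by (intro mult_left_mono) auto
    then have "real (Suc n) * (f (Suc n) - f (Suc (Suc n))) \<le> f 0 - f (Suc n)"
      using Suc by linarith
    then show ?case by (simp add: algebra_simps)
  qed simp
qed

text \<open>Linearity is not built in, as symmetry against all vectors yields it. Plain functions
  suffice, so \<open>C - C\<^sup>2\<close> and its successors need no extensional
  representation.\<close>

locale positive_contraction = hilbert_space +
  fixes C :: "'a \<Rightarrow> 'a"
  assumes closed [simp]: "u \<in> V \<Longrightarrow> C u \<in> V"
    and sym: "u \<in> V \<Longrightarrow> v \<in> V \<Longrightarrow> inner (C u) v = inner u (C v)"
    and nonneg: "u \<in> V \<Longrightarrow> 0 \<le> Re (inner (C u) u)"
    and le_id: "u \<in> V \<Longrightarrow> Re (inner (C u) u) \<le> Re (inner u u)"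
begin

lemma linear_add: "u \<in> V \<Longrightarrow> v \<in> V \<Longrightarrow> C (vadd H u v) = vadd H (C u) (C v)"
  by (rule vec_eqI) (simp_all add: sym inner_simps)

lemma linear_scale: "u \<in> V \<Longrightarrow> C (vscale H c u) = vscale H c (C u)"
  by (rule vec_eqI) (simp_all add: sym inner_simps)

lemma linear_diff: "u \<in> V \<Longrightarrow> v \<in> V \<Longrightarrow> C (vdiff H u v) = vdiff H (C u) (C v)"
  by (rule vec_eqI) (simp_all add: sym inner_simps)

text \<open>Cauchy-Schwarz for the form of \<open>C\<close> at \<open>u\<close> and
  \<open>C u\<close>; estimating the form at \<open>C u\<close> by \<open>le_id\<close> leaves a
  common factor that cancels.\<close>

lemma square_le: "u \<in> V \<Longrightarrow> Re (inner (C u) (C u)) \<le> Re (inner (C u) u)"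
proof -
  assume u: "u \<in> V"
  let ?v = "C u"
  have v: "?v \<in> V" using u by simp
  have "(cmod (inner (C ?v) u))\<^sup>2 \<le> Re (inner (C u) u) * Re (inner (C ?v) ?v)"
  proof (rule cauchy_schwarz_of_nonneg)
    fix c
    let ?w = "vadd H u (vscale H c ?v)"
    have "inner (C ?w) ?w = inner (C u) u + (c * inner (C ?v) u + cnj (c * inner (C ?v) u)) + (c * cnj c) * inner (C ?v) ?v"
      using u v sym[of u ?v] inner_cnj[of u "C ?v"]
      by (simp add: linear_add linear_scale inner_simps algebra_simps)
    moreover have "(c * cnj c) * inner (C ?v) ?v = of_real ((cmod c)\<^sup>2) * inner (C ?v) ?v"
      by (simp only: complex_norm_square)
    ultimately show "0 \<le> Re (inner (C u) u) + 2 * Re (c * inner (C ?v) u) + (cmod c)\<^sup>2 * Re (inner (C ?v) ?v)"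
      using nonneg[of ?w] u v by simp
  qed (use nonneg v in blast)
  also have "inner (C ?v) u = inner ?v ?v" using u v by (simp add: sym)
  also have "(cmod (inner ?v ?v))\<^sup>2 = Re (inner ?v ?v) * Re (inner ?v ?v)"
    using v by (simp add: inner_self power2_eq_square norm_mult)
  also have "Re (inner (C u) u) * Re (inner (C ?v) ?v) \<le> Re (inner (C u) u) * Re (inner ?v ?v)"
    using le_id[OF v] nonneg[OF u] by (rule mult_left_mono)
  finally show ?thesis
    using inner_self_nonneg[OF v] nonneg[OF u] by (cases "Re (inner ?v ?v) = 0") auto
qed

section \<open>Moments and powers of a positive contraction\<close>

lemma pow_closed [simp]: "u \<in> V \<Longrightarrow> (C ^^ n) u \<in> V"
  by (induction n) auto

lemma pow_shift: "u \<in> V \<Longrightarrow> v \<in> V \<Longrightarrow> inner ((C ^^ m) u) ((C ^^ n) v) = inner ((C ^^ (m + n)) u) v"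
proof (induction n arbitrary: m)
  case (Suc n)
  have "inner ((C ^^ m) u) ((C ^^ Suc n) v) = inner ((C ^^ Suc m) u) ((C ^^ n) v)"
    using Suc.prems by (simp add: sym)
  then show ?case using Suc.IH[of "Suc m"] Suc.prems by simp
qed simp

lemma pow_add: "u \<in> V \<Longrightarrow> v \<in> V \<Longrightarrow> (C ^^ n) (vadd H u v) = vadd H ((C ^^ n) u) ((C ^^ n) v)"
  by (induction n) (simp_all add: linear_add)

lemma pow_scale: "u \<in> V \<Longrightarrow> (C ^^ n) (vscale H c u) = vscale H c ((C ^^ n) u)"
  by (induction n) (simp_all add: linear_scale)

text \<open>The moments of the spectral measure of \<open>C\<close> at \<open>u\<close>, which lives
  on the unit interval. The inequalities below correspond to polynomial inequalities there.\<close>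

definition moment :: "'a \<Rightarrow> nat \<Rightarrow> real" where
  "moment u n = Re (inner ((C ^^ n) u) u)"

lemma pow_form_Im: "u \<in> V \<Longrightarrow> Im (inner ((C ^^ n) u) u) = 0"
  using inner_cnj[of "(C ^^ n) u" u] pow_shift[of u u 0 n] pow_closed
  by (metis cnj.sel(2) equal_neg_zero add_0 funpow_0)

lemma moment_shift: "u \<in> V \<Longrightarrow> moment u (2 * k + n) = moment ((C ^^ k) u) n"
  using pow_shift[of "u" "u" "k + n" k]
  by (simp add: moment_def mult_2 funpow_add[symmetric] add_ac flip: comp_apply[of "C ^^ n" "C ^^ k"] funpow_add)

text \<open>Splitting powers between the two arguments turns index \<open>2 * k + n\<close> at
  \<open>u\<close> into index \<open>n\<close> at \<open>(C ^^ k) u\<close>, so a property of three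
  consecutive moments has to be checked from 0 and from 1 only.\<close>

lemma moment_even_odd:
  assumes u: "u \<in> V" and P: "\<And>v. v \<in> V \<Longrightarrow> P (moment v 0) (moment v 1) (moment v 2)"
    "\<And>v. v \<in> V \<Longrightarrow> P (moment v 1) (moment v 2) (moment v 3)"
  shows "P (moment u n) (moment u (Suc n)) (moment u (Suc (Suc n)))"
proof (cases "even n")
  case True
  then obtain k where "n = 2 * k" by blast
  then show ?thesis
    using P(1)[of "(C ^^ k) u"] moment_shift[OF u, of k 0] moment_shift[OF u, of k 1] moment_shift[OF u, of k 2] u
    by simp
next
  case False
  then obtain k where "n = 2 * k + 1" by (rule oddE)
  then show ?thesis
    using P(2)[of "(C ^^ k) u"] moment_shift[OF u, of k 1] moment_shift[OF u, of k 2] moment_shift[OF u, of k 3] u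
    by (simp add: eval_nat_numeral)
qed

lemma moment_simps:
  assumes "u \<in> V"
  shows "moment u 0 = Re (inner u u)" "moment u 1 = Re (inner (C u) u)"
    "moment u (Suc 0) = Re (inner (C u) u)" "moment u 2 = Re (inner (C u) (C u))" "moment u 3 = Re (inner (C (C u)) (C u))"
  using assms by (simp_all add: moment_def eval_nat_numeral sym)

lemma moment_nonneg: "u \<in> V \<Longrightarrow> 0 \<le> moment u n"
  by (rule moment_even_odd[of u "\<lambda>x y z. 0 \<le> x"]) (simp_all add: moment_simps inner_self_nonneg nonneg)

lemma moment_decreasing: "u \<in> V \<Longrightarrow> moment u (Suc n) \<le> moment u n"
  by (rule moment_even_odd[of u "\<lambda>x y z. y \<le> x"]) (simp_all only: moment_simps le_id square_le)

text \<open>The second difference is the squared norm of \<open>v - C v\<close> at index 0, and the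
  form of \<open>C\<close> at \<open>v - C v\<close> at index 1.\<close>

lemma moment_convex: "u \<in> V \<Longrightarrow> moment u (Suc n) - moment u (Suc (Suc n)) \<le> moment u n - moment u (Suc n)"
proof (rule moment_even_odd[of u "\<lambda>x y z. y - z \<le> x - y"])
  fix v assume v: "v \<in> V"
  show "moment v 1 - moment v 2 \<le> moment v 0 - moment v 1"
    using inner_self_nonneg[of "vdiff H v (C v)"] v Re_inner_commute[of v "C v"]
    by (simp add: moment_simps inner_simps)
  show "moment v 2 - moment v 3 \<le> moment v 1 - moment v 2"
    using nonneg[of "vdiff H v (C v)"] v sym[of "C v" v]
    by (simp add: moment_simps linear_diff inner_simps)
qed

text \<open>Integrated form of \<open>t - t ^ Suc n \<le> n * (1 - t)\<close> on the unit interval.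
  It will dominate the approximating functionals by multiples of \<open>\<tau>\<close>.\<close>

lemma moment_diff_le:
  assumes u: "u \<in> V"
  shows "moment u 1 - moment u (Suc n) \<le> real n * (moment u 0 - moment u 1)"
proof -
  have "moment u 1 - moment u (Suc n) \<le> real n * (moment u 1 - moment u (Suc 1))"
    using convex_seq_increments(1)[of "\<lambda>n. moment u (Suc n)" n, OF moment_convex[OF u]] by simp
  also have "\<dots> \<le> real n * (moment u 0 - moment u 1)"
    using moment_convex[OF u, of 0] by (intro mult_left_mono) simp_all
  finally show ?thesis .
qed

text \<open>Squared distances between powers are combinations of moments, which converge by
  monotonicity. The limit is fixed because \<open>C\<close> can be moved to the other argument of
  the inner product.\<close>

lemma pow_convergent:
  assumes u: "u \<in> V"
  obtains w where "w \<in> V" "C w = w" "(\<lambda>n. nrm (vdiff H ((C ^^ n) u) w)) \<longlonglongrightarrow> 0"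
proof -
  have dist: "(nrm (vdiff H ((C ^^ m) u) ((C ^^ n) u)))\<^sup>2 = moment u (2 * m) - 2 * moment u (m + n) + moment u (2 * n)" for m n
  proof -
    have "(nrm (vdiff H ((C ^^ m) u) ((C ^^ n) u)))\<^sup>2
      = Re (inner ((C ^^ m) u) ((C ^^ m) u)) - Re (inner ((C ^^ m) u) ((C ^^ n) u))
        - (Re (inner ((C ^^ n) u) ((C ^^ m) u)) - Re (inner ((C ^^ n) u) ((C ^^ n) u)))"
      using u by (simp add: nrm_square inner_simps)
    then show ?thesis
      unfolding pow_shift[OF u u] moment_def mult_2 add.commute[of n m] by linarith
  qed
  have "decseq (moment u)"
    by (rule decseq_SucI) (rule moment_decreasing[OF u])
  then obtain L where L: "moment u \<longlonglongrightarrow> L"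
    using decseq_convergent[of "moment u" 0] moment_nonneg[OF u] by blast
  have "\<exists>w\<in>V. (\<lambda>n. nrm (vdiff H ((C ^^ n) u) w)) \<longlonglongrightarrow> 0"
  proof (rule complete)
    fix e :: real assume e: "e > 0"
    then have "e\<^sup>2 / 4 > 0" by simp
    then obtain N where N: "\<And>n. n \<ge> N \<Longrightarrow> \<bar>moment u n - L\<bar> < e\<^sup>2 / 4"
      using L unfolding LIMSEQ_iff real_norm_def by meson
    have "nrm (vdiff H ((C ^^ m) u) ((C ^^ n) u)) < e" if mn: "m \<ge> N" "n \<ge> N" for m n
    proof (rule power2_less_imp_less)
      show "(nrm (vdiff H ((C ^^ m) u) ((C ^^ n) u)))\<^sup>2 < e\<^sup>2"
        unfolding dist using N[of "2 * m"] N[of "m + n"] N[of "2 * n"] mn by linarith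
    qed (use e in simp)
    then show "\<exists>N. \<forall>m\<ge>N. \<forall>n\<ge>N. nrm (vdiff H ((C ^^ m) u) ((C ^^ n) u)) < e" by blast
  qed (simp add: u)
  then obtain w where w: "w \<in> V" "(\<lambda>n. nrm (vdiff H ((C ^^ n) u) w)) \<longlonglongrightarrow> 0" by blast
  have "C w = w"
  proof (rule vec_eqI)
    fix v assume v: "v \<in> V"
    have "(\<lambda>n. inner ((C ^^ n) u) (C v)) \<longlonglongrightarrow> inner w (C v)"
      by (rule inner_tendsto) (use u v w in auto)
    moreover have "(\<lambda>n. inner ((C ^^ Suc n) u) v) \<longlonglongrightarrow> inner w v"
      by (rule LIMSEQ_Suc[OF inner_tendsto[of "\<lambda>n. (C ^^ n) u"]]) (use u v w in auto)
    moreover have "inner ((C ^^ Suc n) u) v = inner ((C ^^ n) u) (C v)" for n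
      using u v by (simp add: sym)
    ultimately show "inner (C w) v = inner w v"
      using LIMSEQ_unique w v by (simp add: sym)
  qed (use w in auto)
  with w show ?thesis using that by blast
qed

text \<open>The operators \<open>D\<^sub>0 = C\<close>, \<open>D\<^sub>j\<^sub>+\<^sub>1 = D\<^sub>j - D\<^sub>j\<^sup>2\<close> satisfy \<open>C = \<Sum>\<^sub>j D\<^sub>j\<^sup>2\<close>; this replaces the square
  root of \<open>C\<close>.\<close>

primrec square_part :: "nat \<Rightarrow> 'a \<Rightarrow> 'a" where
  "square_part 0 = C"
| "square_part (Suc j) = (\<lambda>u. vdiff H (square_part j u) (square_part j (square_part j u)))"

lemma square_part_contraction: "positive_contraction H (square_part j)"
proof (induction j)
  case 0
  show ?case by simp (rule positive_contraction_axioms)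
next
  case (Suc j)
  then interpret D: positive_contraction H "square_part j" .
  show ?case
  proof (unfold_locales)
    fix u v assume uv: "u \<in> V" "v \<in> V"
    show "square_part (Suc j) u \<in> V" using uv by simp
    show "inner (square_part (Suc j) u) v = inner u (square_part (Suc j) v)"
      using uv by (simp add: inner_simps D.sym)
    show "0 \<le> Re (inner (square_part (Suc j) u) u)"
      using D.square_le[OF uv(1)] uv by (simp add: inner_simps D.sym)
    show "Re (inner (square_part (Suc j) u) u) \<le> Re (inner u u)"
      using D.le_id[OF uv(1)] inner_self_nonneg[of "square_part j u"] uv by (simp add: inner_simps D.sym)
  qed
qed

lemma square_part_closed [simp]: "u \<in> V \<Longrightarrow> square_part j u \<in> V"
  using positive_contraction.closed[OF square_part_contraction] .

text \<open>Commutation with the representation will let one factor of each square act on the cyclic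
  vector.\<close>

lemma square_part_commute:
  assumes T: "T \<in> bounded_ops H" and comm: "\<And>u. u \<in> V \<Longrightarrow> T (C u) = C (T u)"
  shows "u \<in> V \<Longrightarrow> T (square_part j u) = square_part j (T u)"
  by (induction j arbitrary: u) (use T comm in \<open>simp_all add: bounded_ops_diff bounded_opsD\<close>)

lemma square_part_step:
  assumes "u \<in> V" "v \<in> V"
  shows "inner (square_part j u) (square_part j v) = inner (square_part j u) v - inner (square_part (Suc j) u) v"
  using assms positive_contraction.sym[OF square_part_contraction, of "square_part j u" v]
  by (simp add: inner_simps)

lemma square_part_telescope:
  assumes "u \<in> V" "v \<in> V"
  shows "(\<Sum>j<n. inner (square_part j u) (square_part j v)) = inner (C u) v - inner (square_part n u) v"
  by (induction n) (use assms in \<open>simp_all only: sum.lessThan_Suc square_part_step, simp_all\<close>)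

lemma square_part_summable: "u \<in> V \<Longrightarrow> summable (\<lambda>j. (nrm (square_part j u))\<^sup>2)"
proof (rule summableI_nonneg_bounded)
  fix n assume u: "u \<in> V"
  have "(\<Sum>j<n. (nrm (square_part j u))\<^sup>2) = Re (inner (C u) u) - Re (inner (square_part n u) u)"
    using square_part_telescope[OF u u, of n] u by (simp add: nrm_square flip: Re_sum)
  then show "(\<Sum>j<n. (nrm (square_part j u))\<^sup>2) \<le> Re (inner (C u) u)"
    using positive_contraction.nonneg[OF square_part_contraction u] by simp
qed simp

text \<open>The telescoping remainder is the form of \<open>square_part n\<close>; it tends to 0
  because the squared norms of \<open>square_part n u\<close> are summable.\<close>

lemma square_part_sums:
  assumes u: "u \<in> V" and v: "v \<in> V"
  shows "(\<lambda>j. inner (square_part j u) (square_part j v)) sums inner (C u) v"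
proof -
  have "(\<lambda>n. inner (square_part n u) v) \<longlonglongrightarrow> 0"
  proof (rule Lim_null_comparison)
    show "\<forall>\<^sub>F n in sequentially. norm (inner (square_part n u) v) \<le> nrm (square_part n u) * nrm v"
      using inner_le_nrm u v by simp
    have "(\<lambda>n. (nrm (square_part n u))\<^sup>2) \<longlonglongrightarrow> 0"
      by (rule summable_LIMSEQ_zero[OF square_part_summable[OF u]])
    then have "(\<lambda>n. sqrt ((nrm (square_part n u))\<^sup>2)) \<longlonglongrightarrow> sqrt 0"
      by (rule tendsto_real_sqrt)
    then have "(\<lambda>n. nrm (square_part n u)) \<longlonglongrightarrow> 0"
      using u by simp
    then show "(\<lambda>n. nrm (square_part n u) * nrm v) \<longlonglongrightarrow> 0"
      by (rule tendsto_mult_left_zero)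
  qed
  then have "(\<lambda>n. inner (C u) v - inner (square_part n u) v) \<longlonglongrightarrow> inner (C u) v - 0"
    by (intro tendsto_intros)
  then show ?thesis
    unfolding sums_def square_part_telescope[OF u v] by simp
qed

end

section \<open>The GNS space\<close>

abbreviation gns_class :: "('a::unital_cstar_algebra \<Rightarrow> complex) \<Rightarrow> (nat \<Rightarrow> 'a) \<Rightarrow> (nat \<Rightarrow> 'a) set" where
  "gns_class \<tau> x \<equiv> gns_rel \<tau> `` {x}"

definition gns_vec :: "('a::unital_cstar_algebra \<Rightarrow> complex) \<Rightarrow> 'a \<Rightarrow> (nat \<Rightarrow> 'a) set" where
  "gns_vec \<tau> a = gns_class \<tau> (\<lambda>_. a)"

text \<open>Working with sequences instead of classes lets the same expression be formed for a
  functional \<open>\<nu>\<close> on sequences that are Cauchy for a dominating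
  \<open>\<tau>\<close>.\<close>

definition gns_pairing :: "('a::unital_cstar_algebra \<Rightarrow> complex) \<Rightarrow> (nat \<Rightarrow> 'a) \<Rightarrow> (nat \<Rightarrow> 'a) \<Rightarrow> complex" where
  "gns_pairing \<tau> x y = lim (\<lambda>n. \<tau> (star (y n) * x n))"

context
  fixes \<tau> :: "'a::unital_cstar_algebra \<Rightarrow> complex"
  assumes plf: "plf \<tau>"
begin

section \<open>The GNS seminorm and its Cauchy sequences\<close>

lemma gns_norm_nonneg [simp]: "0 \<le> gns_norm \<tau> a"
  by (simp add: gns_norm_def plf_nonneg[OF plf])

lemma gns_norm_square: "(gns_norm \<tau> a)\<^sup>2 = Re (\<tau> (star a * a))"
  by (simp add: gns_norm_def plf_nonneg[OF plf])

lemma gns_norm_zero [simp]: "gns_norm \<tau> 0 = 0"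
  by (simp add: gns_norm_def plf_zero[OF plf])

lemma gns_norm_cauchy_schwarz: "cmod (\<tau> (star b * a)) \<le> gns_norm \<tau> a * gns_norm \<tau> b"
  by (rule power2_le_imp_le)
     (use plf_cauchy_schwarz[OF plf, of b a] in \<open>simp_all add: power_mult_distrib gns_norm_square\<close>)

lemma gns_norm_triangle: "gns_norm \<tau> (a + b) \<le> gns_norm \<tau> a + gns_norm \<tau> b"
proof (rule power2_le_imp_le)
  have "Re (\<tau> (star a * b)) \<le> gns_norm \<tau> a * gns_norm \<tau> b" "Re (\<tau> (star b * a)) \<le> gns_norm \<tau> a * gns_norm \<tau> b"
    using gns_norm_cauchy_schwarz[of a b] gns_norm_cauchy_schwarz[of b a]
      complex_Re_le_cmod[of "\<tau> (star a * b)"] complex_Re_le_cmod[of "\<tau> (star b * a)"]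
      mult.commute[of "gns_norm \<tau> a" "gns_norm \<tau> b"] by linarith+
  moreover have "(gns_norm \<tau> (a + b))\<^sup>2 = (gns_norm \<tau> a)\<^sup>2 + (gns_norm \<tau> b)\<^sup>2 + Re (\<tau> (star a * b)) + Re (\<tau> (star b * a))"
    by (simp add: gns_norm_square star_add distrib_left distrib_right plf_add[OF plf])
  ultimately show "(gns_norm \<tau> (a + b))\<^sup>2 \<le> (gns_norm \<tau> a + gns_norm \<tau> b)\<^sup>2"
    unfolding power2_sum by linarith
qed simp

lemma gns_norm_scale: "gns_norm \<tau> (c *\<^sub>C a) = cmod c * gns_norm \<tau> a"
proof (rule power2_eq_imp_eq)
  have "\<tau> (star (c *\<^sub>C a) * (c *\<^sub>C a)) = (c * cnj c) * \<tau> (star a * a)"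
    by (simp add: star_scaleC mult_scaleC_left mult_scaleC_right plf_scale[OF plf])
  then have "\<tau> (star (c *\<^sub>C a) * (c *\<^sub>C a)) = of_real ((cmod c)\<^sup>2) * \<tau> (star a * a)"
    by (simp only: complex_norm_square)
  then show "(gns_norm \<tau> (c *\<^sub>C a))\<^sup>2 = (cmod c * gns_norm \<tau> a)\<^sup>2"
    by (simp add: gns_norm_square power_mult_distrib)
qed simp_all

lemma gns_norm_minus: "gns_norm \<tau> (- a) = gns_norm \<tau> a"
  by (simp add: gns_norm_def)

lemma gns_norm_diff_commute: "gns_norm \<tau> (a - b) = gns_norm \<tau> (b - a)"
  using gns_norm_minus[of "a - b"] by simp

lemma gns_norm_diff_triangle: "gns_norm \<tau> (a - c) \<le> gns_norm \<tau> (a - b) + gns_norm \<tau> (b - c)"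
  using gns_norm_triangle[of "a - b" "b - c"] by simp

text \<open>The functional compressed by \<open>x\<close> is positive with value
  \<open>(gns_norm \<tau> x)\<^sup>2\<close> at the unit, and a positive functional is controlled by
  that value.\<close>

lemma gns_norm_mult: "gns_norm \<tau> (a * x) \<le> norm a * gns_norm \<tau> x"
proof (rule power2_le_imp_le)
  have "Re (\<tau> (star x * (star a * a) * x)) \<le> (norm a)\<^sup>2 * Re (\<tau> (star x * 1 * x))"
    by (rule plf_square_le_norm[OF plf_conj[OF plf]])
  then show "(gns_norm \<tau> (a * x))\<^sup>2 \<le> (norm a * gns_norm \<tau> x)\<^sup>2"
    by (simp add: gns_norm_square power_mult_distrib star_mult mult.assoc)
qed simp

lemma gns_cauchyI:
  assumes "\<And>e. e > 0 \<Longrightarrow> \<exists>N. \<forall>m\<ge>N. \<forall>n\<ge>N. gns_norm \<tau> (x m - x n) < e"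
  shows "x \<in> gns_cauchy \<tau>"
  using assms by (simp add: gns_cauchy_def)

lemma gns_cauchyD:
  assumes "x \<in> gns_cauchy \<tau>" "e > 0"
  obtains N where "\<And>m n. m \<ge> N \<Longrightarrow> n \<ge> N \<Longrightarrow> gns_norm \<tau> (x m - x n) < e"
  using assms unfolding gns_cauchy_def by blast

lemma gns_cauchy_const [simp]: "(\<lambda>_. a) \<in> gns_cauchy \<tau>"
  by (auto intro: gns_cauchyI)

lemma gns_cauchy_add: 
  assumes "x \<in> gns_cauchy \<tau>" "y \<in> gns_cauchy \<tau>"
  shows "(\<lambda>n. x n + y n) \<in> gns_cauchy \<tau>"
proof (rule gns_cauchyI)
  fix e :: real assume "e > 0"
  then have e: "e / 2 > 0" by simp
  obtain M where M: "\<And>m n. m \<ge> M \<Longrightarrow> n \<ge> M \<Longrightarrow> gns_norm \<tau> (x m - x n) < e / 2"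
    using gns_cauchyD[OF assms(1) e] by blast
  obtain N where N: "\<And>m n. m \<ge> N \<Longrightarrow> n \<ge> N \<Longrightarrow> gns_norm \<tau> (y m - y n) < e / 2"
    using gns_cauchyD[OF assms(2) e] by blast
  have "gns_norm \<tau> (x m + y m - (x n + y n)) < e" if "m \<ge> max M N" "n \<ge> max M N" for m n
    using gns_norm_triangle[of "x m - x n" "y m - y n"] M[of m n] N[of m n] that
    by (simp add: algebra_simps)
  then show "\<exists>N. \<forall>m\<ge>N. \<forall>n\<ge>N. gns_norm \<tau> (x m + y m - (x n + y n)) < e" by blast
qed

lemma gns_cauchy_lipschitz:
  assumes x: "x \<in> gns_cauchy \<tau>" and lip: "\<And>a b. gns_norm \<tau> (f a - f b) \<le> K * gns_norm \<tau> (a - b)"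
  shows "(\<lambda>n. f (x n)) \<in> gns_cauchy \<tau>"
proof (rule gns_cauchyI)
  fix e :: real assume "e > 0"
  then have "e / (\<bar>K\<bar> + 1) > 0" by simp
  then obtain N where N: "\<And>m n. m \<ge> N \<Longrightarrow> n \<ge> N \<Longrightarrow> gns_norm \<tau> (x m - x n) < e / (\<bar>K\<bar> + 1)"
    using gns_cauchyD[OF x] by blast
  have "gns_norm \<tau> (f (x m) - f (x n)) < e" if "m \<ge> N" "n \<ge> N" for m n
  proof -
    have "gns_norm \<tau> (f (x m) - f (x n)) \<le> (\<bar>K\<bar> + 1) * gns_norm \<tau> (x m - x n)"
      by (rule order_trans[OF lip]) (intro mult_right_mono, auto)
    also have "\<dots> < (\<bar>K\<bar> + 1) * (e / (\<bar>K\<bar> + 1))"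
      using N[OF that] by (intro mult_strict_left_mono) auto
    finally show ?thesis by simp
  qed
  then show "\<exists>N. \<forall>m\<ge>N. \<forall>n\<ge>N. gns_norm \<tau> (f (x m) - f (x n)) < e" by blast
qed

lemma gns_cauchy_scale: "x \<in> gns_cauchy \<tau> \<Longrightarrow> (\<lambda>n. c *\<^sub>C x n) \<in> gns_cauchy \<tau>"
  by (rule gns_cauchy_lipschitz[of x _ "cmod c"])
     (simp_all add: gns_norm_scale scaleC.scale_right_diff_distrib[symmetric])

lemma gns_cauchy_mult: "x \<in> gns_cauchy \<tau> \<Longrightarrow> (\<lambda>n. a * x n) \<in> gns_cauchy \<tau>"
  by (rule gns_cauchy_lipschitz[of x _ "norm a"])
     (simp_all add: right_diff_distrib[symmetric] gns_norm_mult)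

lemma gns_cauchy_diff: "x \<in> gns_cauchy \<tau> \<Longrightarrow> y \<in> gns_cauchy \<tau> \<Longrightarrow> (\<lambda>n. x n - y n) \<in> gns_cauchy \<tau>"
  using gns_cauchy_add[OF _ gns_cauchy_scale[of y "-1"], of x] by simp

lemma gns_cauchy_bounded:
  assumes "x \<in> gns_cauchy \<tau>"
  obtains B where "0 < B" "\<And>n. gns_norm \<tau> (x n) \<le> B"
proof -
  obtain N where N: "\<And>m n. m \<ge> N \<Longrightarrow> n \<ge> N \<Longrightarrow> gns_norm \<tau> (x m - x n) < 1"
    using gns_cauchyD[OF assms] zero_less_one by blast
  define B where "B = 1 + (\<Sum>n\<le>N. gns_norm \<tau> (x n))"
  have le: "gns_norm \<tau> (x n) \<le> (\<Sum>n\<le>N. gns_norm \<tau> (x n))" if "n \<le> N" for n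
    by (rule member_le_sum) (use that in auto)
  have "gns_norm \<tau> (x n) \<le> B" for n
  proof (cases "n \<le> N")
    case True
    then show ?thesis using le[of n] by (simp add: B_def)
  next
    case False
    then have "gns_norm \<tau> (x n - x N) < 1" by (intro N) auto
    then show ?thesis
      using gns_norm_triangle[of "x n - x N" "x N"] le[of N] by (simp add: B_def)
  qed
  moreover have "B > 0" using sum_nonneg[of "{..N}" "\<lambda>n. gns_norm \<tau> (x n)"] by (simp add: B_def add_pos_nonneg)
  ultimately show ?thesis using that by blast
qed

lemma gns_pairing_diff_bound:
  "cmod (\<tau> (star y * x) - \<tau> (star y' * x'))
    \<le> gns_norm \<tau> (x - x') * gns_norm \<tau> y + gns_norm \<tau> x' * gns_norm \<tau> (y - y')"
proof -
  have "\<tau> (star y * x) - \<tau> (star y' * x') = \<tau> (star y * (x - x')) + \<tau> (star (y - y') * x')"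
    by (simp add: plf_add[OF plf, symmetric] plf_diff[OF plf, symmetric] star_diff algebra_simps)
  then show ?thesis
    using norm_triangle_ineq[of "\<tau> (star y * (x - x'))" "\<tau> (star (y - y') * x')"]
      gns_norm_cauchy_schwarz[of y "x - x'"] gns_norm_cauchy_schwarz[of "y - y'" x'] by simp
qed

lemma gns_pairing_tendsto:
  assumes x: "x \<in> gns_cauchy \<tau>" and y: "y \<in> gns_cauchy \<tau>"
  shows "(\<lambda>n. \<tau> (star (y n) * x n)) \<longlonglongrightarrow> gns_pairing \<tau> x y"
proof -
  obtain A where A: "0 < A" "\<And>n. gns_norm \<tau> (x n) \<le> A" using gns_cauchy_bounded[OF x] by blast
  obtain B where B: "0 < B" "\<And>n. gns_norm \<tau> (y n) \<le> B" using gns_cauchy_bounded[OF y] by blast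
  have "Cauchy (\<lambda>n. \<tau> (star (y n) * x n))"
  proof (rule metric_CauchyI)
    fix e :: real assume e: "e > 0"
    then have eA: "e / (2 * A) > 0" and eB: "e / (2 * B) > 0" using A B by auto
    obtain M where M: "\<And>m n. m \<ge> M \<Longrightarrow> n \<ge> M \<Longrightarrow> gns_norm \<tau> (x m - x n) < e / (2 * B)"
      using gns_cauchyD[OF x eB] by blast
    obtain N where N: "\<And>m n. m \<ge> N \<Longrightarrow> n \<ge> N \<Longrightarrow> gns_norm \<tau> (y m - y n) < e / (2 * A)"
      using gns_cauchyD[OF y eA] by blast
    have "dist (\<tau> (star (y m) * x m)) (\<tau> (star (y n) * x n)) < e" if mn: "m \<ge> max M N" "n \<ge> max M N" for m n
    proof -
      have "gns_norm \<tau> (x m - x n) * gns_norm \<tau> (y m) \<le> gns_norm \<tau> (x m - x n) * B"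
        using B by (intro mult_left_mono) auto
      also have "\<dots> < e / (2 * B) * B"
        using M[of m n] mn B by (intro mult_strict_right_mono) auto
      finally have 1: "gns_norm \<tau> (x m - x n) * gns_norm \<tau> (y m) < e / 2" using B by simp
      have "gns_norm \<tau> (x n) * gns_norm \<tau> (y m - y n) \<le> A * gns_norm \<tau> (y m - y n)"
        using A by (intro mult_right_mono) auto
      also have "\<dots> < A * (e / (2 * A))"
        using N[of m n] mn A by (intro mult_strict_left_mono) auto
      finally have 2: "gns_norm \<tau> (x n) * gns_norm \<tau> (y m - y n) < e / 2" using A by simp
      show ?thesis
        using 1 2 gns_pairing_diff_bound[of "y m" "x m" "y n" "x n"] by (simp add: dist_norm)
    qed
    then show "\<exists>N. \<forall>m\<ge>N. \<forall>n\<ge>N. dist (\<tau> (star (y m) * x m)) (\<tau> (star (y n) * x n)) < e" by blast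
  qed
  then have "convergent (\<lambda>n. \<tau> (star (y n) * x n))" by (rule Cauchy_convergent)
  then show ?thesis unfolding gns_pairing_def by (simp add: convergent_LIMSEQ_iff)
qed

section \<open>Classes modulo null sequences\<close>

lemma gns_relD: "(x, y) \<in> gns_rel \<tau> \<Longrightarrow> x \<in> gns_cauchy \<tau>" "(x, y) \<in> gns_rel \<tau> \<Longrightarrow> y \<in> gns_cauchy \<tau>"
  "(x, y) \<in> gns_rel \<tau> \<Longrightarrow> (\<lambda>n. gns_norm \<tau> (x n - y n)) \<longlonglongrightarrow> 0"
  by (simp_all add: gns_rel_def)

lemma gns_rel_dominated:
  assumes "x \<in> gns_cauchy \<tau>" "y \<in> gns_cauchy \<tau>" "\<And>n. gns_norm \<tau> (x n - y n) \<le> g n" "g \<longlonglongrightarrow> 0"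
  shows "(x, y) \<in> gns_rel \<tau>"
proof -
  have "(\<lambda>n. gns_norm \<tau> (x n - y n)) \<longlonglongrightarrow> 0"
    by (rule Lim_null_comparison[OF _ assms(4)]) (use assms(3) in simp)
  then show ?thesis using assms by (simp add: gns_rel_def)
qed

lemma gns_rel_equiv: "equiv (gns_cauchy \<tau>) (gns_rel \<tau>)"
proof (rule equivI)
  show "gns_rel \<tau> \<subseteq> gns_cauchy \<tau> \<times> gns_cauchy \<tau>" by (auto simp: gns_rel_def)
  show "refl_on (gns_cauchy \<tau>) (gns_rel \<tau>)" by (auto simp: refl_on_def gns_rel_def)
  show "sym (gns_rel \<tau>)"
    by (rule symI) (auto simp: gns_rel_def gns_norm_diff_commute)
  show "trans (gns_rel \<tau>)"
  proof (rule transI)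
    fix x y z assume xy: "(x, y) \<in> gns_rel \<tau>" and yz: "(y, z) \<in> gns_rel \<tau>"
    show "(x, z) \<in> gns_rel \<tau>"
    proof (rule gns_rel_dominated)
      show "gns_norm \<tau> (x n - z n) \<le> gns_norm \<tau> (x n - y n) + gns_norm \<tau> (y n - z n)" for n
        by (rule gns_norm_diff_triangle)
      show "(\<lambda>n. gns_norm \<tau> (x n - y n) + gns_norm \<tau> (y n - z n)) \<longlonglongrightarrow> 0"
        using tendsto_add[OF gns_relD(3)[OF xy] gns_relD(3)[OF yz]] by simp
    qed (use gns_relD xy yz in auto)
  qed
qed

lemma gns_class_eqI: "(x, y) \<in> gns_rel \<tau> \<Longrightarrow> gns_class \<tau> x = gns_class \<tau> y"
  using equiv_class_eq[OF gns_rel_equiv] .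

lemma gns_class_self: "x \<in> gns_cauchy \<tau> \<Longrightarrow> x \<in> gns_class \<tau> x"
  using equiv_class_self[OF gns_rel_equiv] .

lemma gns_pairing_cong:
  assumes x: "(x, x') \<in> gns_rel \<tau>" and y: "(y, y') \<in> gns_rel \<tau>"
  shows "gns_pairing \<tau> x y = gns_pairing \<tau> x' y'"
proof -
  obtain A where A: "0 < A" "\<And>n. gns_norm \<tau> (x' n) \<le> A" using gns_cauchy_bounded[OF gns_relD(2)[OF x]] by blast
  obtain B where B: "0 < B" "\<And>n. gns_norm \<tau> (y n) \<le> B" using gns_cauchy_bounded[OF gns_relD(1)[OF y]] by blast
  have "(\<lambda>n. \<tau> (star (y n) * x n) - \<tau> (star (y' n) * x' n)) \<longlonglongrightarrow> 0"
  proof (rule Lim_null_comparison)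
    have "cmod (\<tau> (star (y n) * x n) - \<tau> (star (y' n) * x' n))
        \<le> gns_norm \<tau> (x n - x' n) * B + A * gns_norm \<tau> (y n - y' n)" for n
      using gns_pairing_diff_bound[of "y n" "x n" "y' n" "x' n"]
        mult_left_mono[OF B(2)[of n] gns_norm_nonneg[of "x n - x' n"]]
        mult_right_mono[OF A(2)[of n] gns_norm_nonneg[of "y n - y' n"]] by linarith
    then show "\<forall>\<^sub>F n in sequentially. norm (\<tau> (star (y n) * x n) - \<tau> (star (y' n) * x' n))
        \<le> gns_norm \<tau> (x n - x' n) * B + A * gns_norm \<tau> (y n - y' n)"
      by simp
    show "(\<lambda>n. gns_norm \<tau> (x n - x' n) * B + A * gns_norm \<tau> (y n - y' n)) \<longlonglongrightarrow> 0"
      using tendsto_add[OF tendsto_mult_left_zero[OF gns_relD(3)[OF x]] tendsto_mult_right_zero[OF gns_relD(3)[OF y]]]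
      by simp
  qed
  moreover have "(\<lambda>n. \<tau> (star (y n) * x n) - \<tau> (star (y' n) * x' n))
      \<longlonglongrightarrow> gns_pairing \<tau> x y - gns_pairing \<tau> x' y'"
    by (intro tendsto_diff gns_pairing_tendsto gns_relD[OF x] gns_relD[OF y])
  ultimately show ?thesis using LIMSEQ_unique by fastforce
qed

lemma gns_vecs: "vecs (gns_space \<tau>) = gns_class \<tau> ` gns_cauchy \<tau>"
  by (auto simp: gns_space_def quotient_def)

lemma gns_class_in_vecs [simp]: "x \<in> gns_cauchy \<tau> \<Longrightarrow> gns_class \<tau> x \<in> vecs (gns_space \<tau>)"
  by (simp add: gns_vecs)

lemma gns_inner:
  assumes x: "x \<in> gns_cauchy \<tau>" and y: "y \<in> gns_cauchy \<tau>"
  shows "vinner (gns_space \<tau>) (gns_class \<tau> x) (gns_class \<tau> y) = gns_pairing \<tau> x y"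
proof -
  have lim: "(\<lambda>n. \<tau> (star (y' n) * x' n)) \<longlonglongrightarrow> gns_pairing \<tau> x y"
    if "x' \<in> gns_class \<tau> x" "y' \<in> gns_class \<tau> y" for x' y'
  proof -
    have r: "(x, x') \<in> gns_rel \<tau>" "(y, y') \<in> gns_rel \<tau>" using that by auto
    show ?thesis
      unfolding gns_pairing_cong[OF r] by (rule gns_pairing_tendsto) (use r gns_relD in auto)
  qed
  show ?thesis
    unfolding gns_space_def cspace.simps
  proof (rule the_equality)
    fix c assume "\<forall>x'\<in>gns_class \<tau> x. \<forall>y'\<in>gns_class \<tau> y. (\<lambda>n. \<tau> (star (y' n) * x' n)) \<longlonglongrightarrow> c"
    then have "(\<lambda>n. \<tau> (star (y n) * x n)) \<longlonglongrightarrow> c"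
      using gns_class_self x y by blast
    then show "c = gns_pairing \<tau> x y"
      using gns_pairing_tendsto[OF x y] LIMSEQ_unique by blast
  qed (use lim in blast)
qed

lemma gns_add:
  assumes x: "x \<in> gns_cauchy \<tau>" and y: "y \<in> gns_cauchy \<tau>"
  shows "vadd (gns_space \<tau>) (gns_class \<tau> x) (gns_class \<tau> y) = gns_class \<tau> (\<lambda>n. x n + y n)"
proof -
  have "gns_class \<tau> (\<lambda>n. x' n + y' n) = gns_class \<tau> (\<lambda>n. x n + y n)"
    if "x' \<in> gns_class \<tau> x" "y' \<in> gns_class \<tau> y" for x' y'
  proof (rule gns_class_eqI[symmetric], rule gns_rel_dominated)
    have r: "(x, x') \<in> gns_rel \<tau>" "(y, y') \<in> gns_rel \<tau>" using that by auto
    show "gns_norm \<tau> (x n + y n - (x' n + y' n)) \<le> gns_norm \<tau> (x n - x' n) + gns_norm \<tau> (y n - y' n)" for n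
      using gns_norm_triangle[of "x n - x' n" "y n - y' n"] by (simp add: algebra_simps)
    show "(\<lambda>n. gns_norm \<tau> (x n - x' n) + gns_norm \<tau> (y n - y' n)) \<longlonglongrightarrow> 0"
      using tendsto_add[OF gns_relD(3)[OF r(1)] gns_relD(3)[OF r(2)]] by simp
    show "(\<lambda>n. x' n + y' n) \<in> gns_cauchy \<tau>" "(\<lambda>n. x n + y n) \<in> gns_cauchy \<tau>"
      using r gns_relD by (blast intro: gns_cauchy_add)+
  qed
  moreover have "gns_class \<tau> x \<noteq> {}" "gns_class \<tau> y \<noteq> {}"
    using gns_class_self x y by blast+
  ultimately show ?thesis
    unfolding gns_space_def cspace.simps by auto
qed

lemma gns_class_lipschitz:
  assumes x: "x \<in> gns_cauchy \<tau>" and lip: "\<And>a b. gns_norm \<tau> (f a - f b) \<le> K * gns_norm \<tau> (a - b)"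
  shows "(\<Union>x'\<in>gns_class \<tau> x. gns_class \<tau> (\<lambda>n. f (x' n))) = gns_class \<tau> (\<lambda>n. f (x n))"
proof -
  have "gns_class \<tau> (\<lambda>n. f (x' n)) = gns_class \<tau> (\<lambda>n. f (x n))" if "x' \<in> gns_class \<tau> x" for x'
  proof (rule gns_class_eqI[symmetric], rule gns_rel_dominated)
    have r: "(x, x') \<in> gns_rel \<tau>" using that by auto
    show "gns_norm \<tau> (f (x n) - f (x' n)) \<le> K * gns_norm \<tau> (x n - x' n)" for n
      by (rule lip)
    show "(\<lambda>n. K * gns_norm \<tau> (x n - x' n)) \<longlonglongrightarrow> 0"
      using tendsto_mult_right_zero[OF gns_relD(3)[OF r]] by simp
    show "(\<lambda>n. f (x' n)) \<in> gns_cauchy \<tau>" "(\<lambda>n. f (x n)) \<in> gns_cauchy \<tau>"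
      using r gns_relD gns_cauchy_lipschitz[OF _ lip] by blast+
  qed
  moreover have "gns_class \<tau> x \<noteq> {}" using gns_class_self x by blast
  ultimately show ?thesis by auto
qed

lemma gns_scale:
  assumes x: "x \<in> gns_cauchy \<tau>"
  shows "vscale (gns_space \<tau>) c (gns_class \<tau> x) = gns_class \<tau> (\<lambda>n. c *\<^sub>C x n)"
  unfolding gns_space_def cspace.simps
  by (rule gns_class_lipschitz[OF x, of _ "cmod c"])
     (simp add: gns_norm_scale scaleC.scale_right_diff_distrib[symmetric])

lemma gns_rep_class:
  assumes x: "x \<in> gns_cauchy \<tau>"
  shows "gns_rep \<tau> a (gns_class \<tau> x) = gns_class \<tau> (\<lambda>n. a * x n)"
  using gns_class_lipschitz[OF x, of "(*) a" "norm a"] x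
  by (simp add: gns_rep_def gns_norm_mult right_diff_distrib[symmetric])

lemma gns_diff:
  assumes "x \<in> gns_cauchy \<tau>" "y \<in> gns_cauchy \<tau>"
  shows "vdiff (gns_space \<tau>) (gns_class \<tau> x) (gns_class \<tau> y) = gns_class \<tau> (\<lambda>n. x n - y n)"
  using gns_add[OF assms(1) gns_cauchy_scale[OF assms(2), of "-1"]] assms
  by (simp add: vdiff_def gns_scale)

lemma gns_vnorm_tendsto:
  assumes "x \<in> gns_cauchy \<tau>"
  shows "(\<lambda>n. gns_norm \<tau> (x n)) \<longlonglongrightarrow> vnorm (gns_space \<tau>) (gns_class \<tau> x)"
  unfolding vnorm_def gns_norm_def gns_inner[OF assms assms]
  by (intro tendsto_real_sqrt tendsto_Re gns_pairing_tendsto assms)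

lemma gns_pairing_eqI:
  assumes "x \<in> gns_cauchy \<tau>" "y \<in> gns_cauchy \<tau>" "(\<lambda>n. \<tau> (star (y n) * x n)) \<longlonglongrightarrow> c"
  shows "gns_pairing \<tau> x y = c"
  using gns_pairing_tendsto[OF assms(1,2)] assms(3) LIMSEQ_unique by blast

lemma gns_pairing_add_left:
  assumes "x \<in> gns_cauchy \<tau>" "y \<in> gns_cauchy \<tau>" "z \<in> gns_cauchy \<tau>"
  shows "gns_pairing \<tau> (\<lambda>n. x n + y n) z = gns_pairing \<tau> x z + gns_pairing \<tau> y z"
  by (rule gns_pairing_eqI)
     (simp_all add: distrib_left plf_add[OF plf] assms gns_cauchy_add tendsto_add gns_pairing_tendsto)

lemma gns_pairing_scale_left:
  assumes "x \<in> gns_cauchy \<tau>" "z \<in> gns_cauchy \<tau>"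
  shows "gns_pairing \<tau> (\<lambda>n. c *\<^sub>C x n) z = c * gns_pairing \<tau> x z"
  by (rule gns_pairing_eqI)
     (simp_all add: mult_scaleC_right plf_scale[OF plf] assms gns_cauchy_scale tendsto_mult_left gns_pairing_tendsto)

lemma gns_pairing_cnj:
  assumes "x \<in> gns_cauchy \<tau>" "y \<in> gns_cauchy \<tau>"
  shows "gns_pairing \<tau> x y = cnj (gns_pairing \<tau> y x)"
  by (rule gns_pairing_eqI[OF assms], subst plf_hermitian[OF plf])
     (rule tendsto_cnj[OF gns_pairing_tendsto[OF assms(2,1)]])

lemma gns_pairing_self_nonneg: "x \<in> gns_cauchy \<tau> \<Longrightarrow> 0 \<le> Re (gns_pairing \<tau> x x)"
  by (rule LIMSEQ_le_const[OF tendsto_Re[OF gns_pairing_tendsto]]) (auto simp: plf_nonneg[OF plf])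

section \<open>The completion is a Hilbert space\<close>

lemma gns_pre_hilbert: "pre_hilbert_space (gns_space \<tau>)"
proof (unfold_locales, unfold gns_vecs)
  show "gns_class \<tau> ` gns_cauchy \<tau> \<noteq> {}"
    using gns_cauchy_const by blast
next
  fix u v w and c
  assume "u \<in> gns_class \<tau> ` gns_cauchy \<tau>"
  then obtain x where x: "u = gns_class \<tau> x" "x \<in> gns_cauchy \<tau>" by blast
  show "vscale (gns_space \<tau>) c u \<in> gns_class \<tau> ` gns_cauchy \<tau>"
    using x by (simp add: gns_scale gns_cauchy_scale)
  show "0 \<le> Re (vinner (gns_space \<tau>) u u)"
    using x by (simp add: gns_inner gns_pairing_self_nonneg)
  {
    assume "v \<in> gns_class \<tau> ` gns_cauchy \<tau>"
    then obtain y where y: "v = gns_class \<tau> y" "y \<in> gns_cauchy \<tau>" by blast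
    show "vadd (gns_space \<tau>) u v \<in> gns_class \<tau> ` gns_cauchy \<tau>"
      using x y by (simp add: gns_add gns_cauchy_add)
    show "vinner (gns_space \<tau>) u v = cnj (vinner (gns_space \<tau>) v u)"
      using x y by (simp add: gns_inner) (rule gns_pairing_cnj)
    show "u = v" if eq: "\<And>w. w \<in> gns_class \<tau> ` gns_cauchy \<tau> \<Longrightarrow> vinner (gns_space \<tau>) u w = vinner (gns_space \<tau>) v w"
    proof -
      \<comment> \<open>Testing against the class of \<open>x - y\<close> itself shows that this
        difference is a null sequence.\<close>
      let ?z = "\<lambda>n. x n - y n"
      have z: "?z \<in> gns_cauchy \<tau>" using x y by (simp add: gns_cauchy_diff)
      have "gns_pairing \<tau> x ?z = gns_pairing \<tau> y ?z"
        using eq[of "gns_class \<tau> ?z"] x y z by (simp add: gns_inner)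
      moreover have "(\<lambda>n. \<tau> (star (?z n) * x n) - \<tau> (star (?z n) * y n)) \<longlonglongrightarrow> gns_pairing \<tau> x ?z - gns_pairing \<tau> y ?z"
        by (intro tendsto_diff gns_pairing_tendsto x y z)
      ultimately have "(\<lambda>n. \<tau> (star (?z n) * ?z n)) \<longlonglongrightarrow> 0"
        by (simp add: right_diff_distrib plf_diff[OF plf])
      then have "(\<lambda>n. sqrt (Re (\<tau> (star (?z n) * ?z n)))) \<longlonglongrightarrow> sqrt (Re 0)"
        by (intro tendsto_real_sqrt tendsto_Re)
      then have "(x, y) \<in> gns_rel \<tau>"
        using x y by (simp add: gns_rel_def gns_norm_def)
      then show ?thesis using x y by (simp add: gns_class_eqI)
    qed
  }
  assume "w \<in> gns_class \<tau> ` gns_cauchy \<tau>"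
  then obtain z where z: "w = gns_class \<tau> z" "z \<in> gns_cauchy \<tau>" by blast
  show "vinner (gns_space \<tau>) (vscale (gns_space \<tau>) c u) w = c * vinner (gns_space \<tau>) u w"
    using x z by (simp add: gns_scale gns_inner gns_pairing_scale_left gns_cauchy_scale)
  assume "v \<in> gns_class \<tau> ` gns_cauchy \<tau>"
  then obtain y where y: "v = gns_class \<tau> y" "y \<in> gns_cauchy \<tau>" by blast
  show "vinner (gns_space \<tau>) (vadd (gns_space \<tau>) u v) w = vinner (gns_space \<tau>) u w + vinner (gns_space \<tau>) v w"
    using x y z by (simp add: gns_add gns_inner gns_pairing_add_left gns_cauchy_add)
qed

lemma gns_vec_in_vecs [simp]: "gns_vec \<tau> a \<in> vecs (gns_space \<tau>)"
  by (simp add: gns_vec_def)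

lemma gns_inner_vec: "vinner (gns_space \<tau>) (gns_vec \<tau> a) (gns_vec \<tau> b) = \<tau> (star b * a)"
  by (simp add: gns_vec_def gns_inner gns_pairing_eqI)

lemma gns_vnorm_vec: "vnorm (gns_space \<tau>) (gns_vec \<tau> a) = gns_norm \<tau> a"
  by (simp add: vnorm_def gns_norm_def gns_inner_vec)

lemma gns_vec_diff: "vdiff (gns_space \<tau>) (gns_vec \<tau> a) (gns_vec \<tau> b) = gns_vec \<tau> (a - b)"
  by (simp add: gns_vec_def gns_diff)

lemma gns_approx_tendsto:
  assumes x: "x \<in> gns_cauchy \<tau>"
  shows "(\<lambda>k. vnorm (gns_space \<tau>) (vdiff (gns_space \<tau>) (gns_vec \<tau> (x k)) (gns_class \<tau> x))) \<longlonglongrightarrow> 0"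
proof (rule LIMSEQ_I)
  fix e :: real assume e: "e > 0"
  then have e2: "e / 2 > 0" by simp
  obtain N where N: "\<And>m n. m \<ge> N \<Longrightarrow> n \<ge> N \<Longrightarrow> gns_norm \<tau> (x m - x n) < e / 2"
    using gns_cauchyD[OF x e2] by blast
  have "vnorm (gns_space \<tau>) (vdiff (gns_space \<tau>) (gns_vec \<tau> (x k)) (gns_class \<tau> x)) \<le> e / 2" if "k \<ge> N" for k
    unfolding gns_vec_def gns_diff[OF gns_cauchy_const x]
    by (rule LIMSEQ_le_const2[OF gns_vnorm_tendsto])
       (use N[OF that] in \<open>auto intro!: gns_cauchy_diff x exI[of _ N] less_imp_le\<close>)
  moreover have "0 \<le> vnorm (gns_space \<tau>) (vdiff (gns_space \<tau>) (gns_vec \<tau> (x k)) (gns_class \<tau> x))" for k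
    using pre_hilbert_space.nrm_nonneg[OF gns_pre_hilbert] x
    by (simp add: gns_vec_def gns_diff gns_cauchy_diff)
  ultimately show "\<exists>no. \<forall>k\<ge>no. norm (vnorm (gns_space \<tau>) (vdiff (gns_space \<tau>) (gns_vec \<tau> (x k)) (gns_class \<tau> x)) - 0) < e"
    using e by (intro exI[of _ N]) (force intro: le_less_trans[of _ "e / 2"])
qed

lemma gns_dense:
  assumes "u \<in> vecs (gns_space \<tau>)" "e > 0"
  obtains a where "vnorm (gns_space \<tau>) (vdiff (gns_space \<tau>) (gns_vec \<tau> a) u) < e"
proof -
  obtain x where x: "u = gns_class \<tau> x" "x \<in> gns_cauchy \<tau>" using assms gns_vecs by blast
  then have "\<forall>\<^sub>F k in sequentially. vnorm (gns_space \<tau>) (vdiff (gns_space \<tau>) (gns_vec \<tau> (x k)) u) < e"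
    using gns_approx_tendsto[OF x(2)] assms(2) by (simp add: order_tendstoD)
  then show ?thesis using that eventually_happens'[OF sequentially_bot] by blast
qed

text \<open>Each \<open>u k\<close> is replaced by an algebra element within
  \<open>1 / (k + 1)\<close>; these elements form one Cauchy sequence in the algebra, whose class is
  the limit.\<close>

lemma gns_hilbert: "hilbert_space (gns_space \<tau>)"
proof -
  interpret P: pre_hilbert_space "gns_space \<tau>" by (rule gns_pre_hilbert)
  let ?H = "gns_space \<tau>"
  show ?thesis
  proof
    fix u :: "nat \<Rightarrow> (nat \<Rightarrow> 'a) set"
    assume u: "\<And>n. u n \<in> vecs ?H"
      and cau: "\<And>e. e > 0 \<Longrightarrow> \<exists>N. \<forall>m\<ge>N. \<forall>n\<ge>N. vnorm ?H (vdiff ?H (u m) (u n)) < e"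
    have "\<exists>a. vnorm ?H (vdiff ?H (gns_vec \<tau> a) (u k)) < 1 / (real k + 1)" for k
      using gns_dense[OF u, of "1 / (real k + 1)" k] by force
    then obtain a where a: "\<And>k. vnorm ?H (vdiff ?H (gns_vec \<tau> (a k)) (u k)) < 1 / (real k + 1)"
      by metis
    have lim1: "(\<lambda>k. 1 / (real k + 1)) \<longlonglongrightarrow> 0"
      using LIMSEQ_inverse_real_of_nat by (simp add: inverse_eq_divide add.commute)
    have ca: "a \<in> gns_cauchy \<tau>"
    proof (rule gns_cauchyI)
      fix e :: real assume "e > 0"
      then have e: "e / 3 > 0" by simp
      obtain M where M: "\<And>m n. m \<ge> M \<Longrightarrow> n \<ge> M \<Longrightarrow> vnorm ?H (vdiff ?H (u m) (u n)) < e / 3"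
        using cau[OF e] by blast
      obtain N where N: "\<And>k. k \<ge> N \<Longrightarrow> 1 / (real k + 1) < e / 3"
        using order_tendstoD(2)[OF lim1 e] by (auto simp: eventually_sequentially)
      have "gns_norm \<tau> (a m - a n) < e" if mn: "m \<ge> max M N" "n \<ge> max M N" for m n
      proof -
        have "gns_norm \<tau> (a m - a n) = vnorm ?H (vdiff ?H (gns_vec \<tau> (a m)) (gns_vec \<tau> (a n)))"
          by (simp add: gns_vec_diff gns_vnorm_vec)
        also have "\<dots> \<le> vnorm ?H (vdiff ?H (gns_vec \<tau> (a m)) (u m)) + vnorm ?H (vdiff ?H (u m) (gns_vec \<tau> (a n)))"
          using u by (intro P.nrm_diff_triangle) auto
        also have "vnorm ?H (vdiff ?H (u m) (gns_vec \<tau> (a n))) \<le> vnorm ?H (vdiff ?H (u m) (u n)) + vnorm ?H (vdiff ?H (u n) (gns_vec \<tau> (a n)))"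
          using u by (intro P.nrm_diff_triangle) auto
        finally show ?thesis
          using a[of m] a[of n] M[of m n] N[of m] N[of n] mn P.nrm_diff_commute[OF u[of n], of "gns_vec \<tau> (a n)"] by simp
      qed
      then show "\<exists>N. \<forall>m\<ge>N. \<forall>n\<ge>N. gns_norm \<tau> (a m - a n) < e" by blast
    qed
    have "(\<lambda>k. vnorm ?H (vdiff ?H (u k) (gns_class \<tau> a))) \<longlonglongrightarrow> 0"
    proof (rule Lim_null_comparison)
      have "vnorm ?H (vdiff ?H (u k) (gns_class \<tau> a)) \<le> 1 / (real k + 1) + vnorm ?H (vdiff ?H (gns_vec \<tau> (a k)) (gns_class \<tau> a))" for k
        using P.nrm_diff_triangle[OF u[of k], of "gns_vec \<tau> (a k)" "gns_class \<tau> a"] a[of k] ca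
          P.nrm_diff_commute[OF u[of k], of "gns_vec \<tau> (a k)"] by simp
      then show "\<forall>\<^sub>F k in sequentially. norm (vnorm ?H (vdiff ?H (u k) (gns_class \<tau> a)))
          \<le> 1 / (real k + 1) + vnorm ?H (vdiff ?H (gns_vec \<tau> (a k)) (gns_class \<tau> a))"
        using u ca by simp
      show "(\<lambda>k. 1 / (real k + 1) + vnorm ?H (vdiff ?H (gns_vec \<tau> (a k)) (gns_class \<tau> a))) \<longlonglongrightarrow> 0"
        using tendsto_add[OF lim1 gns_approx_tendsto[OF ca]] by simp
    qed
    then show "\<exists>v\<in>vecs ?H. (\<lambda>k. vnorm ?H (vdiff ?H (u k) v)) \<longlonglongrightarrow> 0"
      using ca by (intro bexI[of _ "gns_class \<tau> a"]) simp_all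
  qed
qed

section \<open>The GNS representation and its bicommutant\<close>

lemma gns_vecE:
  assumes "u \<in> vecs (gns_space \<tau>)"
  obtains x where "x \<in> gns_cauchy \<tau>" "u = gns_class \<tau> x"
  using assms gns_vecs by blast

lemma gns_rep_vec: "gns_rep \<tau> a (gns_vec \<tau> b) = gns_vec \<tau> (a * b)"
  by (simp add: gns_vec_def gns_rep_class)

text \<open>Bounds on the algebra pass to the completion as limits of seminorms. Besides
  \<open>norm d\<close>, the constant may come from an order estimate, as for the cutoffs used
  later.\<close>

lemma gns_rep_norm_le:
  assumes le: "\<And>x. gns_norm \<tau> (d * x) \<le> C * gns_norm \<tau> x"
    and u: "u \<in> vecs (gns_space \<tau>)"
  shows "vnorm (gns_space \<tau>) (gns_rep \<tau> d u) \<le> C * vnorm (gns_space \<tau>) u"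
proof -
  obtain x where x: "x \<in> gns_cauchy \<tau>" "u = gns_class \<tau> x" using gns_vecE[OF u] by blast
  show ?thesis
    unfolding x(2) gns_rep_class[OF x(1)]
    by (rule LIMSEQ_le[OF gns_vnorm_tendsto tendsto_mult_left[OF gns_vnorm_tendsto]])
       (use x le in \<open>auto intro: gns_cauchy_mult\<close>)
qed

lemma gns_rep_bounded_op: "gns_rep \<tau> a \<in> bounded_ops (gns_space \<tau>)"
  and gns_rep_norm: "u \<in> vecs (gns_space \<tau>) \<Longrightarrow>
    vnorm (gns_space \<tau>) (gns_rep \<tau> a u) \<le> norm a * vnorm (gns_space \<tau>) u"
proof -
  interpret hilbert_space "gns_space \<tau>" by (rule gns_hilbert)
  have bd: "nrm (gns_rep \<tau> a u) \<le> norm a * nrm u" if "u \<in> V" for u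
    by (rule gns_rep_norm_le[OF gns_norm_mult that])
  show "u \<in> V \<Longrightarrow> nrm (gns_rep \<tau> a u) \<le> norm a * nrm u" by (rule bd)
  have add: "gns_rep \<tau> a (vadd (gns_space \<tau>) u v) = vadd (gns_space \<tau>) (gns_rep \<tau> a u) (gns_rep \<tau> a v)"
    if "u \<in> V" "v \<in> V" for u v
    using that by (elim gns_vecE) (simp add: gns_add gns_rep_class gns_cauchy_add gns_cauchy_mult distrib_left)
  have scale: "gns_rep \<tau> a (vscale (gns_space \<tau>) c u) = vscale (gns_space \<tau>) c (gns_rep \<tau> a u)"
    if "u \<in> V" for c u
    using that by (elim gns_vecE) (simp add: gns_scale gns_rep_class gns_cauchy_scale gns_cauchy_mult mult_scaleC_right)
  have closed: "gns_rep \<tau> a u \<in> V" if "u \<in> V" for u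
    using that by (elim gns_vecE) (simp add: gns_rep_class gns_cauchy_mult)
  show "gns_rep \<tau> a \<in> bounded_ops (gns_space \<tau>)"
    unfolding bounded_ops_def PiE_def using add scale closed bd
    by (intro CollectI conjI ballI allI IntI Pi_I exI[of _ "norm a"]) (simp_all add: gns_rep_def)
qed

lemma gns_inner_rep_star:
  assumes "u \<in> vecs (gns_space \<tau>)" "v \<in> vecs (gns_space \<tau>)"
  shows "vinner (gns_space \<tau>) (gns_rep \<tau> a u) v = vinner (gns_space \<tau>) u (gns_rep \<tau> (star a) v)"
  using assms by (elim gns_vecE)
    (simp add: gns_rep_class gns_inner gns_cauchy_mult gns_pairing_def star_mult star_star mult.assoc)

lemma gns_rep_adj: "op_adj (gns_space \<tau>) (gns_rep \<tau> a) = gns_rep \<tau> (star a)"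
  by (rule hilbert_space.op_adj_eqI[OF gns_hilbert gns_rep_bounded_op gns_rep_bounded_op gns_inner_rep_star])

lemma gns_rep_add: "gns_rep \<tau> (a + b) = op_add (gns_space \<tau>) (gns_rep \<tau> a) (gns_rep \<tau> b)"
proof (rule extensionalityI)
  fix u assume u: "u \<in> vecs (gns_space \<tau>)"
  then show "gns_rep \<tau> (a + b) u = op_add (gns_space \<tau>) (gns_rep \<tau> a) (gns_rep \<tau> b) u"
    by (elim gns_vecE) (simp add: op_add_def gns_rep_class gns_add gns_cauchy_mult distrib_right)
qed (simp_all add: gns_rep_def op_add_def)

lemma gns_rep_scale: "gns_rep \<tau> (c *\<^sub>C a) = op_scale (gns_space \<tau>) c (gns_rep \<tau> a)"
proof (rule extensionalityI)
  fix u assume u: "u \<in> vecs (gns_space \<tau>)"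
  then show "gns_rep \<tau> (c *\<^sub>C a) u = op_scale (gns_space \<tau>) c (gns_rep \<tau> a) u"
    by (elim gns_vecE) (simp add: op_scale_def gns_rep_class gns_scale gns_cauchy_mult mult_scaleC_left)
qed (simp_all add: gns_rep_def op_scale_def)

lemma gns_rep_mult: "gns_rep \<tau> (a * b) = op_mult (gns_space \<tau>) (gns_rep \<tau> a) (gns_rep \<tau> b)"
proof (rule extensionalityI)
  fix u assume u: "u \<in> vecs (gns_space \<tau>)"
  then show "gns_rep \<tau> (a * b) u = op_mult (gns_space \<tau>) (gns_rep \<tau> a) (gns_rep \<tau> b) u"
    by (elim gns_vecE) (simp add: op_mult_def compose_def gns_rep_class gns_cauchy_mult mult.assoc)
qed (simp_all add: gns_rep_def op_mult_def compose_def)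

lemma gns_rep_one: "gns_rep \<tau> 1 = (\<lambda>u\<in>vecs (gns_space \<tau>). u)"
proof (rule extensionalityI)
  fix u assume u: "u \<in> vecs (gns_space \<tau>)"
  then show "gns_rep \<tau> 1 u = (\<lambda>u\<in>vecs (gns_space \<tau>). u) u"
    by (elim gns_vecE) (simp add: gns_rep_class)
qed (simp_all add: gns_rep_def)

lemma gns_rep_range: "range (gns_rep \<tau>) \<subseteq> bounded_ops (gns_space \<tau>)"
  using gns_rep_bounded_op by blast

lemma gns_Linf_bounded: "gns_Linf \<tau> \<subseteq> bounded_ops (gns_space \<tau>)"
  unfolding gns_Linf_def by (rule hilbert_space.commutant_subset[OF gns_hilbert])

lemma gns_rep_in_Linf: "gns_rep \<tau> a \<in> gns_Linf \<tau>"
proof -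
  interpret hilbert_space "gns_space \<tau>" by (rule gns_hilbert)
  show ?thesis
    unfolding gns_Linf_def commutant_iff[OF commutant_subset]
  proof (intro conjI ballI)
    show "gns_rep \<tau> a \<in> bounded_ops (gns_space \<tau>)" by (rule gns_rep_bounded_op)
    fix S u assume "S \<in> commutant (gns_space \<tau>) (range (gns_rep \<tau>))" "u \<in> V"
    then show "gns_rep \<tau> a (S u) = S (gns_rep \<tau> a u)"
      unfolding commutant_iff[OF gns_rep_range] by simp
  qed
qed

lemma gns_Linf_closed:
  assumes "S \<in> gns_Linf \<tau>" "T \<in> gns_Linf \<tau>"
  shows "op_add (gns_space \<tau>) S T \<in> gns_Linf \<tau>" "op_scale (gns_space \<tau>) c T \<in> gns_Linf \<tau>"
    "op_mult (gns_space \<tau>) S T \<in> gns_Linf \<tau>"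
  using hilbert_space.commutant_closed[OF gns_hilbert hilbert_space.commutant_subset[OF gns_hilbert]] assms
  unfolding gns_Linf_def by blast+

lemma gns_Linf_adj:
  assumes "T \<in> gns_Linf \<tau>"
  shows "op_adj (gns_space \<tau>) T \<in> gns_Linf \<tau>"
proof -
  interpret hilbert_space "gns_space \<tau>" by (rule gns_hilbert)
  show ?thesis
    unfolding gns_Linf_def
    by (rule commutant_adj[OF commutant_subset])
       (use assms gns_rep_adj in \<open>auto simp: gns_Linf_def intro!: commutant_adj[OF gns_rep_range]\<close>)
qed

end

subsection \<open>Functionals dominated by the defining functional\<close>

context
  fixes \<tau> \<nu> :: "'a::unital_cstar_algebra \<Rightarrow> complex"
  assumes tau: "plf \<tau>" and nu: "plf \<nu>" and le: "plf_le \<nu> \<tau>"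
begin

lemma gns_norm_mono: "gns_norm \<nu> a \<le> gns_norm \<tau> a"
  using plf_nonneg(1)[OF le[unfolded plf_le_def], of a] by (simp add: gns_norm_def)

lemma gns_cauchy_mono: "x \<in> gns_cauchy \<tau> \<Longrightarrow> x \<in> gns_cauchy \<nu>"
  unfolding gns_cauchy_def mem_Collect_eq using gns_norm_mono by (meson le_less_trans)

lemma gns_rel_mono: "(x, y) \<in> gns_rel \<tau> \<Longrightarrow> (x, y) \<in> gns_rel \<nu>"
  by (rule gns_rel_dominated[OF nu _ _ gns_norm_mono])
     (auto simp: gns_rel_def intro: gns_cauchy_mono)

text \<open>Domination makes \<open>\<nu> (star b * a)\<close> a bounded form on the completion, and
  its operator \<open>C\<close> is the density of \<open>\<nu>\<close>. It lies in the commutant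
  because a left factor crosses the form as its adjoint.\<close>

lemma radon_nikodym:
  obtains C where "positive_contraction (gns_space \<tau>) C" "C \<in> bounded_ops (gns_space \<tau>)"
    "\<And>a b. vinner (gns_space \<tau>) (C (gns_vec \<tau> a)) (gns_vec \<tau> b) = \<nu> (star b * a)"
    "\<And>a u. u \<in> vecs (gns_space \<tau>) \<Longrightarrow> gns_rep \<tau> a (C u) = C (gns_rep \<tau> a u)"
proof -
  interpret hilbert_space "gns_space \<tau>" by (rule gns_hilbert[OF tau])
  \<comment> \<open>The choice of representatives is immaterial: null sequences for
    \<open>\<tau>\<close> are null for \<open>\<nu>\<close>.\<close>
  define S where "S u v = gns_pairing \<nu> (SOME x. x \<in> u) (SOME y. y \<in> v)" for u v
  have S: "S (gns_class \<tau> x) (gns_class \<tau> y) = gns_pairing \<nu> x y"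
    if "x \<in> gns_cauchy \<tau>" "y \<in> gns_cauchy \<tau>" for x y
  proof -
    have "(SOME x'. x' \<in> gns_class \<tau> x) \<in> gns_class \<tau> x" "(SOME y'. y' \<in> gns_class \<tau> y) \<in> gns_class \<tau> y"
      using gns_class_self[OF tau] that by (metis someI)+
    then show ?thesis
      unfolding S_def by (intro gns_pairing_cong[OF nu, symmetric] gns_rel_mono) auto
  qed
  note cau = gns_cauchy_add[OF tau] gns_cauchy_scale[OF tau] gns_cauchy_mult[OF tau]
  note nuc = gns_pairing_cnj[OF nu gns_cauchy_mono gns_cauchy_mono]
  have S_cnj: "S u v = cnj (S v u)" if "u \<in> V" "v \<in> V" for u v
    using that by (elim gns_vecE[OF tau]) (simp only: S, rule nuc)
  have S_add: "S (vadd (gns_space \<tau>) u v) w = S u w + S v w" if "u \<in> V" "v \<in> V" "w \<in> V" for u v w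
    using that by (elim gns_vecE[OF tau])
      (simp add: S gns_add[OF tau] cau gns_pairing_add_left[OF nu] gns_cauchy_mono)
  have S_scale: "S (vscale (gns_space \<tau>) c u) w = c * S u w" if "u \<in> V" "w \<in> V" for c u w
    using that by (elim gns_vecE[OF tau])
      (simp add: S gns_scale[OF tau] cau gns_pairing_scale_left[OF nu] gns_cauchy_mono)
  obtain C where C: "C \<in> bounded_ops (gns_space \<tau>)" "\<And>u v. u \<in> V \<Longrightarrow> v \<in> V \<Longrightarrow> S u v = inner (C u) v"
  proof (rule operator_of_form[of S 1])
    show "S w (vadd (gns_space \<tau>) u v) = S w u + S w v" if "u \<in> V" "v \<in> V" "w \<in> V" for u v w
      using that S_cnj[of w "vadd (gns_space \<tau>) u v"] S_cnj[of w u] S_cnj[of w v] by (simp add: S_add)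
    show "S w (vscale (gns_space \<tau>) c u) = cnj c * S w u" if "u \<in> V" "w \<in> V" for c u w
      using that S_cnj[of w "vscale (gns_space \<tau>) c u"] S_cnj[of w u] by (simp add: S_scale)
    show "cmod (S u v) \<le> 1 * nrm u * nrm v" if uv: "u \<in> V" "v \<in> V" for u v
    proof -
      obtain x y where x: "x \<in> gns_cauchy \<tau>" "u = gns_class \<tau> x" and y: "y \<in> gns_cauchy \<tau>" "v = gns_class \<tau> y"
        using uv by (meson gns_vecE[OF tau])
      have "cmod (gns_pairing \<nu> x y) \<le> nrm u * nrm v"
        unfolding x y
      proof (rule LIMSEQ_le[OF tendsto_norm tendsto_mult])
        show "(\<lambda>n. \<nu> (star (y n) * x n)) \<longlonglongrightarrow> gns_pairing \<nu> x y"
          using gns_pairing_tendsto[OF nu] gns_cauchy_mono x y by blast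
        show "(\<lambda>n. gns_norm \<tau> (x n)) \<longlonglongrightarrow> nrm (gns_class \<tau> x)" "(\<lambda>n. gns_norm \<tau> (y n)) \<longlonglongrightarrow> nrm (gns_class \<tau> y)"
          using gns_vnorm_tendsto[OF tau] x y by blast+
        have "norm (\<nu> (star (y n) * x n)) \<le> gns_norm \<tau> (x n) * gns_norm \<tau> (y n)" for n
          using gns_norm_cauchy_schwarz[OF nu, of "y n" "x n"]
            mult_mono[OF gns_norm_mono[of "x n"] gns_norm_mono[of "y n"] gns_norm_nonneg[OF tau] gns_norm_nonneg[OF nu]]
          by linarith
        then show "\<exists>N. \<forall>n\<ge>N. norm (\<nu> (star (y n) * x n)) \<le> gns_norm \<tau> (x n) * gns_norm \<tau> (y n)" by blast
      qed
      then show ?thesis using x y by (simp add: S)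
    qed
  qed (auto simp: S_add S_scale)
  have "positive_contraction (gns_space \<tau>) C"
  proof unfold_locales
    fix u v assume u: "u \<in> V"
    show "C u \<in> V" using C(1) u by (rule bounded_opsD)
    obtain x where x: "x \<in> gns_cauchy \<tau>" "u = gns_class \<tau> x"
      using u by (meson gns_vecE[OF tau])
    show "0 \<le> Re (inner (C u) u)"
      using u x gns_pairing_self_nonneg[OF nu gns_cauchy_mono[OF x(1)]] by (simp add: C(2)[symmetric] S)
    have "Re (gns_pairing \<nu> x x) \<le> Re (gns_pairing \<tau> x x)"
    proof (rule LIMSEQ_le[OF tendsto_Re tendsto_Re])
      show "(\<lambda>n. \<nu> (star (x n) * x n)) \<longlonglongrightarrow> gns_pairing \<nu> x x"
        "(\<lambda>n. \<tau> (star (x n) * x n)) \<longlonglongrightarrow> gns_pairing \<tau> x x"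
        using gns_pairing_tendsto[OF nu] gns_pairing_tendsto[OF tau] gns_cauchy_mono x by blast+
      show "\<exists>N. \<forall>n\<ge>N. Re (\<nu> (star (x n) * x n)) \<le> Re (\<tau> (star (x n) * x n))"
        using plf_nonneg(1)[OF le[unfolded plf_le_def]] by (auto simp: gns_norm_def)
    qed
    then show "Re (inner (C u) u) \<le> Re (inner u u)"
      using u x by (simp add: C(2)[symmetric] S gns_inner[OF tau])
    assume v: "v \<in> V"
    show "inner (C u) v = inner u (C v)"
      using u v C(2)[of u v] C(2)[of v u] S_cnj[of u v] inner_cnj[of u "C v"] bounded_opsD(1)[OF C(1)] by simp
  qed
  moreover have "inner (C (gns_vec \<tau> a)) (gns_vec \<tau> b) = \<nu> (star b * a)" for a b
    using gns_vec_in_vecs[OF tau] S[of "\<lambda>_. a" "\<lambda>_. b"] gns_cauchy_const[OF tau]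
    by (simp add: C(2)[symmetric]) (simp add: gns_vec_def gns_pairing_def)
  moreover have "gns_rep \<tau> a (C u) = C (gns_rep \<tau> a u)" if u: "u \<in> V" for a u
  proof (rule vec_eqI)
    note closed = bounded_opsD(1)[OF C(1)] bounded_opsD(1)[OF gns_rep_bounded_op[OF tau]]
    show "gns_rep \<tau> a (C u) \<in> V" "C (gns_rep \<tau> a u) \<in> V" using u closed by auto
    fix w assume w: "w \<in> V"
    have "S u (gns_rep \<tau> (star a) w) = S (gns_rep \<tau> a u) w"
      using u w by (elim gns_vecE[OF tau])
        (simp add: S gns_rep_class[OF tau] cau gns_pairing_def star_mult star_star mult.assoc)
    then show "inner (gns_rep \<tau> a (C u)) w = inner (C (gns_rep \<tau> a u)) w"
      using u w closed by (simp add: gns_inner_rep_star[OF tau] C(2))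
  qed
  ultimately show ?thesis using that C(1) by blast
qed

end

text \<open>After division by \<open>t\<close>, the density of \<open>\<nu>\<close> is a sum of
  squares of operators in the commutant. Each square is split between the two arguments, and its
  factors applied to the cyclic vector give the vectors \<open>z j\<close>.\<close>

lemma dominated_vector_representation:
  fixes \<tau> \<nu> :: "'a::unital_cstar_algebra \<Rightarrow> complex"
  assumes tau: "plf \<tau>" and nu: "plf \<nu>" and le: "plf_le \<nu> (\<lambda>a. of_real t * \<tau> a)" and t: "0 < t"
  obtains z :: "nat \<Rightarrow> (nat \<Rightarrow> 'a) set" where "\<And>n. z n \<in> vecs (gns_space \<tau>)"
    "summable (\<lambda>n. (vnorm (gns_space \<tau>) (z n))\<^sup>2)"
    "\<And>a. (\<lambda>n. vinner (gns_space \<tau>) (gns_rep \<tau> a (z n)) (z n)) sums \<nu> a"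
proof -
  interpret hilbert_space "gns_space \<tau>" by (rule gns_hilbert[OF tau])
  let ?\<nu> = "\<lambda>a. of_real (1 / t) * \<nu> a"
  have nu': "plf ?\<nu>" by (rule plf_scale_pos[OF nu]) (use t in simp)
  have "plf (\<lambda>a. of_real (1 / t) * (of_real t * \<tau> a - \<nu> a))"
    by (rule plf_scale_pos[OF le[unfolded plf_le_def]]) (use t in simp)
  then have le': "plf_le ?\<nu> \<tau>"
    using t by (simp add: plf_le_def right_diff_distrib)
  obtain C where C: "positive_contraction (gns_space \<tau>) C" "C \<in> bounded_ops (gns_space \<tau>)"
    "\<And>a b. inner (C (gns_vec \<tau> a)) (gns_vec \<tau> b) = ?\<nu> (star b * a)"
    "\<And>a u. u \<in> V \<Longrightarrow> gns_rep \<tau> a (C u) = C (gns_rep \<tau> a u)"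
    using radon_nikodym[OF tau nu' le'] by blast
  interpret C: positive_contraction "gns_space \<tau>" C by (rule C)
  let ?\<xi> = "gns_vec \<tau> 1"
  have xi: "?\<xi> \<in> V" by (rule gns_vec_in_vecs[OF tau])
  define z where "z j = vscale (gns_space \<tau>) (of_real (sqrt t)) (C.square_part j ?\<xi>)" for j
  have z: "z j \<in> V" for j using xi by (simp add: z_def)
  show ?thesis
  proof (rule that[OF z])
    show "summable (\<lambda>n. (nrm (z n))\<^sup>2)"
      using summable_mult[OF C.square_part_summable[OF xi], of t] t xi
      by (simp add: z_def nrm_scale power_mult_distrib)
    fix a
    note rep = bounded_opsD[OF gns_rep_bounded_op[OF tau]]
    have "inner (gns_rep \<tau> a (z j)) (z j) = of_real t * inner (C.square_part j (gns_vec \<tau> a)) (C.square_part j ?\<xi>)" for j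
    proof -
      have "gns_rep \<tau> a (C.square_part j ?\<xi>) = C.square_part j (gns_rep \<tau> a ?\<xi>)"
        by (rule C.square_part_commute[OF gns_rep_bounded_op[OF tau] _ xi]) (rule C)
      then have "inner (gns_rep \<tau> a (z j)) (z j) = (of_real (sqrt t) * of_real (sqrt t)) * inner (C.square_part j (gns_vec \<tau> a)) (C.square_part j ?\<xi>)"
        using xi by (simp add: z_def rep inner_simps gns_rep_vec[OF tau] gns_vec_in_vecs[OF tau])
      then show ?thesis using t by (simp flip: of_real_mult)
    qed
    moreover have "(\<lambda>j. of_real t * inner (C.square_part j (gns_vec \<tau> a)) (C.square_part j ?\<xi>)) sums (of_real t * inner (C (gns_vec \<tau> a)) ?\<xi>)"
      by (intro sums_mult C.square_part_sums xi gns_vec_in_vecs[OF tau])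
    moreover have "of_real t * inner (C (gns_vec \<tau> a)) ?\<xi> = \<nu> a"
      using t by (simp add: C(3))
    ultimately show "(\<lambda>n. inner (gns_rep \<tau> a (z n)) (z n)) sums \<nu> a" by simp
  qed
qed

section \<open>Normal functionals are absolutely continuous\<close>

text \<open>A polynomial substitute for \<open>(1 + r a a\<^sup>*)\<^sup>-\<^sup>1\<close>: with \<open>X = r a a\<^sup>* / m\<close> for large \<open>m\<close>, the element
  \<open>g = (1 - X)\<^sup>m\<close> tames \<open>a\<close> in the sense that \<open>\<parallel>g a\<parallel>\<^sup>2 \<le> 1 / r\<close>, while \<open>1 - g\<close> is small if \<open>a a\<^sup>*\<close> is.\<close>

lemma approximate_cutoff:
  fixes a :: "'a::unital_cstar_algebra"
  assumes r: "0 < r"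
  obtains g where "star g = g"
    "\<And>\<omega>. plf \<omega> \<Longrightarrow> Re (\<omega> ((1 - g) * (1 - g))) \<le> Re (\<omega> 1)"
    "\<And>\<omega>. plf \<omega> \<Longrightarrow> Re (\<omega> ((1 - g) * (1 - g))) \<le> r * Re (\<omega> (a * star a))"
    "\<And>\<omega>. plf \<omega> \<Longrightarrow> Re (\<omega> (g * a * star a * g)) \<le> (1 / r) * Re (\<omega> 1)"
proof -
  \<comment> \<open>Large enough that \<open>X\<close>, which is \<open>a * star a\<close> divided
    by \<open>c = real m / r\<close>, has norm at most 1; \<open>Suc\<close> keeps \<open>m\<close>
    positive.\<close>
  define m where "m = Suc (nat \<lceil>r * (norm a)\<^sup>2\<rceil>)"
  define c where "c = real m / r"
  have m: "real m > 0" by (simp add: m_def)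
  have c: "c > 0" using r m by (simp add: c_def)
  have "r * (norm a)\<^sup>2 \<le> real m" unfolding m_def by linarith
  then have cn: "(norm a)\<^sup>2 \<le> c" using r by (simp add: c_def field_simps)
  define X where "X = (1 / c) *\<^sub>R (a * star a)"
  have "star X = X" by (simp add: X_def star_scaleR star_mult star_star)
  moreover have "norm X \<le> 1"
    using cn c cstar_identity[of "star a"] by (simp add: X_def star_star norm_star)
  ultimately obtain s where s: "star s = s" "s * s = 1 - X" by (metis sqrt_exists)
  \<comment> \<open>\<open>y = 1 - X\<close> is the square of a self-adjoint element commuting with
    \<open>X\<close>, so every \<open>y ^ n\<close> is again such a square.\<close>
  define y where "y = s * s"
  define w where "w = (1 / sqrt c) *\<^sub>R a"
  have yX: "1 - y = X" using s by (simp add: y_def)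
  have wX: "X = w * star w"
    using c by (simp add: X_def w_def star_scaleR)
  have ypow: "y ^ n = s ^ n * s ^ n" for n
    by (simp add: y_def power_add[symmetric] mult_2[symmetric] power_mult power2_eq_square)
  have star_pow: "star (s ^ n) = s ^ n" for n by (simp add: star_power s)
  have s_comm: "s ^ n * y = y * s ^ n" for n
    unfolding y_def by (metis mult.assoc power_commutes)
  then have sX: "s ^ n * X = X * s ^ n" for n by (simp add: yX[symmetric] algebra_simps)
  \<comment> \<open>The sequence \<open>\<omega> (y ^ n)\<close> is non-negative, decreasing and
    convex, because \<open>y ^ n\<close>, \<open>X * y ^ n\<close> and \<open>X * X * y ^ n\<close>
    all have the form \<open>star b * b\<close>.\<close>
  have f: "0 \<le> Re (\<omega> (y ^ n))" "Re (\<omega> (y ^ Suc n)) \<le> Re (\<omega> (y ^ n))"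
    "Re (\<omega> (y ^ Suc n)) - Re (\<omega> (y ^ Suc (Suc n))) \<le> Re (\<omega> (y ^ n)) - Re (\<omega> (y ^ Suc n))"
    if \<omega>: "plf \<omega>" for \<omega> n
  proof -
    show "0 \<le> Re (\<omega> (y ^ n))"
      using plf_nonneg(1)[OF \<omega>, of "s ^ n"] by (simp add: ypow star_pow)
    have 1: "y ^ n - y ^ Suc n = X * y ^ n"
      by (simp add: yX[symmetric] left_diff_distrib)
    also have "\<dots> = s ^ n * X * s ^ n"
      by (simp add: ypow sX mult.assoc)
    also have "\<dots> = star (star w * s ^ n) * (star w * s ^ n)"
      by (simp add: wX star_mult star_star star_pow mult.assoc)
    finally have "0 \<le> Re (\<omega> (y ^ n - y ^ Suc n))"
      using plf_nonneg(1)[OF \<omega>, of "star w * s ^ n"] by simp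
    then show "Re (\<omega> (y ^ Suc n)) \<le> Re (\<omega> (y ^ n))" by (simp add: plf_diff[OF \<omega>])
    have "(y ^ n - y ^ Suc n) - (y ^ Suc n - y ^ Suc (Suc n)) = X * X * y ^ n"
      by (simp add: yX[symmetric] algebra_simps)
    also have "\<dots> = s ^ n * X * X * s ^ n"
      by (simp add: ypow sX mult.assoc)
    also have "\<dots> = star (X * s ^ n) * (X * s ^ n)"
      using \<open>star X = X\<close> by (simp add: star_mult star_pow mult.assoc)
    finally have "0 \<le> Re (\<omega> ((y ^ n - y ^ Suc n) - (y ^ Suc n - y ^ Suc (Suc n))))"
      using plf_nonneg(1)[OF \<omega>, of "X * s ^ n"] by simp
    then show "Re (\<omega> (y ^ Suc n)) - Re (\<omega> (y ^ Suc (Suc n))) \<le> Re (\<omega> (y ^ n)) - Re (\<omega> (y ^ Suc n))"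
      by (simp add: plf_diff[OF \<omega>] del: power_Suc)
  qed
  have dec: "Re (\<omega> (y ^ n)) \<le> Re (\<omega> (y ^ k))" if \<omega>: "plf \<omega>" "k \<le> n" for \<omega> k n
    using \<open>k \<le> n\<close> by (rule lift_Suc_antimono_le[of "\<lambda>n. Re (\<omega> (y ^ n))", OF f(2)[OF \<omega>(1)]])
  define g where "g = y ^ m"
  have y2m: "y ^ (2 * m) = g * g"
    by (simp add: g_def mult_2 power_add)
  \<comment> \<open>The square of \<open>1 - g\<close> lies below \<open>1 - g\<close>, since the
    bracket is non-negative: compare the decreasing sequence at \<open>m\<close> and
    \<open>2 * m\<close>.\<close>
  have sq: "(1 - g) * (1 - g) = 1 - g - (g - y ^ (2 * m))"
    unfolding y2m by (simp add: algebra_simps)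
  have fm: "Re (\<omega> ((1 - g) * (1 - g))) \<le> Re (\<omega> 1) - Re (\<omega> g)" if \<omega>: "plf \<omega>" for \<omega>
    using dec[OF \<omega>, of m "2 * m"] unfolding sq by (simp add: plf_diff[OF \<omega>] g_def)
  show ?thesis
  proof (rule that[of g])
    show "star g = g" by (simp add: g_def ypow star_mult star_pow)
    fix \<omega> :: "'a \<Rightarrow> complex" assume \<omega>: "plf \<omega>"
    show "Re (\<omega> ((1 - g) * (1 - g))) \<le> Re (\<omega> 1)"
      using fm[OF \<omega>] f(1)[OF \<omega>, of m] by (simp add: g_def)
    \<comment> \<open>Bernoulli's inequality for \<open>1 - (1 - X) ^ m\<close>; the factor
      \<open>m\<close> then cancels against \<open>c\<close>.\<close>
    have "Re (\<omega> 1) - Re (\<omega> g) \<le> real m * Re (\<omega> X)"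
      using convex_seq_increments(1)[of "\<lambda>n. Re (\<omega> (y ^ n))" m, OF f(3)[OF \<omega>]]
      by (simp add: g_def yX[symmetric] plf_diff[OF \<omega>])
    also have "\<dots> = r * Re (\<omega> (a * star a))"
      using m r by (simp add: X_def plf_scaleR[OF \<omega>] c_def)
    finally show "Re (\<omega> ((1 - g) * (1 - g))) \<le> r * Re (\<omega> (a * star a))"
      using fm[OF \<omega>] by linarith
    have "g * a * star a * g = c *\<^sub>R (g * X * g)"
      using c by (simp add: X_def mult.assoc)
    also have "g * X * g = y ^ (2 * m) - y ^ Suc (2 * m)"
    proof -
      have "g * X = X * g"
        by (simp add: g_def yX[symmetric] left_diff_distrib right_diff_distrib power_commutes)
      then have "g * X * g = X * (g * g)" by (simp add: mult.assoc)
      then show ?thesis by (simp add: y2m[symmetric] yX[symmetric] left_diff_distrib)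
    qed
    finally have "Re (\<omega> (g * a * star a * g)) = c * (Re (\<omega> (y ^ (2 * m))) - Re (\<omega> (y ^ Suc (2 * m))))"
      by (simp add: plf_scaleR[OF \<omega>] plf_diff[OF \<omega>] del: power_Suc)
    \<comment> \<open>The decrement at index \<open>2 * m\<close> is at most the average of the
      first \<open>2 * m + 1\<close> decrements, and these add up to at most the value at the
      unit.\<close>
    also have "\<dots> \<le> c * (Re (\<omega> 1) / real m)"
    proof (rule mult_left_mono)
      let ?d = "Re (\<omega> (y ^ (2 * m))) - Re (\<omega> (y ^ Suc (2 * m)))"
      have "real m * ?d \<le> real (Suc (2 * m)) * ?d"
        using f(2)[OF \<omega>, of "2 * m"] by (intro mult_right_mono) auto
      also have "\<dots> \<le> Re (\<omega> 1)"
        using convex_seq_increments(2)[of "\<lambda>n. Re (\<omega> (y ^ n))" "2 * m", OF f(3)[OF \<omega>]]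
          f(1)[OF \<omega>, of "Suc (2 * m)"] by (simp del: power_Suc)
      finally show "?d \<le> Re (\<omega> 1) / real m" using m by (simp add: field_simps)
    qed (use c in simp)
    also have "\<dots> = (1 / r) * Re (\<omega> 1)" using m by (simp add: c_def)
    finally show "Re (\<omega> (g * a * star a * g)) \<le> (1 / r) * Re (\<omega> 1)" .
  qed
qed

text \<open>The vectors present \<open>\<mu>\<close> as a weak* continuous functional composed with
  the representation; \<open>K\<close> is the constant supplied by the twisted trace
  property.\<close>

locale normal_functional =
  fixes \<tau> \<mu> :: "'a::unital_cstar_algebra \<Rightarrow> complex" and K :: real
    and x y :: "nat \<Rightarrow> (nat \<Rightarrow> 'a) set"
  assumes tau: "plf \<tau>" and mu: "plf \<mu>"
    and K: "0 < K" and almost_tracial: "\<And>a. Re (\<tau> (a * star a)) \<le> K * Re (\<tau> (star a * a))"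
    and x: "\<And>n. x n \<in> vecs (gns_space \<tau>)" and y: "\<And>n. y n \<in> vecs (gns_space \<tau>)"
    and sx: "summable (\<lambda>n. (vnorm (gns_space \<tau>) (x n))\<^sup>2)"
    and sy: "summable (\<lambda>n. (vnorm (gns_space \<tau>) (y n))\<^sup>2)"
    and sums: "\<And>a. (\<lambda>n. vinner (gns_space \<tau>) (gns_rep \<tau> a (x n)) (y n)) sums \<mu> a"
begin

sublocale hilbert_space "gns_space \<tau>" by (rule gns_hilbert[OF tau])

lemma summable_xy: "summable (\<lambda>n. nrm (x n) * nrm (y n))"
proof (rule summable_comparison_test'[OF summable_add[OF sx sy]])
  fix n
  have "2 * (nrm (x n) * nrm (y n)) \<le> (nrm (x n))\<^sup>2 + (nrm (y n))\<^sup>2"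
    using zero_le_power2[of "nrm (x n) - nrm (y n)"] by (simp add: power2_diff algebra_simps)
  moreover have "0 \<le> nrm (x n) * nrm (y n)" using x y by simp
  ultimately show "norm (nrm (x n) * nrm (y n)) \<le> (nrm (x n))\<^sup>2 + (nrm (y n))\<^sup>2"
    by simp
qed

lemma rep_closed: "u \<in> V \<Longrightarrow> gns_rep \<tau> a u \<in> V"
  by (rule bounded_opsD(1)[OF gns_rep_bounded_op[OF tau]])

lemma rep_mult: "u \<in> V \<Longrightarrow> gns_rep \<tau> (a * b) u = gns_rep \<tau> a (gns_rep \<tau> b u)"
  by (simp add: gns_rep_mult[OF tau])

text \<open>The hypothesis concerns the cyclic vector only. Almost traciality, applied to
  \<open>star d * h k\<close>, carries it over to the vector of \<open>d\<close> at the price of the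
  factor \<open>sqrt K * norm d\<close>; such vectors are dense and the \<open>h k\<close> act as
  contractions.\<close>

lemma cutoff_strongly_small:
  assumes h: "\<And>k. star (h k) = h k" "\<And>k x. gns_norm \<tau> (h k * x) \<le> 1 * gns_norm \<tau> x"
    and lim: "(\<lambda>k. gns_norm \<tau> (h k)) \<longlonglongrightarrow> 0" and v: "v \<in> V"
  shows "(\<lambda>k. nrm (gns_rep \<tau> (h k) v)) \<longlonglongrightarrow> 0"
proof (rule LIMSEQ_I)
  have vec: "gns_norm \<tau> (h k * d) \<le> (sqrt K * norm d) * gns_norm \<tau> (h k)" for k d
  proof (rule power2_le_imp_le)
    have "(gns_norm \<tau> (h k * d))\<^sup>2 = Re (\<tau> ((star d * h k) * star (star d * h k)))"
      by (simp add: gns_norm_square[OF tau] star_mult star_star h mult.assoc)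
    also have "\<dots> \<le> K * Re (\<tau> (star (star d * h k) * (star d * h k)))"
      by (rule almost_tracial)
    also have "\<dots> = K * (gns_norm \<tau> (star d * h k))\<^sup>2"
      by (simp add: gns_norm_square[OF tau])
    also have "\<dots> \<le> K * (norm d * gns_norm \<tau> (h k))\<^sup>2"
      using gns_norm_mult[OF tau, of "star d" "h k"] K
      by (intro mult_left_mono power_mono) (simp_all add: norm_star gns_norm_nonneg[OF tau])
    finally show "(gns_norm \<tau> (h k * d))\<^sup>2 \<le> (sqrt K * norm d * gns_norm \<tau> (h k))\<^sup>2"
      using K by (simp add: power_mult_distrib)
  qed (use K gns_norm_nonneg[OF tau] in auto)
  fix e :: real assume e: "e > 0"
  then have e2: "e / 2 > 0" by simp
  obtain d where d: "nrm (vdiff (gns_space \<tau>) (gns_vec \<tau> d) v) < e / 2"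
    using gns_dense[OF tau v e2] by blast
  have dV: "gns_vec \<tau> d \<in> V" by (rule gns_vec_in_vecs[OF tau])
  have "(\<lambda>k. (sqrt K * norm d) * gns_norm \<tau> (h k)) \<longlonglongrightarrow> 0"
    by (rule tendsto_mult_right_zero[OF lim])
  then have "\<forall>\<^sub>F k in sequentially. (sqrt K * norm d) * gns_norm \<tau> (h k) < e / 2"
    by (rule order_tendstoD(2)[OF _ e2])
  then obtain N where N: "\<And>k. k \<ge> N \<Longrightarrow> (sqrt K * norm d) * gns_norm \<tau> (h k) < e / 2"
    unfolding eventually_sequentially by blast
  have "nrm (gns_rep \<tau> (h k) v) < e" if k: "k \<ge> N" for k
  proof -
    let ?T = "gns_rep \<tau> (h k)"
    have "nrm (?T v) \<le> nrm (vdiff (gns_space \<tau>) (?T v) (?T (gns_vec \<tau> d))) + nrm (?T (gns_vec \<tau> d))"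
      using v dV rep_closed by (intro nrm_le_diff) auto
    also have "nrm (?T (gns_vec \<tau> d)) < e / 2"
      using vec[of k d] N[OF k] by (simp add: gns_rep_vec[OF tau] gns_vnorm_vec[OF tau])
    also have "vdiff (gns_space \<tau>) (?T v) (?T (gns_vec \<tau> d)) = ?T (vdiff (gns_space \<tau>) v (gns_vec \<tau> d))"
      using bounded_ops_diff[OF gns_rep_bounded_op[OF tau] v dV] by simp
    also have "nrm (?T (vdiff (gns_space \<tau>) v (gns_vec \<tau> d))) \<le> 1 * nrm (vdiff (gns_space \<tau>) v (gns_vec \<tau> d))"
      by (rule gns_rep_norm_le[OF tau h(2)]) (use v dV in simp)
    also have "\<dots> < e / 2" using d nrm_diff_commute[OF v dV] by simp
    finally show ?thesis by simp
  qed
  then show "\<exists>N. \<forall>k\<ge>N. norm (nrm (gns_rep \<tau> (h k) v) - 0) < e"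
    using rep_closed[OF v] by (intro exI[of _ N]) simp
qed

text \<open>For a cutoff \<open>g k\<close> of \<open>a k\<close> and \<open>h k = 1 - g k\<close>,
  split \<open>a k\<close> into \<open>g k * a k\<close> and \<open>h k * a k\<close>. The first
  part has operator norm at most \<open>q\<close> for all \<open>k\<close>. In the second,
  Cauchy-Schwarz for \<open>\<mu>\<close> moves \<open>h k\<close> onto the fixed \<open>b\<close>,
  where strong convergence to 0 is enough. The cutoff level \<open>r\<close> is fixed by
  \<open>e\<close> before \<open>k\<close> grows.\<close>

lemma weakly_null:
  assumes lim: "(\<lambda>k. gns_norm \<tau> (a k)) \<longlonglongrightarrow> 0" and bd: "\<And>k. gns_norm \<mu> (a k) \<le> B"
  shows "(\<lambda>k. \<mu> (star b * a k)) \<longlonglongrightarrow> 0"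
proof (rule LIMSEQ_I)
  fix e :: real assume e: "e > 0"
  then have e2: "e / 2 > 0" by simp
  define S where "S = (\<Sum>n. nrm (x n) * nrm (y n))"
  have S: "0 \<le> S" unfolding S_def by (rule suminf_nonneg[OF summable_xy]) (use x y in simp)
  \<comment> \<open>Chosen so that \<open>q * (norm b * S)\<close> stays below \<open>e / 2\<close>;
    the added 1 keeps the denominator positive.\<close>
  define q where "q = e / (2 * (norm b * S + 1))"
  have bS: "norm b * S + 1 > 0" using S by (simp add: add_nonneg_pos)
  have q: "q > 0" using e bS by (simp add: q_def)
  define r where "r = 1 / q\<^sup>2"
  have r: "r > 0" using q by (simp add: r_def)
  have "\<exists>g. star g = g \<and> (\<forall>\<omega>. plf \<omega> \<longrightarrow> Re (\<omega> ((1 - g) * (1 - g))) \<le> Re (\<omega> 1) \<and>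
    Re (\<omega> ((1 - g) * (1 - g))) \<le> r * Re (\<omega> (a k * star (a k))) \<and>
    Re (\<omega> (g * a k * star (a k) * g)) \<le> (1 / r) * Re (\<omega> 1))" for k
    using approximate_cutoff[OF r, of "a k"] by metis
  then obtain g where g: "\<And>k. star (g k) = g k"
    "\<And>k \<omega>. plf \<omega> \<Longrightarrow> Re (\<omega> ((1 - g k) * (1 - g k))) \<le> Re (\<omega> 1)"
    "\<And>k \<omega>. plf \<omega> \<Longrightarrow> Re (\<omega> ((1 - g k) * (1 - g k))) \<le> r * Re (\<omega> (a k * star (a k)))"
    "\<And>k \<omega>. plf \<omega> \<Longrightarrow> Re (\<omega> (g k * a k * star (a k) * g k)) \<le> (1 / r) * Re (\<omega> 1)"
    by metis
  define h where "h k = 1 - g k" for k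
  have h: "star (h k) = h k" for k by (simp add: h_def star_diff g)
  have h1: "gns_norm \<tau> (h k * z) \<le> 1 * gns_norm \<tau> z" for k z
  proof -
    have "(gns_norm \<tau> (h k * z))\<^sup>2 \<le> (gns_norm \<tau> z)\<^sup>2"
      using g(2)[OF plf_conj[OF tau], of z k]
      by (simp add: gns_norm_square[OF tau] star_mult h mult.assoc) (simp add: h_def)
    then show ?thesis
      using gns_norm_nonneg[OF tau] power2_le_imp_le by simp
  qed
  have hlim: "(\<lambda>k. gns_norm \<tau> (h k)) \<longlonglongrightarrow> 0"
  proof (rule Lim_null_comparison)
    \<comment> \<open>The cutoff estimate involves \<open>a k * star (a k)\<close>, the hypothesis
      \<open>star (a k) * a k\<close>; almost traciality links the two.\<close>
    have "gns_norm \<tau> (h k) \<le> sqrt (r * K) * gns_norm \<tau> (a k)" for k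
    proof (rule power2_le_imp_le)
      have "(gns_norm \<tau> (h k))\<^sup>2 \<le> r * Re (\<tau> (a k * star (a k)))"
        using g(3)[OF tau, of k] by (simp add: gns_norm_square[OF tau] h) (simp add: h_def)
      also have "\<dots> \<le> r * (K * Re (\<tau> (star (a k) * a k)))"
        using r almost_tracial by (intro mult_left_mono) auto
      finally show "(gns_norm \<tau> (h k))\<^sup>2 \<le> (sqrt (r * K) * gns_norm \<tau> (a k))\<^sup>2"
        using r K by (simp add: power_mult_distrib gns_norm_square[OF tau])
    qed (use r K gns_norm_nonneg[OF tau] in simp)
    then show "\<forall>\<^sub>F k in sequentially. norm (gns_norm \<tau> (h k)) \<le> sqrt (r * K) * gns_norm \<tau> (a k)"
      using gns_norm_nonneg[OF tau] by simp
    show "(\<lambda>k. sqrt (r * K) * gns_norm \<tau> (a k)) \<longlonglongrightarrow> 0"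
      by (rule tendsto_mult_right_zero[OF lim])
  qed
  have small: "(\<lambda>k. nrm (gns_rep \<tau> (h k) v)) \<longlonglongrightarrow> 0" if "v \<in> V" for v
    by (rule cutoff_strongly_small[OF h h1 hlim that])
  have main: "cmod (\<mu> (star b * (g k * a k))) < e / 2" for k
  proof -
    \<comment> \<open>The adjoint of \<open>g k * a k\<close> is estimated, because
      \<open>g k * a k * star (a k) * g k\<close> is bounded by
      \<open>1 / r = q\<^sup>2\<close>.\<close>
    have ag: "gns_norm \<tau> (star (a k) * g k * z) \<le> q * gns_norm \<tau> z" for z
    proof (rule power2_le_imp_le)
      have "(gns_norm \<tau> (star (a k) * g k * z))\<^sup>2 = Re (\<tau> (star z * (g k * a k * star (a k) * g k) * z))"
        by (simp add: gns_norm_square[OF tau] star_mult star_star g mult.assoc)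
      also have "\<dots> \<le> q\<^sup>2 * (gns_norm \<tau> z)\<^sup>2"
        using g(4)[OF plf_conj[OF tau], of z k] by (simp add: gns_norm_square[OF tau] r_def)
      finally show "(gns_norm \<tau> (star (a k) * g k * z))\<^sup>2 \<le> (q * gns_norm \<tau> z)\<^sup>2"
        by (simp add: power_mult_distrib)
    qed (use q gns_norm_nonneg[OF tau] in simp)
    have term_le: "norm (inner (gns_rep \<tau> (star b * (g k * a k)) (x n)) (y n)) \<le> q * norm b * (nrm (x n) * nrm (y n))" for n
    proof -
      have "inner (gns_rep \<tau> (star b * (g k * a k)) (x n)) (y n)
          = inner (x n) (gns_rep \<tau> (star (a k) * g k) (gns_rep \<tau> b (y n)))"
        using x y by (simp add: gns_inner_rep_star[OF tau] star_mult star_star g rep_mult[symmetric] mult.assoc)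
      also have "cmod \<dots> \<le> nrm (x n) * nrm (gns_rep \<tau> (star (a k) * g k) (gns_rep \<tau> b (y n)))"
        using x y rep_closed by (intro inner_le_nrm) auto
      also have "\<dots> \<le> nrm (x n) * (q * (norm b * nrm (y n)))"
      proof (rule mult_left_mono)
        have "nrm (gns_rep \<tau> (star (a k) * g k) (gns_rep \<tau> b (y n))) \<le> q * nrm (gns_rep \<tau> b (y n))"
          by (rule gns_rep_norm_le[OF tau ag rep_closed[OF y]])
        also have "\<dots> \<le> q * (norm b * nrm (y n))"
          using q gns_rep_norm[OF tau y] by (intro mult_left_mono) auto
        finally show "nrm (gns_rep \<tau> (star (a k) * g k) (gns_rep \<tau> b (y n))) \<le> q * (norm b * nrm (y n))" .
      qed (use x in simp)
      finally show ?thesis by (simp add: mult_ac)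
    qed
    have "cmod (\<mu> (star b * (g k * a k))) \<le> (\<Sum>n. q * norm b * (nrm (x n) * nrm (y n)))"
      unfolding sums_unique[OF sums] by (rule norm_suminf_le[OF term_le summable_mult[OF summable_xy]])
    also have "\<dots> = q * (norm b * S)"
      by (simp add: S_def suminf_mult[OF summable_xy])
    also have "\<dots> < q * (norm b * S + 1)" using q by simp
    also have "\<dots> = e / 2" unfolding q_def using bS by (simp only: nonzero_eq_divide_eq) (simp add: field_simps)
    finally show ?thesis .
  qed
  have hb: "(\<lambda>k. gns_norm \<mu> (h k * b)) \<longlonglongrightarrow> 0"
  proof -
    let ?t = "\<lambda>n k. inner (gns_rep \<tau> (h k) (gns_rep \<tau> b (x n))) (gns_rep \<tau> (h k) (gns_rep \<tau> b (y n)))"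
    have t_eq: "inner (gns_rep \<tau> (star (h k * b) * (h k * b)) (x n)) (y n) = ?t n k" for n k
      using x y rep_closed
      by (simp add: rep_mult) (simp add: gns_inner_rep_star[OF tau] star_star star_mult rep_mult h)
    have bound_h: "nrm (gns_rep \<tau> (h k) u) \<le> nrm u" if "u \<in> V" for k u
      using gns_rep_norm_le[OF tau h1 that] by simp
    have t_le: "norm (?t n k) \<le> nrm (gns_rep \<tau> (h k) (gns_rep \<tau> b (x n))) * (norm b * nrm (y n))" for n k
    proof -
      have "norm (?t n k) \<le> nrm (gns_rep \<tau> (h k) (gns_rep \<tau> b (x n))) * nrm (gns_rep \<tau> (h k) (gns_rep \<tau> b (y n)))"
        using x y rep_closed by (intro inner_le_nrm) auto
      also have "\<dots> \<le> nrm (gns_rep \<tau> (h k) (gns_rep \<tau> b (x n))) * (norm b * nrm (y n))"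
        using order_trans[OF bound_h[OF rep_closed[OF y]] gns_rep_norm[OF tau y]] rep_closed x
        by (intro mult_left_mono) auto
      finally show ?thesis .
    qed
    \<comment> \<open>Dominated convergence for series: each term tends to 0 by strong smallness of
      \<open>h k\<close>, under a summable bound independent of \<open>k\<close>.\<close>
    have "((\<lambda>k. suminf (\<lambda>n. ?t n k)) \<longlongrightarrow> suminf (\<lambda>n. 0)) sequentially"
    proof (rule conjunct2[OF conjunct2[OF tannerys_theorem]])
      show "(\<lambda>k. ?t n k) \<longlonglongrightarrow> 0" for n
        by (rule Lim_null_comparison[OF always_eventually tendsto_mult_left_zero[OF small[OF rep_closed[OF x, where a = b]], of n "norm b * nrm (y n)"]])
           (intro allI t_le)
      have "norm (?t n k) \<le> (norm b)\<^sup>2 * (nrm (x n) * nrm (y n))" for n k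
      proof -
        have "nrm (gns_rep \<tau> (h k) (gns_rep \<tau> b (x n))) * (norm b * nrm (y n)) \<le> (norm b * nrm (x n)) * (norm b * nrm (y n))"
          using order_trans[OF bound_h[OF rep_closed[OF x]] gns_rep_norm[OF tau x]] y
          by (intro mult_right_mono) auto
        then show ?thesis using t_le[of k n] by (simp add: power2_eq_square mult_ac)
      qed
      then show "\<forall>\<^sub>F (n, k) in at_top \<times>\<^sub>F sequentially. norm (?t n k) \<le> (norm b)\<^sup>2 * (nrm (x n) * nrm (y n))"
        by (auto intro!: always_eventually)
      show "summable (\<lambda>n. (norm b)\<^sup>2 * (nrm (x n) * nrm (y n)))"
        by (rule summable_mult[OF summable_xy])
    qed simp
    then have "(\<lambda>k. \<mu> (star (h k * b) * (h k * b))) \<longlonglongrightarrow> 0"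
      unfolding sums_unique[OF sums] t_eq by simp
    then have "(\<lambda>k. sqrt (Re (\<mu> (star (h k * b) * (h k * b))))) \<longlonglongrightarrow> sqrt (Re 0)"
      by (intro tendsto_real_sqrt tendsto_Re)
    then show ?thesis by (simp add: gns_norm_def)
  qed
  have "(\<lambda>k. gns_norm \<mu> (h k * b) * \<bar>B\<bar>) \<longlonglongrightarrow> 0"
    by (rule tendsto_mult_left_zero[OF hb])
  then have "\<forall>\<^sub>F k in sequentially. gns_norm \<mu> (h k * b) * \<bar>B\<bar> < e / 2"
    by (rule order_tendstoD(2)[OF _ e2])
  then obtain N where N: "\<And>k. k \<ge> N \<Longrightarrow> gns_norm \<mu> (h k * b) * \<bar>B\<bar> < e / 2"
    unfolding eventually_sequentially by blast
  have "norm (\<mu> (star b * a k) - 0) < e" if k: "k \<ge> N" for k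
  proof -
    have "star b * a k = star b * (g k * a k) + star (h k * b) * a k"
      by (simp add: star_mult h) (simp add: h_def algebra_simps)
    then have "norm (\<mu> (star b * a k)) \<le> cmod (\<mu> (star b * (g k * a k))) + cmod (\<mu> (star (h k * b) * a k))"
      by (simp add: plf_add[OF mu] norm_triangle_ineq)
    also have "cmod (\<mu> (star (h k * b) * a k)) \<le> gns_norm \<mu> (a k) * gns_norm \<mu> (h k * b)"
      by (rule gns_norm_cauchy_schwarz[OF mu])
    also have "\<dots> \<le> \<bar>B\<bar> * gns_norm \<mu> (h k * b)"
      using bd[of k] gns_norm_nonneg[OF mu] by (intro mult_right_mono) auto
    also have "\<dots> < e / 2" using N[OF k] by (simp add: mult.commute)
    also note main[of k]
    finally show ?thesis by simp
  qed
  then show "\<exists>N. \<forall>k\<ge>N. norm (\<mu> (star b * a k) - 0) < e" by blast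
qed

text \<open>With \<open>\<rho> = \<mu> + \<tau>\<close> and \<open>C\<close> the density of \<open>\<mu>\<close> in \<open>L\<^sup>2(\<rho>)\<close>, the approximating functionals have
  densities \<open>C - C\<^sup>n\<^sup>+\<^sup>1 \<le> n (1 - C)\<close>. They increase to \<open>\<mu>\<close> because \<open>1\<close> is not an eigenvalue of \<open>C\<close>.\<close>

lemma abs_cont: "abs_cont \<mu> \<tau>"
proof -
  define \<rho> where "\<rho> a = \<mu> a + \<tau> a" for a
  have rho: "plf \<rho>" unfolding \<rho>_def by (rule plf_plus[OF mu tau])
  have le: "plf_le \<mu> \<rho>" using tau by (simp add: plf_le_def \<rho>_def)
  have le': "plf_le \<tau> \<rho>" using mu by (simp add: plf_le_def \<rho>_def)
  let ?G = "gns_space \<rho>"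
  obtain C where C: "positive_contraction ?G C"
    "\<And>a b. vinner ?G (C (gns_vec \<rho> a)) (gns_vec \<rho> b) = \<mu> (star b * a)"
    "\<And>a u. u \<in> vecs ?G \<Longrightarrow> gns_rep \<rho> a (C u) = C (gns_rep \<rho> a u)"
    using radon_nikodym[OF rho mu le] by metis
  interpret C: positive_contraction ?G C by (rule C)
  have vec [simp]: "gns_vec \<rho> a \<in> C.V" for a by (rule gns_vec_in_vecs[OF rho])
  \<comment> \<open>\<open>p k\<close> has density \<open>C ^^ k\<close> with respect to
    \<open>\<rho>\<close>, so \<open>\<rho>\<close>, \<open>\<mu>\<close> and \<open>\<tau>\<close>
    correspond to \<open>1\<close>, \<open>C\<close> and \<open>1 - C\<close>.\<close>
  define p where "p k a = C.inner ((C ^^ k) (gns_vec \<rho> a)) (gns_vec \<rho> 1)" for k a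
  have p0: "p 0 = \<rho>" by (simp add: p_def fun_eq_iff gns_inner_vec[OF rho])
  have p1: "p (Suc 0) = \<mu>" using C(2)[of _ 1] by (simp add: p_def fun_eq_iff)
  have p_add: "p k (a + b) = p k a + p k b" for k a b
  proof -
    have "gns_vec \<rho> (a + b) = vadd ?G (gns_vec \<rho> a) (gns_vec \<rho> b)"
      using gns_add[OF rho gns_cauchy_const[OF rho] gns_cauchy_const[OF rho]] by (simp add: gns_vec_def)
    then show ?thesis by (simp add: p_def C.pow_add C.inner_simps)
  qed
  have p_scale: "p k (c *\<^sub>C a) = c * p k a" for k c a
  proof -
    have "gns_vec \<rho> (c *\<^sub>C a) = vscale ?G c (gns_vec \<rho> a)"
      using gns_scale[OF rho gns_cauchy_const[OF rho]] by (simp add: gns_vec_def)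
    then show ?thesis by (simp add: p_def C.pow_scale C.inner_simps)
  qed
  have comm: "(C ^^ k) (gns_rep \<rho> a u) = gns_rep \<rho> a ((C ^^ k) u)" if "u \<in> C.V" for k a u
    by (induction k) (use that C(3) in simp_all)
  have p_sq: "p k (star a * a) = of_real (C.moment (gns_vec \<rho> a) k)" for k a
  proof -
    have "p k (star a * a) = C.inner (gns_rep \<rho> (star a) ((C ^^ k) (gns_vec \<rho> a))) (gns_vec \<rho> 1)"
      by (simp add: p_def gns_rep_vec[OF rho, symmetric] comm)
    also have "\<dots> = C.inner ((C ^^ k) (gns_vec \<rho> a)) (gns_vec \<rho> a)"
      by (simp add: gns_inner_rep_star[OF rho] star_star gns_rep_vec[OF rho])
    finally show ?thesis
      by (simp add: complex_eq_iff C.moment_def C.pow_form_Im)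
  qed
  \<comment> \<open>The density is \<open>C - C ^^ Suc n\<close>, so \<open>m 0 = 0\<close>; the
    factor \<open>Suc n\<close> in the domination below, instead of \<open>n\<close>, stays positive
    there.\<close>
  define m where "m n a = p (Suc 0) a - p (Suc n) a" for n a
  have mom_mono: "C.moment u (i + j) \<le> C.moment u i" if "u \<in> C.V" for u i j
    by (induction j) (use C.moment_decreasing[OF that] in \<open>auto intro: order_trans\<close>)
  have p_diff: "plf (\<lambda>a. p i a - p (i + j) a)" for i j
    by (rule plfI) (simp_all add: p_add p_scale p_sq algebra_simps mom_mono)
  have plf_m: "plf (m n)" for n
    using p_diff[of "Suc 0" n] by (simp add: m_def[abs_def])
  have "plf_le (m n) (m (Suc n))" for n
    using p_diff[of "Suc n" 1] by (simp add: plf_le_def m_def)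
  moreover have "\<exists>t>0. plf_le (m n) (\<lambda>a. of_real t * \<tau> a)" for n
  proof (intro exI conjI)
    have tau_p: "\<tau> a = p 0 a - p (Suc 0) a" for a by (simp add: p0 p1 \<rho>_def)
    show "plf_le (m n) (\<lambda>a. of_real (real (Suc n)) * \<tau> a)"
      unfolding plf_le_def
    proof (rule plfI)
      fix a
      have eq: "of_real (real (Suc n)) * \<tau> (star a * a) - m n (star a * a)
         = of_real (real (Suc n) * (C.moment (gns_vec \<rho> a) 0 - C.moment (gns_vec \<rho> a) 1)
           - (C.moment (gns_vec \<rho> a) 1 - C.moment (gns_vec \<rho> a) (Suc n)))"
        by (simp add: tau_p m_def p_sq)
      have "real n * (C.moment (gns_vec \<rho> a) 0 - C.moment (gns_vec \<rho> a) 1)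
          \<le> real (Suc n) * (C.moment (gns_vec \<rho> a) 0 - C.moment (gns_vec \<rho> a) 1)"
        using C.moment_decreasing[of "gns_vec \<rho> a" 0] by (intro mult_right_mono) auto
      then show "0 \<le> Re (of_real (real (Suc n)) * \<tau> (star a * a) - m n (star a * a))"
        unfolding eq Re_complex_of_real using C.moment_diff_le[of "gns_vec \<rho> a" n] by simp
      show "Im (of_real (real (Suc n)) * \<tau> (star a * a) - m n (star a * a)) = 0"
        unfolding eq by (rule Im_complex_of_real)
    qed (simp_all add: plf_add[OF tau] plf_scale[OF tau] plf_add[OF plf_m] plf_scale[OF plf_m] algebra_simps)
  qed simp
  moreover have "(\<lambda>n. m n b) \<longlonglongrightarrow> \<mu> b" for b
  proof -
    \<comment> \<open>The powers of \<open>C\<close> send the vector of \<open>b\<close> to a fixed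
      vector \<open>w\<close>. Algebra elements \<open>a k\<close> approximating \<open>w\<close>
      are null for \<open>\<tau>\<close>, since \<open>1 - C\<close> kills \<open>w\<close>, and
      bounded for \<open>\<mu>\<close>; by \<open>weakly_null\<close>, \<open>w\<close> is
      orthogonal to the cyclic vector.\<close>
    obtain w where w: "w \<in> C.V" "C w = w" "(\<lambda>n. C.nrm (vdiff ?G ((C ^^ n) (gns_vec \<rho> b)) w)) \<longlonglongrightarrow> 0"
      using C.pow_convergent[OF vec] by blast
    obtain a where a: "a \<in> gns_cauchy \<rho>" "w = gns_class \<rho> a" using gns_vecE[OF rho w(1)] by blast
    let ?d = "\<lambda>k. vdiff ?G (gns_vec \<rho> (a k)) w"
    have d: "(\<lambda>k. C.nrm (?d k)) \<longlonglongrightarrow> 0"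
      using gns_approx_tendsto[OF rho a(1)] a(2) by simp
    have "gns_norm \<tau> (a k) \<le> C.nrm (?d k)" for k
    proof (rule power2_le_imp_le)
      let ?u = "gns_vec \<rho> (a k)"
      have "(gns_norm \<tau> (a k))\<^sup>2 = Re (C.inner ?u ?u) - Re (C.inner (C ?u) ?u)"
        by (simp add: gns_norm_square[OF tau] gns_inner_vec[OF rho] C(2) \<rho>_def)
      \<comment> \<open>As \<open>C w = w\<close>, the form of \<open>1 - C\<close> does not change
        when \<open>w\<close> is subtracted.\<close>
      also have "\<dots> = Re (C.inner (?d k) (?d k)) - Re (C.inner (C (?d k)) (?d k))"
        using w C.sym[of ?u w] by (simp add: C.linear_diff C.inner_simps)
      also have "\<dots> \<le> (C.nrm (?d k))\<^sup>2"
        using w C.nonneg[of "?d k"] by (simp add: C.nrm_square)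
      finally show "(gns_norm \<tau> (a k))\<^sup>2 \<le> (C.nrm (?d k))\<^sup>2" .
    qed (use w in simp)
    then have tau_null: "(\<lambda>k. gns_norm \<tau> (a k)) \<longlonglongrightarrow> 0"
      using gns_norm_nonneg[OF tau] by (intro Lim_null_comparison[OF _ d]) simp
    obtain B where "\<And>k. gns_norm \<rho> (a k) \<le> B" using gns_cauchy_bounded[OF rho a(1)] by blast
    then have "gns_norm \<mu> (a k) \<le> B" for k
      using gns_norm_mono[OF rho mu le, of "a k"] order_trans by blast
    then have "(\<lambda>k. \<mu> (star 1 * a k)) \<longlonglongrightarrow> 0"
      by (rule weakly_null[OF tau_null])
    moreover have "(\<lambda>k. \<tau> (star 1 * a k)) \<longlonglongrightarrow> 0"
      by (rule Lim_null_comparison[OF always_eventually tendsto_mult_left_zero[OF tau_null, of "gns_norm \<tau> 1"]])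
         (intro allI gns_norm_cauchy_schwarz[OF tau])
    ultimately have "(\<lambda>k. \<mu> (star 1 * a k) + \<tau> (star 1 * a k)) \<longlonglongrightarrow> 0 + 0"
      by (rule tendsto_add)
    then have "(\<lambda>k. C.inner (gns_vec \<rho> (a k)) (gns_vec \<rho> 1)) \<longlonglongrightarrow> 0"
      by (simp add: gns_inner_vec[OF rho] \<rho>_def)
    moreover have "(\<lambda>k. C.inner (gns_vec \<rho> (a k)) (gns_vec \<rho> 1)) \<longlonglongrightarrow> C.inner w (gns_vec \<rho> 1)"
      by (rule C.inner_tendsto[OF _ w(1) _ d]) simp_all
    ultimately have "C.inner w (gns_vec \<rho> 1) = 0" using LIMSEQ_unique by blast
    moreover have "(\<lambda>n. p n b) \<longlonglongrightarrow> C.inner w (gns_vec \<rho> 1)"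
      unfolding p_def by (rule C.inner_tendsto[OF _ w(1) _ w(3)]) simp_all
    ultimately have "(\<lambda>n. p n b) \<longlonglongrightarrow> 0" by simp
    then have "(\<lambda>n. p (Suc n) b) \<longlonglongrightarrow> 0" by (rule LIMSEQ_Suc)
    then have "(\<lambda>n. p (Suc 0) b - p (Suc n) b) \<longlonglongrightarrow> p (Suc 0) b - 0"
      by (intro tendsto_intros)
    then show ?thesis by (simp add: m_def p1)
  qed
  ultimately show ?thesis unfolding abs_cont_def using plf_m by blast
qed

end

section \<open>Weak* continuous functionals\<close>

lemma sums_interleave:
  fixes f g :: "nat \<Rightarrow> complex"
  assumes "g sums x" "f sums y"
  shows "(\<lambda>n. if even n then f (n div 2) else g ((n - 1) div 2)) sums (x + y)"
  using assms sums_if[of "\<lambda>n. Re (g n)" "Re x" "\<lambda>n. Re (f n)" "Re y"]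
    sums_if[of "\<lambda>n. Im (g n)" "Im x" "\<lambda>n. Im (f n)" "Im y"]
  unfolding sums_complex_iff by (simp add: if_distrib cong: if_cong)

text \<open>Fubini: with row bounds \<open>c * B n\<close> the double series is absolutely summable
  and may be enumerated by the pairing function. The majorant \<open>b\<close> is kept apart from
  \<open>f\<close> because squared norms will dominate inner products.\<close>

lemma sums_prod_decode:
  fixes f :: "nat \<Rightarrow> nat \<Rightarrow> 'b::banach"
  assumes le: "\<And>n j. norm (f n j) \<le> c * b n j" and c: "0 \<le> c" and b: "\<And>n j. 0 \<le> b n j"
    and bB: "\<And>n. b n sums B n" and B: "summable B"
    and fF: "\<And>n. f n sums F n" and F: "F sums S"
  shows "(\<lambda>k. f (fst (prod_decode k)) (snd (prod_decode k))) sums S"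
proof -
  have B0: "0 \<le> B n" for n
    using b bB by (metis sums_unique sums_summable suminf_nonneg)
  have cbB: "(\<lambda>j. c * b n j) sums (c * B n)" for n by (rule sums_mult[OF bB])
  have sn: "summable (\<lambda>j. norm (f n j))" for n
    by (rule summable_comparison_test'[OF sums_summable[OF cbB[of n]]]) (use le in simp)
  have hs: "(f n has_sum F n) UNIV" for n
    by (rule norm_summable_imp_has_sum[OF sn fF])
  have infs: "infsum (\<lambda>j. norm (f n j)) UNIV = (\<Sum>j. norm (f n j))" for n
    by (rule infsumI, rule norm_summable_imp_has_sum) (use sn in \<open>auto simp: summable_sums\<close>)
  have le_B: "(\<Sum>j. norm (f n j)) \<le> c * B n" for n
    unfolding sums_unique[OF cbB] by (rule suminf_le[OF le sn sums_summable[OF cbB]])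
  have sB: "summable (\<lambda>n. c * B n)" by (rule summable_mult[OF B])
  have "(\<lambda>p. norm (case p of (n, j) \<Rightarrow> f n j)) summable_on (UNIV \<times> UNIV)"
  proof (rule Infinite_Sum.abs_summable_on_Sigma_iff[THEN iffD2], intro conjI ballI)
    show "(\<lambda>j. norm (case (n, j) of (n, j) \<Rightarrow> f n j)) summable_on UNIV" for n
      using sn by (simp add: summable_on_UNIV_nonneg_real_iff)
    have "summable (\<lambda>n. \<Sum>j. norm (f n j))"
      by (rule summable_comparison_test'[OF sB]) (use le_B suminf_nonneg[OF sn] in auto)
    then show "(\<lambda>n. norm (\<Sum>\<^sub>\<infinity>j\<in>UNIV. norm (case (n, j) of (n, j) \<Rightarrow> f n j))) summable_on UNIV"
      using suminf_nonneg[OF sn] by (simp add: infs summable_on_UNIV_nonneg_real_iff)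
  qed
  then have "(\<lambda>(n, j). f n j) summable_on (UNIV \<times> UNIV)"
    by (rule abs_summable_summable)
  then obtain S' where S': "((\<lambda>(n, j). f n j) has_sum S') (UNIV \<times> UNIV)"
    by (auto simp: summable_on_def)
  have "(F has_sum S') UNIV"
    by (rule has_sum_SigmaD[OF S']) (use hs in simp)
  then have "S' = S"
    using has_sum_imp_sums F sums_unique2 by blast
  moreover have "bij_betw prod_decode UNIV (UNIV \<times> UNIV)"
    using bij_prod_decode by simp
  ultimately have "((\<lambda>k. (\<lambda>(n, j). f n j) (prod_decode k)) has_sum S) UNIV"
    using S' has_sum_reindex_bij_betw by blast
  then show ?thesis
    using has_sum_imp_sums by (simp add: case_prod_beta)
qed

text \<open>Linear combinations of \<open>fs\<close> are expressed by a predicate \<open>P\<close> closed under the operations.\<close>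

lemma functional_in_span:
  fixes \<phi> :: "'o \<Rightarrow> complex" and P :: "('o \<Rightarrow> complex) \<Rightarrow> bool"
    and add :: "'o \<Rightarrow> 'o \<Rightarrow> 'o" and scale :: "complex \<Rightarrow> 'o \<Rightarrow> 'o"
  assumes lin: "\<And>f S T. P f \<Longrightarrow> S \<in> M \<Longrightarrow> T \<in> M \<Longrightarrow> f (add S T) = f S + f T"
      "\<And>f c T. P f \<Longrightarrow> T \<in> M \<Longrightarrow> f (scale c T) = c * f T"
    and \<phi>: "\<And>S T. S \<in> M \<Longrightarrow> T \<in> M \<Longrightarrow> \<phi> (add S T) = \<phi> S + \<phi> T" "\<And>c T. T \<in> M \<Longrightarrow> \<phi> (scale c T) = c * \<phi> T"
    and P: "P (\<lambda>_. 0)" "\<And>f g. P f \<Longrightarrow> P g \<Longrightarrow> P (\<lambda>T. f T + g T)" "\<And>c f. P f \<Longrightarrow> P (\<lambda>T. c * f T)"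
    and M: "\<And>S T. S \<in> M \<Longrightarrow> T \<in> M \<Longrightarrow> add S T \<in> M" "\<And>c T. T \<in> M \<Longrightarrow> scale c T \<in> M"
    and fs: "\<And>f. f \<in> set fs \<Longrightarrow> P f" and ker: "\<And>T. T \<in> M \<Longrightarrow> (\<And>f. f \<in> set fs \<Longrightarrow> f T = 0) \<Longrightarrow> \<phi> T = 0"
  shows "\<exists>\<omega>. P \<omega> \<and> (\<forall>T\<in>M. \<phi> T = \<omega> T)"
  using lin \<phi> M fs ker
proof (induction fs arbitrary: M)
  case Nil
  then show ?case using P(1) by (intro exI[of _ "\<lambda>_. 0"]) simp
next
  case (Cons f fs)
  have Pf: "P f" using Cons.prems(7) by simp
  note lin = Cons.prems(1,2) and \<phi> = Cons.prems(3,4) and M = Cons.prems(5,6)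
  \<comment> \<open>The induction runs over subspaces: on the kernel of \<open>f\<close> the
    remaining functionals suffice.\<close>
  have "\<exists>\<omega>. P \<omega> \<and> (\<forall>T\<in>{T \<in> M. f T = 0}. \<phi> T = \<omega> T)"
  proof (rule Cons.IH)
    show "\<phi> T = 0" if "T \<in> {T \<in> M. f T = 0}" "\<And>g. g \<in> set fs \<Longrightarrow> g T = 0" for T
      using that by (intro Cons.prems(8)) auto
    show "add S T \<in> {T \<in> M. f T = 0}" if "S \<in> {T \<in> M. f T = 0}" "T \<in> {T \<in> M. f T = 0}" for S T
      using that lin(1)[OF Pf, of S T] M(1)[of S T] by simp
    show "scale c T \<in> {T \<in> M. f T = 0}" if "T \<in> {T \<in> M. f T = 0}" for c T
      using that lin(2)[OF Pf, of T c] M(2)[of T c] by simp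
  qed (use lin \<phi> Cons.prems(7) in auto)
  then obtain \<omega> where \<omega>: "P \<omega>" "\<And>T. T \<in> M \<Longrightarrow> f T = 0 \<Longrightarrow> \<phi> T = \<omega> T" by blast
  show ?case
  proof (cases "\<forall>T\<in>M. f T = 0")
    case True
    then show ?thesis using \<omega> by blast
  next
    case False
    then obtain T0 where T0: "T0 \<in> M" "f T0 \<noteq> 0" by blast
    define c where "c = (\<phi> T0 - \<omega> T0) / f T0"
    have "\<phi> T = \<omega> T + c * f T" if T: "T \<in> M" for T
    proof -
      \<comment> \<open>Adding this multiple of \<open>T0\<close> moves \<open>T\<close> into the
        kernel of \<open>f\<close>, where \<open>\<phi>\<close> and \<open>\<omega>\<close>
        agree.\<close>
      let ?s = "- (f T / f T0)"
      have "\<phi> (add T (scale ?s T0)) = \<omega> (add T (scale ?s T0))"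
        using T T0 M lin[OF Pf] by (intro \<omega>) auto
      then have "\<phi> T + ?s * \<phi> T0 = \<omega> T + ?s * \<omega> T0"
        using T T0 M lin[OF \<omega>(1)] \<phi> by simp
      then show ?thesis by (simp add: c_def algebra_simps diff_divide_distrib)
    qed
    then show ?thesis using P(2)[OF \<omega>(1) P(3)[OF Pf]] by blast
  qed
qed

section \<open>Functionals given by square-summable sequences of vectors\<close>

context hilbert_space
begin

text \<open>Values are prescribed on \<open>bounded_ops\<close> only: on arbitrary functions the
  series may diverge, so as a set of functions \<open>predual_functionals\<close> is not visibly
  closed under sums.\<close>

definition normal_form :: "(nat \<Rightarrow> 'a) \<Rightarrow> (nat \<Rightarrow> 'a) \<Rightarrow> (('a \<Rightarrow> 'a) \<Rightarrow> complex) \<Rightarrow> bool" where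
  "normal_form x y \<omega> \<longleftrightarrow> range x \<subseteq> V \<and> range y \<subseteq> V \<and>
     summable (\<lambda>n. (nrm (x n))\<^sup>2) \<and> summable (\<lambda>n. (nrm (y n))\<^sup>2) \<and>
     (\<forall>T\<in>bounded_ops H. (\<lambda>n. inner (T (x n)) (y n)) sums \<omega> T)"

definition normal :: "(('a \<Rightarrow> 'a) \<Rightarrow> complex) \<Rightarrow> bool" where
  "normal \<omega> \<longleftrightarrow> (\<exists>x y. normal_form x y \<omega>)"

lemma normal_formI:
  assumes "range x \<subseteq> V" "range y \<subseteq> V" "summable (\<lambda>n. (nrm (x n))\<^sup>2)" "summable (\<lambda>n. (nrm (y n))\<^sup>2)"
  shows "normal_form x y (\<lambda>T. \<Sum>n. inner (T (x n)) (y n))"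
  unfolding normal_form_def
proof (intro conjI assms ballI summable_sums)
  fix T assume T: "T \<in> bounded_ops H"
  have x: "x n \<in> V" and y: "y n \<in> V" for n using assms(1,2) by auto
  obtain K where K: "0 \<le> K" "\<And>u. u \<in> V \<Longrightarrow> nrm (T u) \<le> K * nrm u"
    using bounded_ops_bound[OF T] by blast
  show "summable (\<lambda>n. inner (T (x n)) (y n))"
  proof (rule summable_comparison_test'[OF summable_mult[OF summable_add[OF assms(3,4)], of K]])
    fix n
    have "norm (inner (T (x n)) (y n)) \<le> nrm (T (x n)) * nrm (y n)"
      using x y bounded_opsD(1)[OF T] by (intro inner_le_nrm) auto
    also have "\<dots> \<le> K * nrm (x n) * nrm (y n)"
      using K x y by (intro mult_right_mono) auto
    also have "\<dots> \<le> K * ((nrm (x n))\<^sup>2 + (nrm (y n))\<^sup>2)"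
    proof -
      have "2 * (nrm (x n) * nrm (y n)) \<le> (nrm (x n))\<^sup>2 + (nrm (y n))\<^sup>2"
        using zero_le_power2[of "nrm (x n) - nrm (y n)"] by (simp add: power2_diff algebra_simps)
      moreover have "0 \<le> nrm (x n) * nrm (y n)" using x y by simp
      ultimately have "nrm (x n) * nrm (y n) \<le> (nrm (x n))\<^sup>2 + (nrm (y n))\<^sup>2" by linarith
      then show ?thesis using K by (simp add: mult.assoc mult_left_mono)
    qed
    finally show "norm (inner (T (x n)) (y n)) \<le> K * ((nrm (x n))\<^sup>2 + (nrm (y n))\<^sup>2)" .
  qed
qed

lemma predual_normal: "\<omega> \<in> predual_functionals H \<Longrightarrow> normal \<omega>"
  unfolding predual_functionals_def normal_def using normal_formI by blast

lemma normal_add: "normal \<omega> \<Longrightarrow> T \<in> bounded_ops H \<Longrightarrow> S \<in> bounded_ops H \<Longrightarrow>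
    \<omega> (op_add H S T) = \<omega> S + \<omega> T"
proof -
  assume "normal \<omega>" and ST: "T \<in> bounded_ops H" "S \<in> bounded_ops H"
  then obtain x y where xy: "normal_form x y \<omega>" by (auto simp: normal_def)
  have *: "x n \<in> V" "y n \<in> V" for n using xy by (auto simp: normal_form_def)
  have s: "(\<lambda>n. inner (T (x n)) (y n)) sums \<omega> T" if "T \<in> bounded_ops H" for T
    using xy that by (simp add: normal_form_def)
  have "(\<lambda>n. inner (op_add H S T (x n)) (y n)) sums (\<omega> S + \<omega> T)"
    using sums_add[OF s[OF ST(2)] s[OF ST(1)]] * ST by (simp add: bounded_opsD inner_add_left)
  then show ?thesis
    using s[OF op_add_closed[OF ST(2,1)]] sums_unique2 by blast
qed

lemma normal_scale: "normal \<omega> \<Longrightarrow> T \<in> bounded_ops H \<Longrightarrow> \<omega> (op_scale H c T) = c * \<omega> T"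
proof -
  assume "normal \<omega>" and T: "T \<in> bounded_ops H"
  then obtain x y where xy: "normal_form x y \<omega>" by (auto simp: normal_def)
  have *: "x n \<in> V" "y n \<in> V" for n using xy by (auto simp: normal_form_def)
  have s: "(\<lambda>n. inner (T (x n)) (y n)) sums \<omega> T" if "T \<in> bounded_ops H" for T
    using xy that by (simp add: normal_form_def)
  have "(\<lambda>n. inner (op_scale H c T (x n)) (y n)) sums (c * \<omega> T)"
    using sums_mult[OF s[OF T], of c] * T by (simp add: bounded_opsD inner_scale_left)
  then show ?thesis
    using s[OF op_scale_closed[OF T]] sums_unique2 by blast
qed

lemma normal_zero: "normal (\<lambda>_. 0)"
proof -
  obtain u where u: "u \<in> V" using nonempty by blast
  let ?z = "\<lambda>_::nat. vscale H 0 u"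
  have "normal_form ?z ?z (\<lambda>_. 0)"
    unfolding normal_form_def using u by (auto simp: nrm_scale inner_scale_right bounded_opsD)
  then show ?thesis unfolding normal_def by blast
qed

lemma normal_cmult: "normal \<omega> \<Longrightarrow> normal (\<lambda>T. c * \<omega> T)"
proof -
  assume "normal \<omega>"
  then obtain x y where xy: "normal_form x y \<omega>" by (auto simp: normal_def)
  have *: "x n \<in> V" "y n \<in> V" for n using xy by (auto simp: normal_form_def)
  have "normal_form x (\<lambda>n. vscale H (cnj c) (y n)) (\<lambda>T. c * \<omega> T)"
    using xy * unfolding normal_form_def
    by (auto simp: nrm_scale power_mult_distrib inner_scale_right bounded_opsD intro!: sums_mult summable_mult)
  then show ?thesis unfolding normal_def by blast
qed

lemma normal_plus: "normal \<omega> \<Longrightarrow> normal \<omega>' \<Longrightarrow> normal (\<lambda>T. \<omega> T + \<omega>' T)"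
proof -
  assume "normal \<omega>" "normal \<omega>'"
  then obtain x y x' y' where xy: "normal_form x y \<omega>" "normal_form x' y' \<omega>'"
    by (auto simp: normal_def)
  \<comment> \<open>Interleaving the sequences adds the two series and keeps
    square-summability.\<close>
  define X where "X n = (if even n then x' (n div 2) else x ((n - 1) div 2))" for n
  define Y where "Y n = (if even n then y' (n div 2) else y ((n - 1) div 2))" for n
  have "normal_form X Y (\<lambda>T. \<omega> T + \<omega>' T)"
    unfolding normal_form_def
  proof (intro conjI ballI)
    show "range X \<subseteq> V" "range Y \<subseteq> V"
      using xy by (auto simp: X_def Y_def normal_form_def)
    have if_nrm: "(\<lambda>n. (nrm (if even n then f (n div 2) else g ((n - 1) div 2)))\<^sup>2)
        = (\<lambda>n. if even n then (nrm (f (n div 2)))\<^sup>2 else (nrm (g ((n - 1) div 2)))\<^sup>2)" for f g :: "nat \<Rightarrow> 'a"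
      by auto
    show "summable (\<lambda>n. (nrm (X n))\<^sup>2)" "summable (\<lambda>n. (nrm (Y n))\<^sup>2)"
      unfolding X_def Y_def if_nrm
      using xy by (auto simp: normal_form_def intro!: sums_summable[OF sums_if] summable_sums)
    fix T assume T: "T \<in> bounded_ops H"
    have "(\<lambda>n. inner (T (X n)) (Y n))
        = (\<lambda>n. if even n then inner (T (x' (n div 2))) (y' (n div 2)) else inner (T (x ((n - 1) div 2))) (y ((n - 1) div 2)))"
      by (auto simp: X_def Y_def)
    moreover have "\<dots> sums (\<omega> T + \<omega>' T)"
      by (rule sums_interleave[where f = "\<lambda>n. inner (T (x' n)) (y' n)" and g = "\<lambda>n. inner (T (x n)) (y n)"])
         (use xy T in \<open>auto simp: normal_form_def\<close>)
    ultimately show "(\<lambda>n. inner (T (X n)) (Y n)) sums (\<omega> T + \<omega>' T)" by simp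
  qed
  then show ?thesis unfolding normal_def by blast
qed

text \<open>\<open>Z\<close> will be the zero operator. A subbasic set through it contains the set
  where one functional is small, intersections merge the finite sets and take the smaller radius,
  and a union needs only one member.\<close>

lemma weak_star_nbhd:
  assumes M: "M \<subseteq> bounded_ops H" and Z: "\<And>\<omega>. \<omega> \<in> predual_functionals H \<Longrightarrow> \<omega> Z = 0"
    and gen: "generate_topology_on {{T \<in> M. \<omega> T \<in> U} | \<omega> U. \<omega> \<in> predual_functionals H \<and> open U} W" and ZW: "Z \<in> W"
  shows "\<exists>F e. finite F \<and> F \<subseteq> predual_functionals H \<and> 0 < e \<and> (\<forall>T\<in>M. (\<forall>\<omega>\<in>F. cmod (\<omega> T) < e) \<longrightarrow> T \<in> W)"
  using gen ZW
proof (induction rule: generate_topology_on.induct)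
  case Empty
  then show ?case by simp
next
  case (Int a b)
  then obtain F e G d where F: "finite F" "F \<subseteq> predual_functionals H" "0 < e"
      "\<forall>T\<in>M. (\<forall>\<omega>\<in>F. cmod (\<omega> T) < e) \<longrightarrow> T \<in> a"
    and G: "finite G" "G \<subseteq> predual_functionals H" "0 < d"
      "\<forall>T\<in>M. (\<forall>\<omega>\<in>G. cmod (\<omega> T) < d) \<longrightarrow> T \<in> b"
    by auto
  show ?case
    by (rule exI[of _ "F \<union> G"], rule exI[of _ "min e d"]) (use F G in auto)
next
  case (UN K)
  then obtain k where "k \<in> K" "Z \<in> k" by blast
  with UN.IH show ?case by (meson UnionI)
next
  case (Basis s)
  from Basis.hyps obtain \<omega> U where s: "s = {T \<in> M. \<omega> T \<in> U}" "\<omega> \<in> predual_functionals H" "open U" by blast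
  have "0 \<in> U" using Basis.prems s(1) Z[OF s(2)] by simp
  then obtain e where "0 < e" "ball 0 e \<subseteq> U" using s(3) openE by blast
  then show ?case
    using s by (intro exI[of _ "{\<omega>}"] exI[of _ e]) (auto simp: subset_iff dist_norm)
qed

text \<open>Continuity bounds the functional on the common kernel of finitely many predual
  functionals; by scaling it vanishes there, so it is a linear combination of them.\<close>

lemma weak_star_continuous_normal:
  assumes M: "M \<subseteq> bounded_ops H" and add: "\<And>S T. S \<in> M \<Longrightarrow> T \<in> M \<Longrightarrow> op_add H S T \<in> M"
    and scale: "\<And>c T. T \<in> M \<Longrightarrow> op_scale H c T \<in> M" and ne: "M \<noteq> {}"
    and plf: "op_plf H M \<phi>" and cont: "weak_star_continuous H M \<phi>"
  shows "\<exists>\<omega>. normal \<omega> \<and> (\<forall>T\<in>M. \<phi> T = \<omega> T)"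
proof -
  obtain T0 where T0: "T0 \<in> M" using ne by blast
  define Z where "Z = op_scale H 0 T0"
  have ZM: "Z \<in> M" using scale[OF T0] by (simp add: Z_def)
  have \<phi>: "\<phi> (op_add H S T) = \<phi> S + \<phi> T" "\<phi> (op_scale H c T) = c * \<phi> T" if "S \<in> M" "T \<in> M" for S T c
    using plf that by (auto simp: op_plf_def)
  have \<phi>Z: "\<phi> Z = 0" using \<phi>(2)[OF T0 T0, of 0] by (simp add: Z_def)
  have Z0: "\<omega> Z = 0" if "\<omega> \<in> predual_functionals H" for \<omega>
    using normal_scale[OF predual_normal[OF that], of T0 0] T0 M by (auto simp: Z_def)
  let ?B = "{{T \<in> M. \<omega> T \<in> U} | \<omega> U. \<omega> \<in> predual_functionals H \<and> open U}"
  have top: "topspace (weak_star_topology H M) = M"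
  proof -
    obtain u where u: "u \<in> V" using nonempty by blast
    have "(\<lambda>T. \<Sum>n. inner (T (vscale H 0 u)) (vscale H 0 u)) \<in> predual_functionals H"
      unfolding predual_functionals_def
      by (intro CollectI exI[of _ "\<lambda>_. vscale H 0 u"]) (use u in \<open>auto simp: nrm_scale\<close>)
    then have "{T \<in> M. (\<Sum>n. inner (T (vscale H 0 u)) (vscale H 0 u)) \<in> UNIV} \<in> ?B"
      by blast
    then have "M \<in> ?B" by simp
    moreover have "\<Union>?B \<subseteq> M" by blast
    ultimately have "\<Union>?B = M" by blast
    then show ?thesis unfolding weak_star_topology_def topology_generated_by_topspace .
  qed
  have "openin (weak_star_topology H M) {T \<in> topspace (weak_star_topology H M). \<phi> T \<in> ball 0 1}"
    using cont unfolding weak_star_continuous_def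
    by (rule openin_continuous_map_preimage) simp
  then have gen: "generate_topology_on ?B {T \<in> M. \<phi> T \<in> ball 0 1}"
    unfolding top unfolding weak_star_topology_def by (rule openin_topology_generated_by)
  have Z1: "Z \<in> {T \<in> M. \<phi> T \<in> ball 0 1}" using ZM \<phi>Z by simp
  have "\<exists>F e. finite F \<and> F \<subseteq> predual_functionals H \<and> 0 < e \<and>
      (\<forall>T\<in>M. (\<forall>\<omega>\<in>F. cmod (\<omega> T) < e) \<longrightarrow> T \<in> {T \<in> M. \<phi> T \<in> ball 0 1})"
    by (rule weak_star_nbhd[OF M _ gen Z1]) (rule Z0)
  then obtain F e where F: "finite F" "F \<subseteq> predual_functionals H" "0 < e"
    "\<And>T. T \<in> M \<Longrightarrow> (\<forall>\<omega>\<in>F. cmod (\<omega> T) < e) \<Longrightarrow> T \<in> {T \<in> M. \<phi> T \<in> ball 0 1}"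
    by (elim exE conjE) (use that in blast)
  obtain fs where fs: "set fs = F" using F(1) finite_list by blast
  show ?thesis
  proof (rule functional_in_span[where add = "op_add H" and scale = "op_scale H" and fs = fs])
    show "\<phi> T = 0" if T: "T \<in> M" and 0: "\<And>f. f \<in> set fs \<Longrightarrow> f T = 0" for T
    proof -
      \<comment> \<open>All multiples of \<open>T\<close> stay in the neighbourhood; a non-zero
        \<open>\<phi> T\<close> would reach modulus 1 at
        \<open>t = 1 / cmod (\<phi> T)\<close>.\<close>
      have "cmod (of_real t * \<phi> T) < 1" for t :: real
      proof -
        have "op_scale H (of_real t) T \<in> M" using scale[OF T] .
        moreover have "cmod (\<omega> (op_scale H (of_real t) T)) < e" if \<omega>: "\<omega> \<in> F" for \<omega>
        proof -
          have "\<omega> (op_scale H (of_real t) T) = of_real t * \<omega> T"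
            by (rule normal_scale[OF predual_normal]) (use \<omega> F(2) T M in auto)
          then show ?thesis using 0[of \<omega>] \<omega> fs F(3) by simp
        qed
        ultimately have "\<phi> (op_scale H (of_real t) T) \<in> {T \<in> UNIV. T \<in> ball 0 1}"
          using F(4)[of "op_scale H (of_real t) T"] by blast
        then show ?thesis using \<phi>(2)[OF T T] by simp
      qed
      from this[of "1 / cmod (\<phi> T)"] show ?thesis
        by (cases "\<phi> T = 0") (simp_all add: norm_mult norm_divide)
    qed
    show "f (op_add H S T) = f S + f T" if "normal f" "S \<in> M" "T \<in> M" for f S T
      using that M by (intro normal_add) auto
    show "f (op_scale H c T) = c * f T" if "normal f" "T \<in> M" for f c T
      using that M by (intro normal_scale) auto
  qed (use F(2) fs \<phi> add scale normal_zero normal_plus normal_cmult predual_normal in auto)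
qed

lemma vector_functional:
  assumes z: "range z \<subseteq> V" "summable (\<lambda>n. (nrm (z n))\<^sup>2)" and M: "M \<subseteq> bounded_ops H"
    and \<phi>: "\<phi> = (\<lambda>T. \<Sum>n. inner (T (z n)) (z n))"
  shows "op_plf H M \<phi>" "weak_star_continuous H M \<phi>"
proof -
  have nf: "normal_form z z \<phi>" unfolding \<phi> by (rule normal_formI[OF z(1) z(1) z(2) z(2)])
  then have n: "normal \<phi>" by (auto simp: normal_def)
  have zV: "z n \<in> V" for n using z by auto
  show "op_plf H M \<phi>"
    unfolding op_plf_def
  proof (intro conjI ballI allI)
    fix T assume T: "T \<in> M"
    then have Tb: "T \<in> bounded_ops H" using M by blast
    have "(\<lambda>n. inner (op_mult H (op_adj H T) T (z n)) (z n)) sums \<phi> (op_mult H (op_adj H T) T)"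
      using nf op_mult_closed[OF op_adj(1)[OF Tb] Tb] by (simp add: normal_form_def)
    then have s: "(\<lambda>n. inner (T (z n)) (T (z n))) sums \<phi> (op_mult H (op_adj H T) T)"
      using zV bounded_opsD(1)[OF Tb] by (simp add: inner_op_adj_left[OF Tb])
    have sR: "(\<lambda>n. Re (inner (T (z n)) (T (z n)))) sums Re (\<phi> (op_mult H (op_adj H T) T))"
      and sI: "(\<lambda>n. Im (inner (T (z n)) (T (z n)))) sums Im (\<phi> (op_mult H (op_adj H T) T))"
      using s unfolding sums_complex_iff by blast+
    have "0 \<le> Re (\<phi> (op_mult H (op_adj H T) T))"
      by (rule sums_le[OF _ sums_zero sR]) (use zV bounded_opsD(1)[OF Tb] in \<open>simp add: inner_self_nonneg\<close>)
    moreover have "Im (\<phi> (op_mult H (op_adj H T) T)) = 0"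
      using sums_unique2[OF sI] sums_zero zV bounded_opsD(1)[OF Tb] by (simp add: inner_self_Im)
    ultimately show "\<phi> (op_mult H (op_adj H T) T) \<in> \<real>\<^sub>\<ge>\<^sub>0"
      by (simp add: complex_nonneg_Reals_iff)
  qed (use normal_add[OF n] normal_scale[OF n] subsetD[OF M] in auto)
  have pre: "\<phi> \<in> predual_functionals H"
    unfolding predual_functionals_def \<phi> using z by blast
  let ?B = "{{T \<in> M. \<omega> T \<in> U} | \<omega> U. \<omega> \<in> predual_functionals H \<and> open U}"
  have "\<Union>?B \<subseteq> M" by blast
  moreover have "{T \<in> M. \<phi> T \<in> UNIV} \<in> ?B" using pre by blast
  then have "M \<in> ?B" by simp
  ultimately have top: "\<Union>?B = M" by blast
  show "weak_star_continuous H M \<phi>"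
    unfolding weak_star_continuous_def weak_star_topology_def continuous_map_def
      topology_generated_by_topspace top
    using pre by (auto intro!: topology_generated_by_Basis)
qed

end

section \<open>Extension of positive functionals\<close>

text \<open>The negative part \<open>p\<close> of \<open>k\<close> lies in \<open>N\<^sub>\<tau>\<close>, hence in \<open>N\<^sub>\<kappa>\<close>.\<close>

lemma plf_nonneg_of_compression:
  fixes k :: "'a::unital_cstar_algebra"
  assumes tau: "plf \<tau>" and kappa: "plf \<kappa>" and null: "null_ideal \<tau> \<subseteq> null_ideal \<kappa>"
    and sa: "star k = k" and pos: "\<And>a. 0 \<le> Re (\<tau> (star a * k * a))"
  shows "0 \<le> Re (\<kappa> k)"
proof -
  have unit: "0 \<le> Re (\<kappa> k)"
    if sa: "star k = k" and nk: "norm k \<le> 1" and pos: "\<And>a. 0 \<le> Re (\<tau> (star a * k * a))" for k :: 'a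
  proof -
    have "star (1 - k * k) = 1 - k * k" by (simp add: star_diff star_mult sa)
    \<comment> \<open>\<open>m\<close> is the absolute value of \<open>k\<close>, and
      \<open>r\<close> below is its square root; the bound on \<open>1 - m\<close> is what permits
      this second root.\<close>
    then obtain m where m: "star m = m" "m * m = 1 - (1 - k * k)" "norm (1 - m) \<le> 1"
      "\<And>b. b * (1 - k * k) = (1 - k * k) * b \<Longrightarrow> b * m = m * b"
      using sqrt_exists[OF _ norm_one_minus_square_le[OF sa nk]] by metis
    have km: "k * m = m * k" by (rule m(4)) (simp add: algebra_simps)
    have mm: "m * m = k * k" using m(2) by simp
    have "star (1 - m) = 1 - m" by (simp add: star_diff m)
    then obtain r where r: "star r = r" "r * r = 1 - (1 - m)"
      "\<And>b. b * (1 - m) = (1 - m) * b \<Longrightarrow> b * r = r * b"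
      using sqrt_exists[OF _ m(3)] by metis
    have rr: "r * r = m" using r(2) by simp
    \<comment> \<open>Twice the negative part of \<open>k\<close>, so
      \<open>k * p = - (m * p)\<close> and the compression of \<open>k\<close> by \<open>p\<close>
      is the negative of a square.\<close>
    define p where "p = m - k"
    have sp: "star p = p" by (simp add: p_def star_diff m sa)
    have kp: "k * p = - (m * p)" by (simp add: p_def right_diff_distrib km mm)
    have "star p * k * p = - (star (r * p) * (r * p))"
      by (simp add: sp star_mult r mult.assoc kp) (simp add: rr flip: mult.assoc)
    then have "Re (\<tau> (star (r * p) * (r * p))) \<le> 0"
      using pos[of p] by (simp add: plf_minus[OF tau])
    then have "\<tau> (star (r * p) * (r * p)) = 0"
      using plf_nonneg[OF tau, of "r * p"] by (simp add: complex_eq_iff)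
    then have "\<tau> (r * (r * p)) = 0" by (rule plf_vanish[OF tau])
    then have mp: "\<tau> (m * p) = 0" by (simp add: rr flip: mult.assoc)
    have "star p * p = m * p + m * p"
      using kp by (simp add: sp) (simp add: p_def left_diff_distrib)
    then have "p \<in> null_ideal \<tau>"
      using mp by (simp add: null_ideal_def plf_add[OF tau])
    then have "\<kappa> (star p * p) = 0" using null by (auto simp: null_ideal_def)
    then have "\<kappa> (1 * p) = 0" by (rule plf_vanish[OF kappa])
    \<comment> \<open>Since \<open>p\<close> is null for \<open>\<kappa>\<close>, \<open>k\<close>
      and its absolute value take the same value.\<close>
    then have "\<kappa> k = \<kappa> (star r * r)"
      by (simp add: p_def plf_diff[OF kappa] r(1) rr)
    then show ?thesis using plf_nonneg(1)[OF kappa, of r] by simp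
  qed
  define c where "c = 1 / (norm k + 1)"
  have c: "c > 0" by (simp add: c_def add_nonneg_pos)
  have "0 \<le> Re (\<kappa> (c *\<^sub>R k))"
  proof (rule unit)
    show "star (c *\<^sub>R k) = c *\<^sub>R k" by (simp add: star_scaleR sa)
    have "norm (c *\<^sub>R k) = norm k / (norm k + 1)"
      using c by (simp add: c_def)
    also have "\<dots> \<le> 1" by (simp add: divide_le_eq_1 add_nonneg_pos)
    finally show "norm (c *\<^sub>R k) \<le> 1" .
    show "0 \<le> Re (\<tau> (star a * (c *\<^sub>R k) * a))" for a
      using pos[of a] c by (simp add: plf_scaleR[OF tau])
  qed
  then show ?thesis using c by (simp add: plf_scaleR[OF kappa] zero_le_mult_iff)
qed

text \<open>A partial positive functional on real functions, encoded by its graph so that extension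
  is inclusion and unions of chains are upper bounds. Single-valuedness follows from positivity,
  applied to a difference that is the zero function.\<close>

definition positive_graph :: "(('x \<Rightarrow> real) \<times> real) set \<Rightarrow> bool" where
  "positive_graph G \<longleftrightarrow>
     (\<forall>f r g s. (f, r) \<in> G \<longrightarrow> (g, s) \<in> G \<longrightarrow> (\<lambda>x. f x + g x, r + s) \<in> G) \<and>
     (\<forall>c f r. (f, r) \<in> G \<longrightarrow> (\<lambda>x. c * f x, c * r) \<in> G) \<and>
     (\<forall>f r. (f, r) \<in> G \<longrightarrow> (\<forall>x. 0 \<le> f x) \<longrightarrow> 0 \<le> r)"

lemma positive_graphD:
  assumes "positive_graph G"
  shows "(f, r) \<in> G \<Longrightarrow> (g, s) \<in> G \<Longrightarrow> (\<lambda>x. f x + g x, r + s) \<in> G"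
    "(f, r) \<in> G \<Longrightarrow> (\<lambda>x. c * f x, c * r) \<in> G"
    "(f, r) \<in> G \<Longrightarrow> (\<And>x. 0 \<le> f x) \<Longrightarrow> 0 \<le> r"
    "(f, r) \<in> G \<Longrightarrow> (g, s) \<in> G \<Longrightarrow> (\<lambda>x. f x - g x, r - s) \<in> G"
proof -
  show 1: "(f, r) \<in> G \<Longrightarrow> (g, s) \<in> G \<Longrightarrow> (\<lambda>x. f x + g x, r + s) \<in> G" for f r g s
    using assms by (simp add: positive_graph_def)
  show 2: "(f, r) \<in> G \<Longrightarrow> (\<lambda>x. c * f x, c * r) \<in> G" for f r c
    using assms by (simp add: positive_graph_def)
  show "(f, r) \<in> G \<Longrightarrow> (\<And>x. 0 \<le> f x) \<Longrightarrow> 0 \<le> r"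
    using assms by (simp add: positive_graph_def)
  show "(f, r) \<in> G \<Longrightarrow> (g, s) \<in> G \<Longrightarrow> (\<lambda>x. f x - g x, r - s) \<in> G"
    using 1[of f r "\<lambda>x. (-1) * g x" "(-1) * s"] 2[of g s "-1"] by simp
qed

lemma positive_graph_mono:
  assumes "positive_graph G" "(f, r) \<in> G" "(g, s) \<in> G" "\<And>x. f x \<le> g x"
  shows "r \<le> s"
  using positive_graphD(3)[OF assms(1) positive_graphD(4)[OF assms(1,3,2)]] assms(4) by simp

lemma positive_graph_unique:
  assumes "positive_graph G" "(f, r) \<in> G" "(f, s) \<in> G"
  shows "r = s"
  using positive_graph_mono[OF assms] positive_graph_mono[OF assms(1,3,2)] by simp

text \<open>The one-step extension of M. Riesz: any \<open>t\<close> between the values on minorants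
  and the values on majorants of \<open>f\<close> is admissible. Multiples of \<open>e\<close>
  provide both kinds, so the supremum exists.\<close>

lemma positive_graph_extend:
  assumes G: "positive_graph G" and e: "(e, s) \<in> G" and f: "\<And>x. \<bar>f x\<bar> \<le> c * e x"
  obtains t G' where "positive_graph G'" "G \<subseteq> G'" "(f, t) \<in> G'"
proof -
  define L where "L = {r. \<exists>h. (h, r) \<in> G \<and> (\<forall>x. h x \<le> f x)}"
  have fb: "- c * e x \<le> f x" "f x \<le> c * e x" for x
    using f[of x] by (simp_all add: abs_le_iff)
  have "- c * s \<in> L"
    unfolding L_def using positive_graphD(2)[OF G e, of "- c"] fb(1) by blast
  moreover have LU: "l \<le> u" if l: "l \<in> L" and k: "(k, u) \<in> G" "\<And>x. f x \<le> k x" for l u k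
  proof -
    obtain h where h: "(h, l) \<in> G" "\<And>x. h x \<le> f x" using l by (auto simp: L_def)
    show ?thesis
      by (rule positive_graph_mono[OF G h(1) k(1)]) (use h(2) k(2) order_trans in blast)
  qed
  ultimately have bdd: "bdd_above L" and ne: "L \<noteq> {}"
    using positive_graphD(2)[OF G e, of c] fb(2) unfolding bdd_above_def by blast+
  define t where "t = Sup L"
  have tL: "l \<le> t" if "l \<in> L" for l unfolding t_def by (rule cSup_upper[OF that bdd])
  have tU: "t \<le> u" if "(k, u) \<in> G" "\<And>x. f x \<le> k x" for k u
    unfolding t_def by (rule cSup_least[OF ne]) (use LU that in blast)
  define G' where "G' = {(\<lambda>x. h x + a * f x, r + a * t) | h r a. (h, r) \<in> G}"
  have G'I: "(k, q) \<in> G'" if "(h, r) \<in> G" "k = (\<lambda>x. h x + a * f x)" "q = r + a * t" for k q h r a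
    unfolding G'_def using that by blast
  have "positive_graph G'"
    unfolding positive_graph_def
  proof (intro conjI allI impI)
    fix f1 r1 f2 r2 assume "(f1, r1) \<in> G'" "(f2, r2) \<in> G'"
    then obtain h1 s1 a1 h2 s2 a2 where
      1: "f1 = (\<lambda>x. h1 x + a1 * f x)" "r1 = s1 + a1 * t" "(h1, s1) \<in> G" and
      2: "f2 = (\<lambda>x. h2 x + a2 * f x)" "r2 = s2 + a2 * t" "(h2, s2) \<in> G"
      by (auto simp: G'_def)
    have "(\<lambda>x. f1 x + f2 x) = (\<lambda>x. (h1 x + h2 x) + (a1 + a2) * f x)" "r1 + r2 = (s1 + s2) + (a1 + a2) * t"
      by (auto simp: 1 2 algebra_simps)
    then show "(\<lambda>x. f1 x + f2 x, r1 + r2) \<in> G'"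
      by (rule G'I[OF positive_graphD(1)[OF G 1(3) 2(3)]])
  next
    fix b f1 r1 assume "(f1, r1) \<in> G'"
    then obtain h1 s1 a1 where 1: "f1 = (\<lambda>x. h1 x + a1 * f x)" "r1 = s1 + a1 * t" "(h1, s1) \<in> G"
      by (auto simp: G'_def)
    have "(\<lambda>x. b * f1 x) = (\<lambda>x. b * h1 x + (b * a1) * f x)" "b * r1 = b * s1 + (b * a1) * t"
      by (auto simp: 1 algebra_simps)
    then show "(\<lambda>x. b * f1 x, b * r1) \<in> G'"
      by (rule G'I[OF positive_graphD(2)[OF G 1(3)]])
  next
    fix f1 r1 assume "(f1, r1) \<in> G'" and pos: "\<forall>x. 0 \<le> f1 x"
    then obtain h r a where 1: "f1 = (\<lambda>x. h x + a * f x)" "r1 = r + a * t" "(h, r) \<in> G"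
      by (auto simp: G'_def)
    then have p: "0 \<le> h x + a * f x" for x using pos by simp
    \<comment> \<open>For \<open>a \<noteq> 0\<close>, the function \<open>(- 1 / a) * h\<close> is
      a minorant or a majorant of \<open>f\<close> according to the sign of
      \<open>a\<close>.\<close>
    consider "a = 0" | "a > 0" | "a < 0" by linarith
    then show "0 \<le> r1"
    proof cases
      case 1
      then show ?thesis using positive_graphD(3)[OF G \<open>(h, r) \<in> G\<close>] p \<open>r1 = r + a * t\<close> by simp
    next
      case 2
      have "(- 1 / a) * h x \<le> f x" for x using p[of x] 2 by (simp add: field_simps)
      then have "(- 1 / a) * r \<in> L"
        unfolding L_def using positive_graphD(2)[OF G \<open>(h, r) \<in> G\<close>, of "- 1 / a"] by blast
      from tL[OF this] show ?thesis using 2 \<open>r1 = r + a * t\<close> by (simp add: field_simps)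
    next
      case 3
      have "f x \<le> (- 1 / a) * h x" for x using p[of x] 3 by (simp add: field_simps)
      then have "t \<le> (- 1 / a) * r"
        by (rule tU[OF positive_graphD(2)[OF G \<open>(h, r) \<in> G\<close>, of "- 1 / a"]])
      then show ?thesis using 3 \<open>r1 = r + a * t\<close> by (simp add: field_simps)
    qed
  qed
  moreover have "G \<subseteq> G'"
  proof
    fix q assume "q \<in> G"
    then show "q \<in> G'"
      by (cases q) (auto intro!: G'I[where a = 0])
  qed
  moreover have "(f, t) \<in> G'"
    by (rule G'I[OF positive_graphD(2)[OF G e, of 0], where a = 1]) simp_all
  ultimately show ?thesis using that by blast
qed

text \<open>Zorn's lemma on graphs. The laws are asserted for functions bounded by a multiple of
  \<open>e\<close> only, since elsewhere \<open>g\<close> may be an arbitrary value of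
  \<open>THE\<close>.\<close>

lemma positive_functional_extension:
  assumes G: "positive_graph G" and e: "(e, s) \<in> G"
  shows "\<exists>g. (\<forall>f r. (f, r) \<in> G \<longrightarrow> g f = r) \<and>
    (\<forall>f h c d. (\<forall>x. \<bar>f x\<bar> \<le> c * e x) \<longrightarrow> (\<forall>x. \<bar>h x\<bar> \<le> d * e x) \<longrightarrow> g (\<lambda>x. f x + h x) = g f + g h) \<and>
    (\<forall>f c b. (\<forall>x. \<bar>f x\<bar> \<le> c * e x) \<longrightarrow> g (\<lambda>x. b * f x) = b * g f) \<and>
    (\<forall>f c. (\<forall>x. \<bar>f x\<bar> \<le> c * e x) \<longrightarrow> (\<forall>x. 0 \<le> f x) \<longrightarrow> 0 \<le> g f)"
proof -
  define \<A> where "\<A> = {G'. positive_graph G' \<and> G \<subseteq> G'}"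
  have "\<exists>M\<in>\<A>. \<forall>X\<in>\<A>. M \<subseteq> X \<longrightarrow> X = M"
  proof (rule subset_Zorn_nonempty)
    show "\<A> \<noteq> {}" using G by (auto simp: \<A>_def)
    fix \<C> assume ne: "\<C> \<noteq> {}" and ch: "subset.chain \<A> \<C>"
    have C: "positive_graph X" "G \<subseteq> X" if "X \<in> \<C>" for X
      using ch that by (auto simp: subset.chain_def \<A>_def)
    have tot: "X \<subseteq> Y \<or> Y \<subseteq> X" if "X \<in> \<C>" "Y \<in> \<C>" for X Y
      using ch that by (auto simp: subset.chain_def)
    have "positive_graph (\<Union>\<C>)"
      unfolding positive_graph_def
    proof (intro conjI allI impI)
      fix f r g s assume "(f, r) \<in> \<Union>\<C>" "(g, s) \<in> \<Union>\<C>"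
      then obtain X where "X \<in> \<C>" "(f, r) \<in> X" "(g, s) \<in> X" using tot by blast
      then show "(\<lambda>x. f x + g x, r + s) \<in> \<Union>\<C>" using positive_graphD(1)[OF C(1)] by blast
    next
      fix c f r assume "(f, r) \<in> \<Union>\<C>"
      then show "(\<lambda>x. c * f x, c * r) \<in> \<Union>\<C>" using positive_graphD(2)[OF C(1)] by blast
    next
      fix f r assume "(f, r) \<in> \<Union>\<C>" "\<forall>x. 0 \<le> f x"
      then show "0 \<le> r" using positive_graphD(3)[OF C(1)] by blast
    qed
    then show "\<Union>\<C> \<in> \<A>" using ne C(2) by (auto simp: \<A>_def)
  qed
  then obtain M where M: "positive_graph M" "G \<subseteq> M" and max: "\<And>X. positive_graph X \<Longrightarrow> M \<subseteq> X \<Longrightarrow> X = M"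
    unfolding \<A>_def by (auto intro: order_trans)
  have eM: "(e, s) \<in> M" using e M by blast
  define g where "g f = (THE r. (f, r) \<in> M)" for f
  have g: "g f = r" if "(f, r) \<in> M" for f r
    unfolding g_def using that positive_graph_unique[OF M(1)] by blast
  \<comment> \<open>By maximality the one-step extension by \<open>f\<close> is already contained in
    \<open>M\<close>.\<close>
  have dom: "(f, g f) \<in> M" if f: "\<And>x. \<bar>f x\<bar> \<le> c * e x" for f c
  proof -
    obtain t G' where "positive_graph G'" "M \<subseteq> G'" "(f, t) \<in> G'"
      using positive_graph_extend[OF M(1) eM f] by blast
    then have "(f, t) \<in> M" using max by blast
    then show ?thesis using g by metis
  qed
  show ?thesis
  proof (rule exI[of _ g], intro conjI allI impI)
    show "g f = r" if "(f, r) \<in> G" for f r using g that M by blast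
    show "g (\<lambda>x. f x + h x) = g f + g h"
      if "\<forall>x. \<bar>f x\<bar> \<le> c * e x" "\<forall>x. \<bar>h x\<bar> \<le> d * e x" for f h c d
      by (rule g, rule positive_graphD(1)[OF M(1) dom[of f c] dom[of h d]]) (use that in auto)
    show "g (\<lambda>x. b * f x) = b * g f" if "\<forall>x. \<bar>f x\<bar> \<le> c * e x" for f c b
      by (rule g, rule positive_graphD(2)[OF M(1) dom[of f c]]) (use that in auto)
    show "0 \<le> g f" if "\<forall>x. \<bar>f x\<bar> \<le> c * e x" "\<forall>x. 0 \<le> f x" for f c
      by (rule positive_graphD(3)[OF M(1) dom[of f c]]) (use that in auto)
  qed
qed

text \<open>Operators are identified with their quadratic forms \<open>a \<mapsto> \<langle>T a, a\<rangle>\<close> on the algebra, whose real and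
  imaginary parts are functions bounded by a multiple of \<open>a \<mapsto> \<parallel>a\<parallel>\<^sup>2\<close>.\<close>

lemma plf_extension_exists:
  fixes \<tau> \<kappa> :: "'a::unital_cstar_algebra \<Rightarrow> complex"
  assumes tau: "plf \<tau>" and kappa: "plf \<kappa>" and null: "null_ideal \<tau> \<subseteq> null_ideal \<kappa>"
  obtains \<phi> where "plf_extension \<tau> \<kappa> \<phi>"
proof -
  interpret hilbert_space "gns_space \<tau>" by (rule gns_hilbert[OF tau])
  define q where "q h a = Re (\<tau> (star a * h * a))" for h a
  define e where "e = q 1"
  \<comment> \<open>That the value of \<open>\<kappa>\<close> depends only on the form
    \<open>q h\<close> needs no separate check: it is part of the positivity of this graph, which
    rests on \<open>plf_nonneg_of_compression\<close>.\<close>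
  define G where "G = {(q h, Re (\<kappa> h)) | h. star h = h}"
  have "positive_graph G"
    unfolding positive_graph_def
  proof (intro conjI allI impI)
    fix f r g s assume "(f, r) \<in> G" "(g, s) \<in> G"
    then obtain h k where hk: "f = q h" "r = Re (\<kappa> h)" "star h = h" "g = q k" "s = Re (\<kappa> k)" "star k = k"
      by (auto simp: G_def)
    have "(\<lambda>x. f x + g x) = q (h + k)" "r + s = Re (\<kappa> (h + k))" "star (h + k) = h + k"
      by (auto simp: hk q_def plf_add[OF tau] plf_add[OF kappa] star_add distrib_left distrib_right)
    then show "(\<lambda>x. f x + g x, r + s) \<in> G" unfolding G_def by blast
  next
    fix c f r assume "(f, r) \<in> G"
    then obtain h where h: "f = q h" "r = Re (\<kappa> h)" "star h = h" by (auto simp: G_def)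
    have "(\<lambda>x. c * f x) = q (c *\<^sub>R h)" "c * r = Re (\<kappa> (c *\<^sub>R h))" "star (c *\<^sub>R h) = c *\<^sub>R h"
      by (auto simp: h q_def plf_scaleR[OF tau] plf_scaleR[OF kappa] star_scaleR)
    then show "(\<lambda>x. c * f x, c * r) \<in> G" unfolding G_def by blast
  next
    fix f r assume "(f, r) \<in> G" "\<forall>x. 0 \<le> f x"
    then obtain h where h: "f = q h" "r = Re (\<kappa> h)" "star h = h" by (auto simp: G_def)
    show "0 \<le> r"
      unfolding h(2) by (rule plf_nonneg_of_compression[OF tau kappa null h(3)])
        (use h \<open>\<forall>x. 0 \<le> f x\<close> in \<open>simp add: q_def\<close>)
  qed
  moreover have "(e, Re (\<kappa> 1)) \<in> G" unfolding G_def e_def by (intro CollectI exI[of _ 1]) simp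
  ultimately have "\<exists>g. (\<forall>f r. (f, r) \<in> G \<longrightarrow> g f = r) \<and>
    (\<forall>f h c d. (\<forall>x. \<bar>f x\<bar> \<le> c * e x) \<longrightarrow> (\<forall>x. \<bar>h x\<bar> \<le> d * e x) \<longrightarrow> g (\<lambda>x. f x + h x) = g f + g h) \<and>
    (\<forall>f c b. (\<forall>x. \<bar>f x\<bar> \<le> c * e x) \<longrightarrow> g (\<lambda>x. b * f x) = b * g f) \<and>
    (\<forall>f c. (\<forall>x. \<bar>f x\<bar> \<le> c * e x) \<longrightarrow> (\<forall>x. 0 \<le> f x) \<longrightarrow> 0 \<le> g f)"
    by (rule positive_functional_extension)
  then obtain g where g: "\<forall>f r. (f, r) \<in> G \<longrightarrow> g f = r"
    "\<forall>f h c d. (\<forall>x. \<bar>f x\<bar> \<le> c * e x) \<longrightarrow> (\<forall>x. \<bar>h x\<bar> \<le> d * e x) \<longrightarrow> g (\<lambda>x. f x + h x) = g f + g h"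
    "\<forall>f c b. (\<forall>x. \<bar>f x\<bar> \<le> c * e x) \<longrightarrow> g (\<lambda>x. b * f x) = b * g f"
    "\<forall>f c. (\<forall>x. \<bar>f x\<bar> \<le> c * e x) \<longrightarrow> (\<forall>x. 0 \<le> f x) \<longrightarrow> 0 \<le> g f"
    by (elim exE conjE) (rule that)
  have gG: "\<And>f r. (f, r) \<in> G \<Longrightarrow> g f = r"
    and gadd: "\<And>f h c d. (\<And>x. \<bar>f x\<bar> \<le> c * e x) \<Longrightarrow> (\<And>x. \<bar>h x\<bar> \<le> d * e x) \<Longrightarrow> g (\<lambda>x. f x + h x) = g f + g h"
    and gscale: "\<And>f c b. (\<And>x. \<bar>f x\<bar> \<le> c * e x) \<Longrightarrow> g (\<lambda>x. b * f x) = b * g f"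
    and gpos: "\<And>f c. (\<And>x. \<bar>f x\<bar> \<le> c * e x) \<Longrightarrow> (\<And>x. 0 \<le> f x) \<Longrightarrow> 0 \<le> g f"
    by (rule g[rule_format]; blast)+
  define F where "F T a = inner (T (gns_vec \<tau> a)) (gns_vec \<tau> a)" for T a
  have vec [simp]: "gns_vec \<tau> a \<in> V" for a by (rule gns_vec_in_vecs[OF tau])
  have bd: "\<exists>c. (\<forall>a. \<bar>Re (F T a)\<bar> \<le> c * e a) \<and> (\<forall>a. \<bar>Im (F T a)\<bar> \<le> c * e a)" if T: "T \<in> bounded_ops (gns_space \<tau>)" for T
  proof -
    obtain K where K: "0 \<le> K" "\<And>u. u \<in> V \<Longrightarrow> nrm (T u) \<le> K * nrm u"
      using bounded_ops_bound[OF T] by blast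
    have "cmod (F T a) \<le> K * e a" for a
    proof -
      have "cmod (F T a) \<le> nrm (T (gns_vec \<tau> a)) * nrm (gns_vec \<tau> a)"
        unfolding F_def using bounded_opsD(1)[OF T] by (intro inner_le_nrm) auto
      also have "\<dots> \<le> K * nrm (gns_vec \<tau> a) * nrm (gns_vec \<tau> a)"
        using K by (intro mult_right_mono) auto
      also have "\<dots> = K * (nrm (gns_vec \<tau> a))\<^sup>2" by (simp add: power2_eq_square)
      also have "(nrm (gns_vec \<tau> a))\<^sup>2 = e a"
        by (simp add: gns_vnorm_vec[OF tau] gns_norm_square[OF tau] e_def q_def)
      finally show ?thesis .
    qed
    then show ?thesis
      using abs_Re_le_cmod abs_Im_le_cmod by (intro exI[of _ K]) (meson order_trans)
  qed
  \<comment> \<open>Defined on all bounded operators. Although \<open>g\<close> is only real linear,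
    evaluating it on the real and imaginary parts of the form makes \<open>\<phi>\<close> complex
    linear.\<close>
  define \<phi> where "\<phi> T = Complex (g (\<lambda>a. Re (F T a))) (g (\<lambda>a. Im (F T a)))" for T
  have add: "\<phi> (op_add (gns_space \<tau>) S T) = \<phi> S + \<phi> T"
    if S: "S \<in> bounded_ops (gns_space \<tau>)" and T: "T \<in> bounded_ops (gns_space \<tau>)" for S T
  proof -
    have "F (op_add (gns_space \<tau>) S T) a = F S a + F T a" for a
      using bounded_opsD(1)[OF S] bounded_opsD(1)[OF T] by (simp add: F_def inner_add_left)
    moreover obtain c where "\<forall>a. \<bar>Re (F S a)\<bar> \<le> c * e a" "\<forall>a. \<bar>Im (F S a)\<bar> \<le> c * e a" using bd[OF S] by blast
    moreover obtain d where "\<forall>a. \<bar>Re (F T a)\<bar> \<le> d * e a" "\<forall>a. \<bar>Im (F T a)\<bar> \<le> d * e a" using bd[OF T] by blast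
    ultimately show ?thesis
      using gadd[of "\<lambda>a. Re (F S a)" c "\<lambda>a. Re (F T a)" d] gadd[of "\<lambda>a. Im (F S a)" c "\<lambda>a. Im (F T a)" d]
      by (simp add: \<phi>_def complex_eq_iff)
  qed
  have scale: "\<phi> (op_scale (gns_space \<tau>) z T) = z * \<phi> T" if T: "T \<in> bounded_ops (gns_space \<tau>)" for z T
  proof -
    have Fz: "F (op_scale (gns_space \<tau>) z T) a = z * F T a" for a
      using bounded_opsD(1)[OF T] by (simp add: F_def inner_scale_left)
    obtain c where c: "\<And>a. \<bar>Re (F T a)\<bar> \<le> c * e a" "\<And>a. \<bar>Im (F T a)\<bar> \<le> c * e a" using bd[OF T] by blast
    have le: "\<bar>b * f a\<bar> \<le> (\<bar>b\<bar> * c) * e a" if "\<And>a. \<bar>f a\<bar> \<le> c * e a" for b :: real and f a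
      using mult_left_mono[OF that[of a], of "\<bar>b\<bar>"] by (simp add: abs_mult mult.assoc)
    have comb: "g (\<lambda>a. b * Re (F T a) + d * Im (F T a)) = b * g (\<lambda>a. Re (F T a)) + d * g (\<lambda>a. Im (F T a))" for b d
      using gadd[of "\<lambda>a. b * Re (F T a)" "\<bar>b\<bar> * c" "\<lambda>a. d * Im (F T a)" "\<bar>d\<bar> * c",
          OF le[of "\<lambda>a. Re (F T a)", OF c(1)] le[of "\<lambda>a. Im (F T a)", OF c(2)]]
        gscale[of "\<lambda>a. Re (F T a)", OF c(1)] gscale[of "\<lambda>a. Im (F T a)", OF c(2)]
      by simp
    show ?thesis
      using comb[of "Re z" "- Im z"] comb[of "Im z" "Re z"]
      by (simp add: \<phi>_def Fz complex_eq_iff algebra_simps)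
  qed
  have pos: "\<phi> (op_mult (gns_space \<tau>) (op_adj (gns_space \<tau>) T) T) \<in> \<real>\<^sub>\<ge>\<^sub>0"
    if T: "T \<in> bounded_ops (gns_space \<tau>)" for T
  proof -
    let ?S = "op_mult (gns_space \<tau>) (op_adj (gns_space \<tau>) T) T"
    have S: "?S \<in> bounded_ops (gns_space \<tau>)" by (rule op_mult_closed[OF op_adj(1)[OF T] T])
    have FS: "F ?S a = inner (T (gns_vec \<tau> a)) (T (gns_vec \<tau> a))" for a
      using bounded_opsD(1)[OF T] by (simp add: F_def inner_op_adj_left[OF T])
    obtain c where c: "\<And>a. \<bar>Re (F ?S a)\<bar> \<le> c * e a" "\<And>a. \<bar>Im (F ?S a)\<bar> \<le> c * e a" using bd[OF S] by blast
    have "0 \<le> g (\<lambda>a. Re (F ?S a))"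
      by (rule gpos[OF c(1)]) (use bounded_opsD(1)[OF T] FS in \<open>simp add: inner_self_nonneg\<close>)
    moreover have "(\<lambda>a. Im (F ?S a)) = (\<lambda>a. 0 * Im (F ?S a))"
      using bounded_opsD(1)[OF T] FS by (simp add: inner_self_Im)
    then have "g (\<lambda>a. Im (F ?S a)) = 0"
      using gscale[of "\<lambda>a. Im (F ?S a)" c 0] c(2) by simp
    ultimately show ?thesis by (simp add: \<phi>_def complex_nonneg_Reals_iff)
  qed
  have rep: "\<phi> (gns_rep \<tau> h) = \<kappa> h" for h
  proof -
    \<comment> \<open>Decomposition into self-adjoint parts, whose forms belong to the domain of
      \<open>G\<close>.\<close>
    define h1 where "h1 = (1 / 2) *\<^sub>R (h + star h)"
    define h2 where "h2 = (- \<i> / 2) *\<^sub>C (h - star h)"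
    have s1: "star h1 = h1" by (simp add: h1_def star_scaleR star_add star_star add.commute)
    have s2: "star h2 = h2"
      by (simp add: h2_def star_scaleC star_diff star_star) (simp add: scaleC.scale_right_diff_distrib)
    have "\<i> *\<^sub>C h2 = (1 / 2) *\<^sub>C (h - star h)"
      by (simp add: h2_def scaleC_scaleC)
    then have h: "h1 + \<i> *\<^sub>C h2 = h"
      by (simp add: h1_def scaleR_scaleC scaleC.scale_right_diff_distrib scaleC_add_right
          flip: scaleC_add_left)
    have real: "Im (\<omega> k) = 0" if "plf \<omega>" "star k = k" for \<omega> k
      using plf_star[OF that(1), of k] that(2) by (metis cnj.sel(2) equal_neg_zero)
    have F: "F (gns_rep \<tau> h) a = of_real (q h1 a) + \<i> * of_real (q h2 a)" for a
    proof -
      have "F (gns_rep \<tau> h) a = \<tau> (star a * (h1 + \<i> *\<^sub>C h2) * a)"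
        by (simp add: F_def gns_rep_vec[OF tau] gns_inner_vec[OF tau] h mult.assoc)
      also have "\<dots> = \<tau> (star a * h1 * a) + \<i> * \<tau> (star a * h2 * a)"
        by (simp add: distrib_left distrib_right plf_add[OF tau] plf_scale[OF tau] mult_scaleC_left mult_scaleC_right)
      finally show ?thesis
        using real[OF plf_conj[OF tau] s1, of a] real[OF plf_conj[OF tau] s2, of a]
        by (simp add: q_def complex_eq_iff)
    qed
    have "g (q h1) = Re (\<kappa> h1)" "g (q h2) = Re (\<kappa> h2)"
      using s1 s2 by (auto intro!: gG simp: G_def)
    moreover have "(\<lambda>a. Re (F (gns_rep \<tau> h) a)) = q h1" "(\<lambda>a. Im (F (gns_rep \<tau> h) a)) = q h2"
      by (auto simp: F)
    moreover have "\<kappa> h = \<kappa> h1 + \<i> * \<kappa> h2"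
      using h plf_add[OF kappa, of h1 "\<i> *\<^sub>C h2"] by (simp add: plf_scale[OF kappa])
    ultimately show ?thesis
      using real[OF kappa s1] real[OF kappa s2] by (simp add: \<phi>_def complex_eq_iff)
  qed
  have "plf_extension \<tau> \<kappa> \<phi>"
    unfolding plf_extension_def op_plf_def
  proof (intro conjI ballI allI)
    note sub = subsetD[OF gns_Linf_bounded[OF tau]]
    show "\<phi> (op_add (gns_space \<tau>) S T) = \<phi> S + \<phi> T" if "S \<in> gns_Linf \<tau>" "T \<in> gns_Linf \<tau>" for S T
      by (rule add[OF sub[OF that(1)] sub[OF that(2)]])
    show "\<phi> (op_scale (gns_space \<tau>) c T) = c * \<phi> T" if "T \<in> gns_Linf \<tau>" for c T
      by (rule scale[OF sub[OF that]])
    show "\<phi> (op_mult (gns_space \<tau>) (op_adj (gns_space \<tau>) T) T) \<in> \<real>\<^sub>\<ge>\<^sub>0" if "T \<in> gns_Linf \<tau>" for T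
      by (rule pos[OF sub[OF that]])
  qed (rule rep)
  then show ?thesis by (rule that)
qed

section \<open>Weak* and pointwise notions compared\<close>

text \<open>Cauchy-Schwarz between \<open>T\<close> and the identity. It passes from vanishing at
  the unit, which the restriction to the represented algebra detects, to vanishing on all of
  \<open>M\<close>.\<close>

lemma (in hilbert_space) op_plf_zero_of_unit:
  assumes plf: "op_plf H M \<psi>" and M: "M \<subseteq> bounded_ops H" and one: "(\<lambda>u\<in>V. u) \<in> M"
    and add: "\<And>S T. S \<in> M \<Longrightarrow> T \<in> M \<Longrightarrow> op_add H S T \<in> M"
    and scale: "\<And>c T. T \<in> M \<Longrightarrow> op_scale H c T \<in> M"
    and mult: "\<And>S T. S \<in> M \<Longrightarrow> T \<in> M \<Longrightarrow> op_mult H S T \<in> M"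
    and adj: "\<And>T. T \<in> M \<Longrightarrow> op_adj H T \<in> M"
    and zero: "\<psi> (\<lambda>u\<in>V. u) = 0" and T: "T \<in> M"
  shows "\<psi> T = 0"
proof -
  let ?I = "\<lambda>u\<in>V. u"
  have \<psi>: "\<psi> (op_add H S T) = \<psi> S + \<psi> T" "\<psi> (op_scale H c T) = c * \<psi> T"
    "\<psi> (op_mult H (op_adj H T) T) \<in> \<real>\<^sub>\<ge>\<^sub>0" if "S \<in> M" "T \<in> M" for S T c
    using plf that by (auto simp: op_plf_def)
  have Tb: "T \<in> bounded_ops H" using T M by blast
  let ?A = "op_mult H (op_adj H T) T"
  have AM: "?A \<in> M" using mult adj T by blast
  \<comment> \<open>Positivity at \<open>T + c\<close>, where the term with the value of
    \<open>\<psi>\<close> at the identity drops out.\<close>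
  have expand: "\<psi> ?A + (c * \<psi> (op_adj H T) + cnj c * \<psi> T) \<in> \<real>\<^sub>\<ge>\<^sub>0" for c
  proof -
    let ?S = "op_add H T (op_scale H c ?I)"
    let ?R = "op_add H ?A (op_add H (op_add H (op_scale H c (op_adj H T)) (op_scale H (cnj c) T)) (op_scale H (c * cnj c) ?I))"
    have SM: "?S \<in> M" by (intro add scale T one)
    then have Sb: "?S \<in> bounded_ops H" using M by blast
    have RM: "?R \<in> M" by (intro add scale T one AM adj)
    have "op_mult H (op_adj H ?S) ?S = ?R"
    proof (rule op_eqI)
      show "op_mult H (op_adj H ?S) ?S \<in> bounded_ops H" "?R \<in> bounded_ops H"
        using op_mult_closed[OF op_adj(1)[OF Sb] Sb] RM M by blast+
      fix u v assume uv: "u \<in> V" "v \<in> V"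
      note cl = bounded_opsD(1)[OF Tb] bounded_opsD(1)[OF op_adj(1)[OF Tb]] bounded_opsD(1)[OF Sb]
      have "inner (op_mult H (op_adj H ?S) ?S u) v = inner (?S u) (?S v)"
        using uv cl(3)[OF uv(1)] inner_op_adj_left[OF Sb, of "?S u" v] by (simp del: op_add_apply)
      also have "\<dots> = inner (?R u) v"
        using uv cl by (simp add: inner_simps inner_op_adj_left[OF Tb] algebra_simps)
      finally show "inner (op_mult H (op_adj H ?S) ?S u) v = inner (?R u) v" .
    qed
    then have "\<psi> ?R \<in> \<real>\<^sub>\<ge>\<^sub>0" using \<psi>(3)[OF SM SM] by simp
    then show ?thesis
      using AM T one adj add scale zero by (simp add: \<psi>)
  qed
  let ?x = "\<psi> (op_adj H T)" and ?y = "\<psi> T"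
  have A: "Im (\<psi> ?A) = 0" "0 \<le> Re (\<psi> ?A)"
    using \<psi>(3)[OF T T] by (simp_all add: complex_nonneg_Reals_iff)
  have xy: "?x = cnj ?y"
    by (rule hermitian_of_real_parts)
       (use expand[of 1] expand[of \<i>] A in \<open>simp_all add: complex_nonneg_Reals_iff\<close>)
  have "(cmod ?x)\<^sup>2 \<le> Re (\<psi> ?A) * 0"
  proof (rule cauchy_schwarz_of_nonneg)
    fix c
    have "Re (cnj c * ?y) = Re (c * ?x)" unfolding xy by simp
    then show "0 \<le> Re (\<psi> ?A) + 2 * Re (c * ?x) + (cmod c)\<^sup>2 * 0"
      using expand[of c] by (simp add: complex_nonneg_Reals_iff)
  qed simp
  then show ?thesis using xy by simp
qed

lemma op_plf_restrict:
  assumes tau: "plf \<tau>" and \<phi>: "op_plf (gns_space \<tau>) (gns_Linf \<tau>) \<phi>"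
  shows "plf (\<lambda>a. \<phi> (gns_rep \<tau> a))"
proof (rule plfI)
  note R = gns_rep_in_Linf[OF tau]
  show "\<phi> (gns_rep \<tau> (a + b)) = \<phi> (gns_rep \<tau> a) + \<phi> (gns_rep \<tau> b)" for a b
    using \<phi> R by (simp add: gns_rep_add[OF tau] op_plf_def)
  show "\<phi> (gns_rep \<tau> (c *\<^sub>C a)) = c * \<phi> (gns_rep \<tau> a)" for c a
    using \<phi> R by (simp add: gns_rep_scale[OF tau] op_plf_def)
  have "\<phi> (gns_rep \<tau> (star a * a)) \<in> \<real>\<^sub>\<ge>\<^sub>0" for a
    using \<phi> R by (simp add: gns_rep_mult[OF tau] gns_rep_adj[OF tau, symmetric] op_plf_def)
  then show "Im (\<phi> (gns_rep \<tau> (star a * a))) = 0" "0 \<le> Re (\<phi> (gns_rep \<tau> (star a * a)))" for a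
    by (simp_all add: complex_nonneg_Reals_iff)
qed

lemma weak_star_continuous_abs_cont:
  assumes tau: "plf \<tau>" and K: "0 < K" "\<And>a. Re (\<tau> (a * star a)) \<le> K * Re (\<tau> (star a * a))"
    and \<phi>: "op_plf (gns_space \<tau>) (gns_Linf \<tau>) \<phi>"
    and cont: "weak_star_continuous (gns_space \<tau>) (gns_Linf \<tau>) \<phi>"
  shows "abs_cont (\<lambda>a. \<phi> (gns_rep \<tau> a)) \<tau>"
proof -
  interpret hilbert_space "gns_space \<tau>" by (rule gns_hilbert[OF tau])
  have "\<exists>\<omega>. normal \<omega> \<and> (\<forall>T\<in>gns_Linf \<tau>. \<phi> T = \<omega> T)"
    by (rule weak_star_continuous_normal[OF gns_Linf_bounded[OF tau] _ _ _ \<phi> cont])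
       (use gns_Linf_closed[OF tau] gns_rep_in_Linf[OF tau] in blast)+
  then obtain \<omega> x y where xy: "normal_form x y \<omega>" and eq: "\<And>T. T \<in> gns_Linf \<tau> \<Longrightarrow> \<phi> T = \<omega> T"
    by (auto simp: normal_def)
  have "normal_functional \<tau> (\<lambda>a. \<phi> (gns_rep \<tau> a)) K x y"
    by unfold_locales
       (use tau K op_plf_restrict[OF tau \<phi>] xy eq gns_rep_in_Linf[OF tau] gns_rep_bounded_op[OF tau]
         in \<open>auto simp: normal_form_def\<close>)
  then show ?thesis by (rule normal_functional.abs_cont)
qed

text \<open>The increments \<open>d n\<close> are dominated by multiples of \<open>\<tau>\<close>,
  hence given by vectors \<open>z n j\<close>. The squared norms of all these vectors add up to the
  value of \<open>\<mu>\<close> at the unit, so together they form one square-summable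
  sequence.\<close>

lemma abs_cont_weak_star:
  fixes \<tau> \<mu> :: "'a::unital_cstar_algebra \<Rightarrow> complex"
  assumes tau: "plf \<tau>" and ac: "abs_cont \<mu> \<tau>"
  shows "weak_star_abs_cont \<mu> \<tau>"
proof -
  interpret hilbert_space "gns_space \<tau>" by (rule gns_hilbert[OF tau])
  obtain m where m: "\<And>n. plf (m n)" "\<And>n. plf_le (m n) (m (Suc n))" "\<And>a. (\<lambda>n. m n a) \<longlonglongrightarrow> \<mu> a"
    "\<And>n. \<exists>t>0. plf_le (m n) (\<lambda>a. of_real t * \<tau> a)"
    using ac by (auto simp: abs_cont_def)
  define d where "d n = (case n of 0 \<Rightarrow> m 0 | Suc k \<Rightarrow> (\<lambda>a. m (Suc k) a - m k a))" for n
  have pd: "plf (d n)" for n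
    using m(1,2) by (cases n) (simp_all add: d_def plf_le_def)
  have led: "\<exists>t>0. plf_le (d n) (\<lambda>a. of_real t * \<tau> a)" for n
  proof (cases n)
    case 0
    then show ?thesis using m(4) by (simp add: d_def)
  next
    case (Suc k)
    obtain t where t: "t > 0" "plf_le (m n) (\<lambda>a. of_real t * \<tau> a)" using m(4) by blast
    have "plf (\<lambda>a. (of_real t * \<tau> a - m n a) + m k a)"
      using plf_plus[OF t(2)[unfolded plf_le_def] m(1)] .
    then have "plf_le (d n) (\<lambda>a. of_real t * \<tau> a)"
      by (simp add: plf_le_def d_def Suc algebra_simps)
    then show ?thesis using t by blast
  qed
  have dsums: "(\<lambda>n. d n a) sums \<mu> a" for a
  proof -
    have "(\<Sum>n<Suc N. d n a) = m N a" for N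
      by (induction N) (simp_all add: d_def)
    then have "(\<lambda>N. \<Sum>n<Suc N. d n a) \<longlonglongrightarrow> \<mu> a" using m(3) by simp
    then show ?thesis unfolding sums_def by (rule LIMSEQ_imp_Suc)
  qed
  have "\<exists>z. (\<forall>j. z j \<in> V) \<and> (\<forall>a. (\<lambda>j. inner (gns_rep \<tau> a (z j)) (z j)) sums d n a)" for n
  proof -
    obtain t where "t > 0" "plf_le (d n) (\<lambda>a. of_real t * \<tau> a)" using led by blast
    then show ?thesis using dominated_vector_representation[OF tau pd, of n t] by metis
  qed
  then obtain z where z: "\<And>n j. z n j \<in> V" "\<And>n a. (\<lambda>j. inner (gns_rep \<tau> a (z n j)) (z n j)) sums d n a"
    by metis
  \<comment> \<open>Evaluation at the unit turns the vector series into a series of squared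
    norms.\<close>
  have nz: "(\<lambda>j. (nrm (z n j))\<^sup>2) sums Re (d n 1)" for n
    using z(2)[of 1 n] unfolding sums_complex_iff
    by (simp add: gns_rep_one[OF tau] z(1) nrm_square)
  have dR: "(\<lambda>n. Re (d n 1)) sums Re (\<mu> 1)"
    using dsums[of 1] unfolding sums_complex_iff by blast
  define w where "w k = z (fst (prod_decode k)) (snd (prod_decode k))" for k
  have w: "range w \<subseteq> V" using z(1) by (auto simp: w_def)
  have "(\<lambda>k. (nrm (w k))\<^sup>2) sums Re (\<mu> 1)"
    unfolding w_def
    by (rule sums_prod_decode[where f = "\<lambda>n j. (nrm (z n j))\<^sup>2" and b = "\<lambda>n j. (nrm (z n j))\<^sup>2" and c = 1,
          OF _ _ _ nz sums_summable[OF dR] nz dR]) simp_all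
  then have sw: "summable (\<lambda>k. (nrm (w k))\<^sup>2)" by (rule sums_summable)
  have wsums: "(\<lambda>k. inner (gns_rep \<tau> a (w k)) (w k)) sums \<mu> a" for a
    unfolding w_def
  proof (rule sums_prod_decode[where f = "\<lambda>n j. inner (gns_rep \<tau> a (z n j)) (z n j)" and c = "norm a",
        OF _ _ _ nz sums_summable[OF dR] z(2) dsums])
    fix n j
    have "norm (inner (gns_rep \<tau> a (z n j)) (z n j)) \<le> nrm (gns_rep \<tau> a (z n j)) * nrm (z n j)"
      using z(1) bounded_opsD(1)[OF gns_rep_bounded_op[OF tau]] by (intro inner_le_nrm) auto
    also have "\<dots> \<le> norm a * nrm (z n j) * nrm (z n j)"
      using gns_rep_norm[OF tau z(1)] z(1) by (intro mult_right_mono) auto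
    finally show "norm (inner (gns_rep \<tau> a (z n j)) (z n j)) \<le> norm a * (nrm (z n j))\<^sup>2"
      by (simp add: power2_eq_square mult.assoc)
  qed simp_all
  define \<phi> where "\<phi> = (\<lambda>T. \<Sum>k. inner (T (w k)) (w k))"
  have "\<phi> (gns_rep \<tau> a) = \<mu> a" for a
    unfolding \<phi>_def by (rule sums_unique[OF wsums, symmetric])
  then show ?thesis
    unfolding weak_star_abs_cont_def plf_extension_def
    using vector_functional[OF w sw gns_Linf_bounded[OF tau] \<phi>_def] by blast
qed

text \<open>A common minorant \<open>\<nu>\<close> has a weak* continuous extension
  \<open>\<psi>\<close>, and \<open>\<mu> - \<nu>\<close> extends to some \<open>\<theta>\<close> by
  the Hahn-Banach argument. Then \<open>\<theta> + \<psi>\<close> extends \<open>\<mu>\<close> and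
  majorizes \<open>\<psi>\<close>, which forces \<open>\<psi>\<close> to vanish.\<close>

lemma weak_star_singular_imp_singular:
  assumes tau: "plf \<tau>" and mu: "plf \<mu>" and null: "null_ideal \<tau> \<subseteq> null_ideal \<mu>"
    and ws: "weak_star_singular \<mu> \<tau>"
  shows "singular \<mu> \<tau>"
  unfolding singular_def
proof (intro allI impI)
  fix \<nu> assume nu: "plf \<nu>" and le1: "plf_le \<nu> \<mu>" and le2: "plf_le \<nu> \<tau>"
  interpret hilbert_space "gns_space \<tau>" by (rule gns_hilbert[OF tau])
  have le2': "plf_le \<nu> (\<lambda>a. of_real 1 * \<tau> a)" using le2 by simp
  obtain z where z: "\<And>n. z n \<in> V" "summable (\<lambda>n. (nrm (z n))\<^sup>2)"
    "\<And>a. (\<lambda>n. inner (gns_rep \<tau> a (z n)) (z n)) sums \<nu> a"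
    by (rule dominated_vector_representation[OF tau nu le2' zero_less_one]) (rule that)
  define \<psi> where "\<psi> = (\<lambda>T. \<Sum>n. inner (T (z n)) (z n))"
  have zV: "range z \<subseteq> V" using z by blast
  have \<psi>: "op_plf (gns_space \<tau>) (gns_Linf \<tau>) \<psi>" "weak_star_continuous (gns_space \<tau>) (gns_Linf \<tau>) \<psi>"
    using vector_functional[OF zV z(2) gns_Linf_bounded[OF tau] \<psi>_def] by blast+
  have \<psi>_rep: "\<psi> (gns_rep \<tau> a) = \<nu> a" for a
    unfolding \<psi>_def by (rule sums_unique[OF z(3), symmetric])
  let ?\<kappa> = "\<lambda>a. \<mu> a - \<nu> a"
  have kappa: "plf ?\<kappa>" using le1 by (simp add: plf_le_def)
  have "null_ideal \<tau> \<subseteq> null_ideal ?\<kappa>"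
  proof
    fix a assume "a \<in> null_ideal \<tau>"
    then have "\<mu> (star a * a) = 0" using null by (auto simp: null_ideal_def)
    then show "a \<in> null_ideal ?\<kappa>"
      using plf_nonneg[OF nu, of a] plf_nonneg[OF kappa, of a] by (simp add: null_ideal_def complex_eq_iff)
  qed
  then obtain \<theta> where \<theta>: "plf_extension \<tau> ?\<kappa> \<theta>"
    using plf_extension_exists[OF tau kappa] by blast
  have sum: "op_plf (gns_space \<tau>) (gns_Linf \<tau>) (\<lambda>T. \<theta> T + \<psi> T)"
    using \<theta> \<psi>(1) by (simp add: plf_extension_def op_plf_def algebra_simps nonneg_Reals_add_I)
  have ext: "plf_extension \<tau> \<mu> (\<lambda>T. \<theta> T + \<psi> T)"
    using sum \<theta> by (simp add: plf_extension_def \<psi>_rep)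
  have le: "op_plf_le (gns_space \<tau>) (gns_Linf \<tau>) \<psi> (\<lambda>T. \<theta> T + \<psi> T)"
    using \<theta> by (simp add: op_plf_le_def plf_extension_def)
  have "\<psi> T = 0" if "T \<in> gns_Linf \<tau>" for T
    using ws ext le \<psi> that unfolding weak_star_singular_def by blast
  then show "\<nu> = (\<lambda>_. 0)"
    using gns_rep_in_Linf[OF tau] \<psi>_rep by (metis (no_types))
qed

text \<open>The restriction of a weak* continuous minorant is absolutely continuous, hence a limit
  of functionals dominated by multiples of \<open>\<tau>\<close>. Scaled down, each of these is a
  common minorant of \<open>\<mu>\<close> and \<open>\<tau>\<close> and must vanish.\<close>

lemma singular_imp_weak_star_singular:
  assumes tau: "plf \<tau>" and mu: "plf \<mu>"
    and K: "0 < K" "\<And>a. Re (\<tau> (a * star a)) \<le> K * Re (\<tau> (star a * a))"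
    and sing: "singular \<mu> \<tau>"
  shows "weak_star_singular \<mu> \<tau>"
  unfolding weak_star_singular_def
proof (intro notI, elim exE conjE)
  fix \<phi> \<psi>
  assume ext: "plf_extension \<tau> \<mu> \<phi>" and \<psi>: "op_plf (gns_space \<tau>) (gns_Linf \<tau>) \<psi>"
    and cont: "weak_star_continuous (gns_space \<tau>) (gns_Linf \<tau>) \<psi>"
    and ne: "\<exists>T\<in>gns_Linf \<tau>. \<psi> T \<noteq> 0" and le: "op_plf_le (gns_space \<tau>) (gns_Linf \<tau>) \<psi> \<phi>"
  interpret hilbert_space "gns_space \<tau>" by (rule gns_hilbert[OF tau])
  define \<nu> where "\<nu> a = \<psi> (gns_rep \<tau> a)" for a
  have nu: "plf \<nu>" unfolding \<nu>_def by (rule op_plf_restrict[OF tau \<psi>])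
  have diff: "plf (\<lambda>a. \<mu> a - \<nu> a)"
    using op_plf_restrict[OF tau le[unfolded op_plf_le_def]] ext by (simp add: plf_extension_def \<nu>_def)
  have "abs_cont \<nu> \<tau>"
    using weak_star_continuous_abs_cont[OF tau K \<psi> cont] by (simp add: \<nu>_def[abs_def])
  then obtain m where m: "\<And>n. plf (m n)" "\<And>n. plf_le (m n) (m (Suc n))" "\<And>a. (\<lambda>n. m n a) \<longlonglongrightarrow> \<nu> a"
    "\<And>n. \<exists>t>0. plf_le (m n) (\<lambda>a. of_real t * \<tau> a)"
    by (auto simp: abs_cont_def)
  have "m n = (\<lambda>_. 0)" for n
  proof -
    obtain t where t: "t > 0" "plf_le (m n) (\<lambda>a. of_real t * \<tau> a)" using m(4) by blast
    \<comment> \<open>\<open>s \<le> 1\<close> keeps \<open>?m\<close> below \<open>\<mu>\<close>,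
      and \<open>s * t \<le> 1\<close> keeps it below \<open>\<tau>\<close>.\<close>
    define s where "s = 1 / max t 1"
    have s: "0 < s" "s \<le> 1" "s * t \<le> 1" using t by (auto simp: s_def divide_le_eq)
    let ?m = "\<lambda>a. of_real s * m n a"
    have pm: "plf ?m" by (rule plf_scale_pos[OF m(1)]) (use s in simp)
    have le_nu: "Re (m n (star a * a)) \<le> Re (\<nu> (star a * a))" for a
    proof (rule incseq_le)
      show "incseq (\<lambda>n. Re (m n (star a * a)))"
        using m(2) plf_nonneg(1) unfolding plf_le_def by (intro incseq_SucI) fastforce
      show "(\<lambda>n. Re (m n (star a * a))) \<longlonglongrightarrow> Re (\<nu> (star a * a))"
        by (intro tendsto_intros m)
    qed
    have "plf_le ?m \<mu>"
      unfolding plf_le_def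
    proof (rule plfI)
      fix a
      have "s * Re (m n (star a * a)) \<le> 1 * Re (m n (star a * a))"
        using s plf_nonneg(1)[OF m(1)] by (intro mult_right_mono) auto
      then show "0 \<le> Re (\<mu> (star a * a) - of_real s * m n (star a * a))"
        using le_nu[of a] plf_nonneg(1)[OF diff, of a] by simp
      show "Im (\<mu> (star a * a) - of_real s * m n (star a * a)) = 0"
        using plf_nonneg(2)[OF mu, of a] plf_nonneg(2)[OF m(1), of n a] by simp
    qed (simp_all add: plf_add[OF mu] plf_add[OF m(1)] plf_scale[OF mu] plf_scale[OF m(1)] algebra_simps)
    moreover have "plf_le ?m \<tau>"
      unfolding plf_le_def
    proof (rule plfI)
      fix a
      have "Re (m n (star a * a)) \<le> t * Re (\<tau> (star a * a))"
        using plf_nonneg(1)[OF t(2)[unfolded plf_le_def], of a] by simp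
      then have "s * Re (m n (star a * a)) \<le> (s * t) * Re (\<tau> (star a * a))"
        using s by (simp add: mult.assoc)
      also have "\<dots> \<le> 1 * Re (\<tau> (star a * a))"
        using s plf_nonneg(1)[OF tau] by (intro mult_right_mono) auto
      finally show "0 \<le> Re (\<tau> (star a * a) - of_real s * m n (star a * a))" by simp
      show "Im (\<tau> (star a * a) - of_real s * m n (star a * a)) = 0"
        using plf_nonneg(2)[OF tau, of a] plf_nonneg(2)[OF m(1), of n a] by simp
    qed (simp_all add: plf_add[OF tau] plf_add[OF m(1)] plf_scale[OF tau] plf_scale[OF m(1)] algebra_simps)
    ultimately have "?m = (\<lambda>_. 0)"
      using sing pm unfolding singular_def by blast
    then show ?thesis using s by (simp add: fun_eq_iff)
  qed
  then have "\<nu> a = 0" for a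
    using LIMSEQ_unique[OF m(3)[of a]] by simp
  then have unit: "\<psi> (\<lambda>u\<in>V. u) = 0"
    by (simp add: \<nu>_def flip: gns_rep_one[OF tau])
  have "\<psi> T = 0" if "T \<in> gns_Linf \<tau>" for T
  proof (rule op_plf_zero_of_unit[OF \<psi> gns_Linf_bounded[OF tau] _ _ _ _ _ unit that])
    show "(\<lambda>u\<in>V. u) \<in> gns_Linf \<tau>"
      using gns_rep_in_Linf[OF tau, of 1] by (simp add: gns_rep_one[OF tau])
  qed (use gns_Linf_closed[OF tau] gns_Linf_adj[OF tau] in blast)+
  then show False using ne by blast
qed

theorem theorem4:
  fixes \<sigma> :: "real \<Rightarrow> 'a::unital_cstar_algebra \<Rightarrow> 'a"
    and \<mu> lam :: "'a \<Rightarrow> complex"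
  assumes "cstar_dynamical_system \<sigma>"
    and "plf \<mu>" and "plf lam"
    and "null_ideal lam \<subseteq> null_ideal \<mu>"
    and "kms_plf \<sigma> lam"
  shows "(weak_star_abs_cont \<mu> lam \<longleftrightarrow> abs_cont \<mu> lam) \<and>
         (weak_star_singular \<mu> lam \<longleftrightarrow> singular \<mu> lam)"
proof -
  \<comment> \<open>The witness is the value at \<open>\<i>\<close> of the strip extension of
    \<open>a\<close>.\<close>
  have "\<exists>d. \<forall>b. lam (a * b) = lam (b * d)" for a
    using assms(5) unfolding kms_plf_def by blast
  then obtain K where K: "0 < K" "\<And>a. Re (lam (a * star a)) \<le> K * Re (lam (star a * a))"
    using twisted_trace_almost_tracial[OF assms(3)] by metis
  have "abs_cont \<mu> lam" if ac: "weak_star_abs_cont \<mu> lam"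
  proof -
    obtain \<phi> where \<phi>: "plf_extension lam \<mu> \<phi>" "weak_star_continuous (gns_space lam) (gns_Linf lam) \<phi>"
      using ac by (auto simp: weak_star_abs_cont_def)
    then show ?thesis
      using weak_star_continuous_abs_cont[OF assms(3) K, of \<phi>] by (simp add: plf_extension_def)
  qed
  then show ?thesis
    using abs_cont_weak_star[OF assms(3)] weak_star_singular_imp_singular[OF assms(3,2,4)]
      singular_imp_weak_star_singular[OF assms(3,2) K] by blast
qed

end
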